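(* Let $\mathfrak a\subset\mathfrak p$ be a maximal Abelian subalgebra, let $P=\mu_{\mathfrak a}(\mathbb P(V))=\mu_{\mathfrak a}(\mathcal O)$, let $\mathscr F(P)$ be the set of (nonempty) faces of the polytope $P$, and let $\mathcal W=N_K(\mathfrak a)/K^{\mathfrak a}$ be the Weyl group, acting on $\mathscr F(P)$. There exists a bijection between $\mathscr F(P)/\mathcal W$ and the set of irreducible representations of parabolic subgroups of $G$ induced by $\tau$, up to equivalence.
   Context: Setting: $G$ is a connected noncompact real semisimple Lie group with finite center, $K\subset G$ a maximal compact subgroup, $\mathfrak g=\mathfrak k\oplus\mathfrak p$ the corresponding Cartan decomposition, and $\tau:G\to \mathrm{SL}(V)$ an irreducible representation on a finite-dimensional complex vector space $V$. $h$ is a Hermitian scalar product on $V$ such that $\tau(G)$ is compatible with $\mathrm{SU}(V,h)^{\mathbb C}$, i.e. $\tau(K)\subset \mathrm{SU}(V,h)$, $\tau(\mathfrak p)\subset i\,\mathfrak{su}(V,h)$ and $\tau(G)=\tau(K)\exp(\tau(\mathfrak p))$. $G$ is identified with $\tau(G)$; elements of $\mathfrak p$ are thus Hermitian endomorphisms of $V$, and $G$ acts on $\mathbb P(V)$. Gradient map: fix an $\mathrm{Ad}(K)$-invariant scalar product $\langle\cdot,\cdot\rangle$ on $\mathfrak p$. The $G$-gradient map $\mu_{\mathfrak p}:\mathbb P(V)\to\mathfrak p$ is determined by $\langle\mu_{\mathfrak p}([v]),\beta\rangle=h(\beta v,v)/h(v,v)$ for all $\beta\in\mathfrak p$; $\mu_{\mathfrak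 a}=\pi_{\mathfrak a}\circ\mu_{\mathfrak p}$ with $\pi_{\mathfrak a}:\mathfrak p\to\mathfrak a$ the orthogonal projection. The orbit $\mathcal O$: let $U^{\mathbb C}$ be the Zariski closure of $\tau(G)$ in $\mathrm{SL}(V)$; it is complex semisimple, acts irreducibly on $V$, and has a unique closed orbit $\mathcal O'$ in $\mathbb P(V)$. $\mathcal O$ is the unique closed $G$-orbit contained in $\mathcal O'$; it is a $K$-orbit. Weyl group: $N_K(\mathfrak a)=\{k\in K:\mathrm{Ad}(k)\mathfrak a=\mathfrak a\}$, $K^{\mathfrak a}=\{k\in K:\mathrm{Ad}(k)z=z\ \forall z\in\mathfrak a\}$. Parabolic subgroups of $G$ are the subgroups $G^{\beta+}=\{g\in G:\lim_{t\to-\infty}\exp(t\beta)g\exp(-t\beta)\text{ exists}\}$, $\beta\in\mathfrak p$. Each parabolic $Q$ preserves and acts irreducibly on exactly one nonzero complex subspace of $V$. An irreducible representation of a parabolic subgroup of $G$ induced by $\tau$ is a pair $(Q,W)$ with $Q\subset G$ parabolic and $W\subset V$ the nonzero complex subspace preserved by $Q$ on which $Q$ acts irreducibly. Equivalence is up to the action of $K$: $(Q,W)$ and $(Q',W')$ are equivalent if $W'=kW$ for some $k\in K$ (parabolic subgroups with the same irreducible subspace $W$ are thus identified; each such $Q$ is contained in the stabilizer of $W$). *)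

theory Defs
  imports "HOL-Analysis.Analysis" "HOL-Algebra.Group"
begin

text \<open>On an open set \<open>S\<close>, \<open>Ck k S f\<close> says that \<open>f\<close> is of class $C^k$:
  all directional derivatives are of class $C^{k-1}$.\<close>

fun Ck :: "nat \<Rightarrow> 'a::euclidean_space set \<Rightarrow> ('a \<Rightarrow> 'b::euclidean_space) \<Rightarrow> bool" where
  "Ck 0 S f \<longleftrightarrow> continuous_on S f"
| "Ck (Suc k) S f \<longleftrightarrow>
     f differentiable_on S \<and> (\<forall>v. Ck k S (\<lambda>x. frechet_derivative f (at x) v))"

definition smooth_on :: "'a::euclidean_space set \<Rightarrow> ('a \<Rightarrow> 'b::euclidean_space) \<Rightarrow> bool" where
  "smooth_on S f \<longleftrightarrow> (\<forall>k. Ck k S f)"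

text \<open>A chart is a pair of a domain and a map; outside its domain the map is arbitrary.\<close>

type_synonym ('g, 'e) chart = "'g set \<times> ('g \<Rightarrow> 'e)"

definition chart_inv :: "('g, 'e) chart \<Rightarrow> 'e \<Rightarrow> 'g" where
  "chart_inv c = inv_into (fst c) (snd c)"

definition smooth_atlas ::
    "('g::topological_space, 'e::euclidean_space) chart set \<Rightarrow> bool" where
  "smooth_atlas A \<longleftrightarrow>
     (\<Union>c\<in>A. fst c) = UNIV \<and>
     (\<forall>c\<in>A. open (fst c) \<and> open (snd c ` fst c) \<and>
        homeomorphism (fst c) (snd c ` fst c) (snd c) (chart_inv c)) \<and>
     (\<forall>c\<in>A. \<forall>d\<in>A. smooth_on (snd c ` (fst c \<inter> fst d)) (snd d \<circ> chart_inv c))"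

definition smooth_map ::
    "('g::topological_space, 'e::euclidean_space) chart set \<Rightarrow>
     ('f::topological_space, 'd::euclidean_space) chart set \<Rightarrow> ('g \<Rightarrow> 'f) \<Rightarrow> bool" where
  "smooth_map A B f \<longleftrightarrow> continuous_on UNIV f \<and>
     (\<forall>c\<in>A. \<forall>d\<in>B. smooth_on (snd c ` (fst c \<inter> f -` fst d)) (snd d \<circ> f \<circ> chart_inv c))"

definition prod_atlas ::
    "('g, 'e) chart set \<Rightarrow> ('f, 'd) chart set \<Rightarrow> ('g \<times> 'f, 'e \<times> 'd) chart set" where
  "prod_atlas A B = {(fst c \<times> fst d, map_prod (snd c) (snd d)) | c d. c \<in> A \<and> d \<in> B}"

definition lie_group ::
    "'g::{t2_space,second_countable_topology} monoid \<Rightarrow>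
     ('g, 'e::euclidean_space) chart set \<Rightarrow> bool" where
  "lie_group G A \<longleftrightarrow> group G \<and> carrier G = UNIV \<and> smooth_atlas A \<and>
     smooth_map (prod_atlas A A) A (\<lambda>(x, y). x \<otimes>\<^bsub>G\<^esub> y) \<and>
     smooth_map A A (\<lambda>x. inv\<^bsub>G\<^esub> x)"

text \<open>The Lie algebra is the tangent space at the identity, identified with the model space
  \<open>'e\<close> through a fixed chart \<open>c\<close> around the identity. The adjoint action is the derivative of
  conjugation, and the bracket is the derivative of the adjoint action.\<close>

definition Ad :: "'g monoid \<Rightarrow> ('g, 'e::euclidean_space) chart \<Rightarrow> 'g \<Rightarrow> 'e \<Rightarrow> 'e" where
  "Ad G c g = frechet_derivative
     (\<lambda>x. snd c (g \<otimes>\<^bsub>G\<^esub> chart_inv c x \<otimes>\<^bsub>G\<^esub> inv\<^bsub>G\<^esub> g)) (at (snd c \<one>\<^bsub>G\<^esub>))"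

definition lie_bracket :: "'g monoid \<Rightarrow> ('g, 'e::euclidean_space) chart \<Rightarrow> 'e \<Rightarrow> 'e \<Rightarrow> 'e" where
  "lie_bracket G c X Y =
     frechet_derivative (\<lambda>x. Ad G c (chart_inv c x) Y) (at (snd c \<one>\<^bsub>G\<^esub>)) X"

definition lie_subalgebra_of ::
    "'g::topological_space monoid \<Rightarrow> ('g, 'e::euclidean_space) chart \<Rightarrow> 'g set \<Rightarrow> 'e set" where
  "lie_subalgebra_of G c H = {X. \<exists>\<gamma> :: real \<Rightarrow> 'g. continuous_on UNIV \<gamma> \<and>
     (\<forall>s t. \<gamma> (s + t) = \<gamma> s \<otimes>\<^bsub>G\<^esub> \<gamma> t) \<and> range \<gamma> \<subseteq> H \<and>
     ((snd c \<circ> \<gamma>) has_vector_derivative X) (at 0)}"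

definition lie_ideal :: "('e::euclidean_space \<Rightarrow> 'e \<Rightarrow> 'e) \<Rightarrow> 'e set \<Rightarrow> bool" where
  "lie_ideal br I \<longleftrightarrow> subspace I \<and> (\<forall>X. \<forall>Y\<in>I. br X Y \<in> I)"

definition lie_derived :: "('e::euclidean_space \<Rightarrow> 'e \<Rightarrow> 'e) \<Rightarrow> 'e set \<Rightarrow> 'e set" where
  "lie_derived br S = span {br X Y | X Y. X \<in> S \<and> Y \<in> S}"

definition lie_solvable :: "('e::euclidean_space \<Rightarrow> 'e \<Rightarrow> 'e) \<Rightarrow> 'e set \<Rightarrow> bool" where
  "lie_solvable br S \<longleftrightarrow> (\<exists>k. (lie_derived br ^^ k) S = {0})"

definition lie_semisimple :: "('e::euclidean_space \<Rightarrow> 'e \<Rightarrow> 'e) \<Rightarrow> bool" where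
  "lie_semisimple br \<longleftrightarrow> (\<forall>I. lie_ideal br I \<and> lie_solvable br I \<longrightarrow> I = {0})"

text \<open>The trace of $\mathrm{ad}\,X\circ\mathrm{ad}\,Y$, computed in an orthonormal basis of the
  model space.\<close>

definition killing_form :: "('e::euclidean_space \<Rightarrow> 'e \<Rightarrow> 'e) \<Rightarrow> 'e \<Rightarrow> 'e \<Rightarrow> real" where
  "killing_form br X Y = (\<Sum>b\<in>Basis. br X (br Y b) \<bullet> b)"

definition cartan_decomposition ::
    "('e::euclidean_space \<Rightarrow> 'e \<Rightarrow> 'e) \<Rightarrow> 'e set \<Rightarrow> 'e set \<Rightarrow> bool" where
  "cartan_decomposition br k p \<longleftrightarrow> subspace k \<and> subspace p \<and> k \<inter> p = {0} \<and>
     {X + Y | X Y. X \<in> k \<and> Y \<in> p} = UNIV \<and>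
     (\<forall>X\<in>k. \<forall>Y\<in>k. br X Y \<in> k) \<and> (\<forall>X\<in>k. \<forall>Y\<in>p. br X Y \<in> p) \<and> (\<forall>X\<in>p. \<forall>Y\<in>p. br X Y \<in> k) \<and>
     (\<forall>X\<in>k. X \<noteq> 0 \<longrightarrow> killing_form br X X < 0) \<and>
     (\<forall>X\<in>p. X \<noteq> 0 \<longrightarrow> killing_form br X X > 0)"

definition maximal_compact_subgroup :: "'g::topological_space monoid \<Rightarrow> 'g set \<Rightarrow> bool" where
  "maximal_compact_subgroup G K \<longleftrightarrow> subgroup K G \<and> compact K \<and>
     (\<forall>L. subgroup L G \<and> compact L \<and> K \<subseteq> L \<longrightarrow> L = K)"

definition group_center :: "'g monoid \<Rightarrow> 'g set" where
  "group_center G = {z \<in> carrier G. \<forall>g\<in>carrier G. z \<otimes>\<^bsub>G\<^esub> g = g \<otimes>\<^bsub>G\<^esub> z}"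

definition preserves :: "(complex^'n^'n) set \<Rightarrow> (complex^'n) set \<Rightarrow> bool" where
  "preserves S W \<longleftrightarrow> (\<forall>g\<in>S. \<forall>w\<in>W. g *v w \<in> W)"

definition acts_irreducibly :: "(complex^'n^'n) set \<Rightarrow> (complex^'n) set \<Rightarrow> bool" where
  "acts_irreducibly S W \<longleftrightarrow> vec.subspace W \<and> W \<noteq> {0} \<and> preserves S W \<and>
     (\<forall>U. vec.subspace U \<and> U \<subseteq> W \<and> preserves S U \<longrightarrow> U = {0} \<or> U = W)"

definition irreducible_SL_representation ::
    "'g::topological_space monoid \<Rightarrow> ('g, 'e::euclidean_space) chart set \<Rightarrow>
     ('g \<Rightarrow> complex^'n^'n) \<Rightarrow> bool" where
  "irreducible_SL_representation G A \<tau> \<longleftrightarrow>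
     smooth_map A {(UNIV, id)} \<tau> \<and>
     (\<forall>x\<in>carrier G. \<forall>y\<in>carrier G. \<tau> (x \<otimes>\<^bsub>G\<^esub> y) = \<tau> x ** \<tau> y) \<and>
     (\<forall>x\<in>carrier G. det (\<tau> x) = 1) \<and>
     acts_irreducibly (\<tau> ` carrier G) UNIV"

definition rep_derivative ::
    "'g monoid \<Rightarrow> ('g, 'e::euclidean_space) chart \<Rightarrow> ('g \<Rightarrow> complex^'n^'n) \<Rightarrow>
     'e \<Rightarrow> complex^'n^'n" where
  "rep_derivative G c \<tau> = frechet_derivative (\<tau> \<circ> chart_inv c) (at (snd c \<one>\<^bsub>G\<^esub>))"

text \<open>\<open>V\<close> is \<open>complex^'n\<close> with an arbitrary Hermitian product. From here on \<open>G\<close>, \<open>K\<close>, \<open>p\<close> denote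
  the images in the endomorphisms of \<open>V\<close>. \<open>exp\<close> of the library is not available on matrices, whose \<open>*\<close> is componentwise.\<close>

definition mexp :: "complex^'n^'n \<Rightarrow> complex^'n^'n" where
  "mexp X = (\<Sum>k. (1 / fact k) *\<^sub>R (((**) X ^^ k) (mat 1)))"

definition hermitian_product :: "(complex^'n \<Rightarrow> complex^'n \<Rightarrow> complex) \<Rightarrow> bool" where
  "hermitian_product h \<longleftrightarrow>
     (\<forall>u v w. h (u + v) w = h u w + h v w) \<and> (\<forall>z v w. h (z *s v) w = z * h v w) \<and>
     (\<forall>v w. h w v = cnj (h v w)) \<and> (\<forall>v. v \<noteq> 0 \<longrightarrow> Re (h v v) > 0)"

definition SU :: "(complex^'n \<Rightarrow> complex^'n \<Rightarrow> complex) \<Rightarrow> (complex^'n^'n) set" where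
  "SU h = {g. det g = 1 \<and> (\<forall>v w. h (g *v v) (g *v w) = h v w)}"

definition su :: "(complex^'n \<Rightarrow> complex^'n \<Rightarrow> complex) \<Rightarrow> (complex^'n^'n) set" where
  "su h = {X. trace X = 0 \<and> (\<forall>v w. h (X *v v) w + h v (X *v w) = 0)}"

definition compatible ::
    "(complex^'n \<Rightarrow> complex^'n \<Rightarrow> complex) \<Rightarrow>
     (complex^'n^'n) set \<Rightarrow> (complex^'n^'n) set \<Rightarrow> (complex^'n^'n) set \<Rightarrow> bool" where
  "compatible h G K p \<longleftrightarrow> K \<subseteq> SU h \<and> p \<subseteq> (\<lambda>X. mat \<i> ** X) ` su h \<and>
     G = {k ** mexp \<beta> | k \<beta>. k \<in> K \<and> \<beta> \<in> p}"

definition conj_by :: "complex^'n^'n \<Rightarrow> complex^'n^'n \<Rightarrow> complex^'n^'n" where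
  "conj_by k X = k ** X ** matrix_inv k"

definition invariant_scalar_product ::
    "(complex^'n^'n) set \<Rightarrow> (complex^'n^'n) set \<Rightarrow>
     (complex^'n^'n \<Rightarrow> complex^'n^'n \<Rightarrow> real) \<Rightarrow> bool" where
  "invariant_scalar_product K p s \<longleftrightarrow>
     (\<forall>X\<in>p. \<forall>Y\<in>p. \<forall>Z\<in>p. s (X + Y) Z = s X Z + s Y Z) \<and>
     (\<forall>r. \<forall>X\<in>p. \<forall>Y\<in>p. s (r *\<^sub>R X) Y = r * s X Y) \<and>
     (\<forall>X\<in>p. \<forall>Y\<in>p. s X Y = s Y X) \<and> (\<forall>X\<in>p. X \<noteq> 0 \<longrightarrow> s X X > 0) \<and>
     (\<forall>k\<in>K. \<forall>X\<in>p. \<forall>Y\<in>p. s (conj_by k X) (conj_by k Y) = s X Y)"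

text \<open>Points of \<open>P(V)\<close> are the complex lines in \<open>V\<close>.\<close>

definition proj_space :: "(complex^'n) set set" where
  "proj_space = {vec.span {v} | v. v \<noteq> 0}"

definition gradient_map ::
    "(complex^'n \<Rightarrow> complex^'n \<Rightarrow> complex) \<Rightarrow> (complex^'n^'n) set \<Rightarrow>
     (complex^'n^'n \<Rightarrow> complex^'n^'n \<Rightarrow> real) \<Rightarrow> (complex^'n) set \<Rightarrow> complex^'n^'n" where
  "gradient_map h p s x = (THE m. m \<in> p \<and>
     (\<forall>v\<in>x - {0}. \<forall>\<beta>\<in>p. complex_of_real (s m \<beta>) = h (\<beta> *v v) v / h v v))"

definition orth_proj ::
    "(complex^'n^'n \<Rightarrow> complex^'n^'n \<Rightarrow> real) \<Rightarrow> (complex^'n^'n) set \<Rightarrow>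
     complex^'n^'n \<Rightarrow> complex^'n^'n" where
  "orth_proj s a X = (THE Y. Y \<in> a \<and> (\<forall>Z\<in>a. s (X - Y) Z = 0))"

definition abelian_gradient_map ::
    "(complex^'n \<Rightarrow> complex^'n \<Rightarrow> complex) \<Rightarrow> (complex^'n^'n) set \<Rightarrow>
     (complex^'n^'n \<Rightarrow> complex^'n^'n \<Rightarrow> real) \<Rightarrow> (complex^'n^'n) set \<Rightarrow>
     (complex^'n) set \<Rightarrow> complex^'n^'n" where
  "abelian_gradient_map h p s a = orth_proj s a \<circ> gradient_map h p s"

definition abelian_subalgebra :: "(complex^'n^'n) set \<Rightarrow> bool" where
  "abelian_subalgebra a \<longleftrightarrow> subspace a \<and> (\<forall>X\<in>a. \<forall>Y\<in>a. X ** Y - Y ** X = 0)"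

definition maximal_abelian_in :: "(complex^'n^'n) set \<Rightarrow> (complex^'n^'n) set \<Rightarrow> bool" where
  "maximal_abelian_in p a \<longleftrightarrow> a \<subseteq> p \<and> abelian_subalgebra a \<and>
     (\<forall>b. b \<subseteq> p \<and> abelian_subalgebra b \<and> a \<subseteq> b \<longrightarrow> b = a)"

inductive polynomial_fun :: "(complex^'n^'n \<Rightarrow> complex) \<Rightarrow> bool" where
  const: "polynomial_fun (\<lambda>X. z)"
| entry: "polynomial_fun (\<lambda>X. X $ i $ j)"
| add: "polynomial_fun f \<Longrightarrow> polynomial_fun g \<Longrightarrow> polynomial_fun (\<lambda>X. f X + g X)"
| mult: "polynomial_fun f \<Longrightarrow> polynomial_fun g \<Longrightarrow> polynomial_fun (\<lambda>X. f X * g X)"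

definition zariski_closure_SL :: "(complex^'n^'n) set \<Rightarrow> (complex^'n^'n) set" where
  "zariski_closure_SL S = {g. det g = 1 \<and>
     (\<forall>f. polynomial_fun f \<and> (\<forall>s\<in>S. f s = 0) \<longrightarrow> f g = 0)}"

text \<open>Closedness refers to the quotient topology on \<open>P(V)\<close>.\<close>

definition closed_in_proj :: "(complex^'n) set set \<Rightarrow> bool" where
  "closed_in_proj S \<longleftrightarrow> S \<subseteq> proj_space \<and>
     closedin (top_of_set (- {0})) {v. v \<noteq> 0 \<and> vec.span {v} \<in> S}"

definition proj_orbit ::
    "(complex^'n^'n) set \<Rightarrow> (complex^'n) set \<Rightarrow> (complex^'n) set set" where
  "proj_orbit H x = {(*v) g ` x | g. g \<in> H}"

definition closed_orbit :: "(complex^'n^'n) set \<Rightarrow> (complex^'n) set set \<Rightarrow> bool" where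
  "closed_orbit H S \<longleftrightarrow> (\<exists>x\<in>proj_space. S = proj_orbit H x) \<and> closed_in_proj S"

definition nonempty_faces :: "'a::real_vector set \<Rightarrow> 'a set set" where
  "nonempty_faces P = {F. F face_of P \<and> F \<noteq> {}}"

definition normalizer_in :: "(complex^'n^'n) set \<Rightarrow> (complex^'n^'n) set \<Rightarrow> (complex^'n^'n) set" where
  "normalizer_in K a = {k \<in> K. conj_by k ` a = a}"

definition centralizer_in :: "(complex^'n^'n) set \<Rightarrow> (complex^'n^'n) set \<Rightarrow> (complex^'n^'n) set" where
  "centralizer_in K a = {k \<in> K. \<forall>z\<in>a. conj_by k z = z}"

definition weyl_group ::
    "(complex^'n^'n) set \<Rightarrow> (complex^'n^'n) set \<Rightarrow> (complex^'n^'n) set set" where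
  "weyl_group K a = (\<lambda>k. (\<lambda>z. k ** z) ` centralizer_in K a) ` normalizer_in K a"

text \<open>All representatives of a coset act in the same way on subsets of \<open>a\<close>, so the union below
  is just the image under any one of them.\<close>

definition weyl_act ::
    "(complex^'n^'n) set \<Rightarrow> (complex^'n^'n) set \<Rightarrow> (complex^'n^'n) set" where
  "weyl_act w F = (\<Union>k\<in>w. conj_by k ` F)"

definition faces_mod_weyl ::
    "(complex^'n^'n) set \<Rightarrow> (complex^'n^'n) set \<Rightarrow> (complex^'n^'n) set \<Rightarrow>
     (complex^'n^'n) set set set" where
  "faces_mod_weyl K a P = (\<lambda>F. (\<lambda>w. weyl_act w F) ` weyl_group K a) ` nonempty_faces P"

definition parabolic ::
    "(complex^'n^'n) set \<Rightarrow> complex^'n^'n \<Rightarrow> (complex^'n^'n) set" where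
  "parabolic G \<beta> = {g \<in> G. \<exists>l\<in>G.
     ((\<lambda>t. mexp (t *\<^sub>R \<beta>) ** g ** mexp (- t *\<^sub>R \<beta>)) \<longlongrightarrow> l) at_bot}"

definition parabolic_irreps ::
    "(complex^'n^'n) set \<Rightarrow> (complex^'n^'n) set \<Rightarrow>
     ((complex^'n^'n) set \<times> (complex^'n) set) set" where
  "parabolic_irreps G p = {(Q, W). (\<exists>\<beta>\<in>p. Q = parabolic G \<beta>) \<and> acts_irreducibly Q W}"

definition irrep_equiv ::
    "(complex^'n^'n) set \<Rightarrow> (complex^'n^'n) set \<Rightarrow> (complex^'n^'n) set \<Rightarrow>
     (((complex^'n^'n) set \<times> (complex^'n) set) \<times> ((complex^'n^'n) set \<times> (complex^'n) set)) set" where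
  "irrep_equiv G K p = {((Q, W), (Q', W')).
     (Q, W) \<in> parabolic_irreps G p \<and> (Q', W') \<in> parabolic_irreps G p \<and>
     (\<exists>k\<in>K. W' = (*v) k ` W)}"

end

theory Submission
  imports Defs
begin

text \<open>
  Identify \<open>G\<close> with its image \<open>K exp(p)\<close> in \<open>SL(V)\<close>. The elements of \<open>a\<close> are commuting self-adjoint
  operators, so \<open>V\<close> has an orthonormal basis of weight vectors \<open>b i\<close>, and \<open>\<mu>\<^sub>a[v]\<close> is the average of
  the weights with respect to the masses \<open>|v i|\<^sup>2\<close> of the coefficients of \<open>v\<close>. Hence \<open>P\<close> is the convex hull of
  the weights.

  \<^bold>\<open>The closed orbit already maps onto \<open>P\<close>.\<close> Some \<open>[v]\<close> in the orbit has all coefficients nonzero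
  (\<open>generic_orbit_point\<close>): otherwise the orbit is covered by finitely many hyperplanes, and a subspace of
  least dimension that contains an open piece of the orbit is invariant under a neighbourhood
  of \<open>1\<close>, hence under the connected group \<open>G\<close>, against irreducibility. To reach the point with
  barycentric coordinates \<open>u\<close>, maximise \<open>\<Prod> |v i|\<^bsup>2 u i\<^esup> / |v|\<^sup>2\<close> over the compact orbit; that the
  derivative along \<open>exp a\<close> vanishes says exactly that \<open>\<mu>\<^sub>a[v]\<close> is that point
  (\<open>polytope_attained_on_invariant_cone\<close>).

  \<^bold>\<open>Faces give irreducible representations.\<close> A face \<open>F\<close> is exposed by some \<open>\<beta> \<in> a\<close>, and the lines that
  \<open>\<mu>\<^sub>a\<close> sends into \<open>F\<close> are those of the eigenspace of \<open>\<beta>\<close> for its largest eigenvalue. This eigenspace is the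
  only subspace on which \<open>G\<^bsup>\<beta>+\<^esup>\<close> acts irreducibly (\<open>parabolic_acts_irreducibly_iff\<close>): if \<open>G\<^bsup>\<beta>+\<^esup>\<close> preserves a
  subspace \<open>U\<close> of some eigenspace of \<open>\<beta>\<close>, then the part of the Lie algebra that lowers the eigenvalues of
  \<open>\<beta>\<close> generates from \<open>U\<close> a subspace invariant under the whole Lie algebra, which is therefore \<open>V\<close>; so \<open>V\<close>
  is the sum of \<open>U\<close> and of eigenspaces for smaller eigenvalues.

  \<^bold>\<open>Conjugacy.\<close> Every \<open>\<beta> \<in> p\<close> is \<open>K\<close>-conjugate to an element of \<open>a\<close>, so all irreducible representations
  arise from faces up to equivalence. If \<open>k \<in> K\<close> maps the space \<open>W\<close> of a face \<open>F\<close> onto the space \<open>W'\<close> of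
  \<open>F'\<close>, then \<open>a\<close> and \<open>k a k\<^bsup>-1\<^esup>\<close> both preserve \<open>W'\<close>; they are conjugate under the stabiliser
  of \<open>W'\<close> in \<open>K\<close>, and this corrects \<open>k\<close> to an element of the Weyl group that maps \<open>F\<close> to \<open>F'\<close>. Both facts come from
  one variational argument (\<open>commuting_conjugate\<close>).

  \<^bold>\<open>Lie theory.\<close> The Lie algebra is taken to be the set of velocities at \<open>1\<close> of curves in the
  matrix group. The group is closed, because the Hermitian factor of the polar decomposition stays
  bounded when the product converges in \<open>SL(V)\<close>, so velocities exponentiate into the group. Irreducibility
  passes to the Lie algebra through the charts of the Lie group: a subspace invariant under the Lie
  algebra is invariant near \<open>1\<close> by an estimate of Gronwall type.
\<close>

section \<open>The matrix exponential\<close>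

text \<open>A copy of the bounded operators with composition as multiplication: on this Banach algebra the
  library exponential is the exponential of operators, and its theory carries over to \<open>mexp\<close>.\<close>

typedef (overloaded) 'a endo = "UNIV :: ('a::real_normed_vector \<Rightarrow>\<^sub>L 'a) set"
  by simp

lemmas endo_inverse [simp] = Rep_endo_inverse Abs_endo_inverse [OF UNIV_I]

instantiation endo :: (euclidean_space) real_normed_algebra_1
begin

definition "0 = Abs_endo 0"
definition "1 = Abs_endo id_blinfun"
definition "x + y = Abs_endo (Rep_endo x + Rep_endo y)"
definition "x - y = Abs_endo (Rep_endo x - Rep_endo y)"
definition "- x = Abs_endo (- Rep_endo x)"
definition "x * y = Abs_endo (Rep_endo x o\<^sub>L Rep_endo y)"
definition "r *\<^sub>R x = Abs_endo (r *\<^sub>R Rep_endo x)"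
definition "norm x = norm (Rep_endo x)"
definition "dist x y = norm (Rep_endo x - Rep_endo y)"
definition "sgn x = Abs_endo (sgn (Rep_endo x))"
definition "(uniformity :: ('a endo \<times> 'a endo) filter) = (INF e\<in>{0<..}. principal {(x, y). dist x y < e})"
definition "open (U :: 'a endo set) \<longleftrightarrow> (\<forall>x\<in>U. eventually (\<lambda>(x', y). x' = x \<longrightarrow> y \<in> U) uniformity)"

lemmas endo_defs = zero_endo_def one_endo_def plus_endo_def minus_endo_def uminus_endo_def
  times_endo_def scaleR_endo_def norm_endo_def dist_endo_def sgn_endo_def

instance
proof
  show "norm (1 :: 'a endo) = 1"
    by (simp add: endo_defs norm_blinfun_id)
  have "(id_blinfun :: 'a \<Rightarrow>\<^sub>L 'a) \<noteq> 0"
    by (metis norm_blinfun_id norm_zero zero_neq_one)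
  then show "(0 :: 'a endo) \<noteq> 1"
    by (auto simp: endo_defs Abs_endo_inject)
qed (auto simp: endo_defs Abs_endo_inject Rep_endo_inject [symmetric] uniformity_endo_def
      open_endo_def sgn_div_norm norm_triangle_ineq norm_blinfun_compose algebra_simps
      blinfun.bilinear_simps intro!: blinfun_eqI)

end

lemma Rep_endo_norm: "norm (Rep_endo x - Rep_endo y) = norm (x - y)"
  by (simp add: endo_defs)

instance endo :: (euclidean_space) banach
proof
  fix X :: "nat \<Rightarrow> 'a endo"
  assume "Cauchy X"
  then have "Cauchy (\<lambda>n. Rep_endo (X n))"
    by (simp add: Cauchy_def dist_norm Rep_endo_norm)
  then obtain L where "(\<lambda>n. Rep_endo (X n)) \<longlonglongrightarrow> L"
    using Cauchy_convergent convergent_def by blast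
  then have "X \<longlonglongrightarrow> Abs_endo L"
    by (simp add: LIMSEQ_def dist_norm Rep_endo_norm [symmetric])
  then show "convergent X"
    by (auto simp: convergent_def)
qed

lemma has_vector_derivative_imp_difference_quotient:
  assumes "(\<gamma> has_vector_derivative X) (at 0)"
  shows "(\<lambda>n. real n *\<^sub>R (\<gamma> (1 / real n) - \<gamma> 0)) \<longlonglongrightarrow> X"
proof -
  have "((\<lambda>t. norm (\<gamma> t - \<gamma> 0 - t *\<^sub>R X) / norm t) \<longlongrightarrow> 0) (at 0)"
    using assms by (simp add: has_vector_derivative_def has_derivative_iff_norm)
  moreover have "filterlim (\<lambda>n. 1 / real n) (at 0) sequentially"
    unfolding filterlim_at
    by (auto intro!: lim_1_over_n eventually_sequentiallyI [of 1])
  ultimately have "(\<lambda>n. norm (\<gamma> (1 / real n) - \<gamma> 0 - (1 / real n) *\<^sub>R X) / norm (1 / real n)) \<longlonglongrightarrow> 0"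
    by (rule filterlim_compose)
  moreover have "norm (\<gamma> (1 / real n) - \<gamma> 0 - (1 / real n) *\<^sub>R X) / norm (1 / real n)
      = norm (real n *\<^sub>R (\<gamma> (1 / real n) - \<gamma> 0) - X)" if "n > 0" for n
  proof -
    have "real n *\<^sub>R (\<gamma> (1 / real n) - \<gamma> 0) - X = real n *\<^sub>R (\<gamma> (1 / real n) - \<gamma> 0 - (1 / real n) *\<^sub>R X)"
      using that by (simp add: scaleR_diff_right)
    then have "norm (real n *\<^sub>R (\<gamma> (1 / real n) - \<gamma> 0) - X)
        = real n * norm (\<gamma> (1 / real n) - \<gamma> 0 - (1 / real n) *\<^sub>R X)"
      by simp
    then show ?thesis
      using that by simp
  qed
  then have "\<forall>\<^sub>F n in sequentially. norm (\<gamma> (1 / real n) - \<gamma> 0 - (1 / real n) *\<^sub>R X) / norm (1 / real n)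
      = norm (real n *\<^sub>R (\<gamma> (1 / real n) - \<gamma> 0) - X)"
    by (intro eventually_sequentiallyI [of 1]) auto
  ultimately have "(\<lambda>n. norm (real n *\<^sub>R (\<gamma> (1 / real n) - \<gamma> 0) - X)) \<longlonglongrightarrow> 0"
    by (simp add: filterlim_cong)
  then show ?thesis
    using Lim_null tendsto_norm_zero_iff by fastforce
qed

text \<open>Telescoping, as for commuting elements; one factor \<open>r\<close> too many keeps the induction simple.\<close>

lemma power_diff_norm_bound:
  fixes a b :: "'a::real_normed_algebra_1"
  assumes "norm a \<le> r" "norm b \<le> r" "1 \<le> r"
  shows "norm (a ^ m - b ^ m) \<le> real m * r ^ m * norm (a - b)"
proof (induction m)
  case (Suc m)
  have "a ^ Suc m - b ^ Suc m = a * (a ^ m - b ^ m) + (a - b) * b ^ m"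
    by (simp add: algebra_simps)
  also have "norm \<dots> \<le> norm a * norm (a ^ m - b ^ m) + norm (a - b) * norm b ^ m"
    by (intro order_trans [OF norm_triangle_ineq] add_mono order_trans [OF norm_mult_ineq]
        mult_left_mono norm_power_ineq) auto
  also have "\<dots> \<le> r * (real m * r ^ m * norm (a - b)) + norm (a - b) * r ^ m"
    using assms Suc by (intro add_mono mult_mono power_mono) auto
  also have "norm (a - b) * r ^ m \<le> norm (a - b) * r ^ Suc m"
    using assms by (intro mult_left_mono power_increasing) auto
  finally show ?case
    by (simp add: algebra_simps)
qed simp

text \<open>Compare \<open>g n\<close> with \<open>exp (x / n)\<close>: they differ by \<open>o(1/n)\<close>, and taking \<open>n\<close>-th powers magnifies the
  difference by at most \<open>n\<close> times a constant. This is how one-parameter subgroups arise from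
  mere curves in a closed group.\<close>

lemma power_tendsto_exp:
  fixes g :: "nat \<Rightarrow> 'a::{real_normed_algebra_1,banach}"
  assumes "(\<lambda>n. real n *\<^sub>R (g n - 1)) \<longlonglongrightarrow> x"
  shows "(\<lambda>n. g n ^ n) \<longlonglongrightarrow> exp x"
proof -
  define e where "e n = exp ((1 / real n) *\<^sub>R x)" for n
  have e: "(\<lambda>n. real n *\<^sub>R (e n - 1)) \<longlonglongrightarrow> x"
    using has_vector_derivative_imp_difference_quotient [OF exp_scaleR_has_vector_derivative_left [of x 0]]
    by (simp add: e_def)
  have diff: "(\<lambda>n. real n *\<^sub>R (g n - e n)) \<longlonglongrightarrow> 0"
    using tendsto_diff [OF assms e] by (simp add: algebra_simps)
  obtain C where C: "\<And>n. norm (real n *\<^sub>R (g n - 1)) \<le> C" "\<And>n. norm (real n *\<^sub>R (e n - 1)) \<le> C" "C > 0"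
  proof -
    obtain C1 where C1: "C1 > 0" "\<And>n. norm (real n *\<^sub>R (g n - 1)) \<le> C1"
      using convergent_imp_Bseq [OF convergentI [OF assms]] by (auto simp: Bseq_def)
    obtain C2 where C2: "\<And>n. norm (real n *\<^sub>R (e n - 1)) \<le> C2"
      using convergent_imp_Bseq [OF convergentI [OF e]] by (auto simp: Bseq_def)
    show ?thesis
      by (rule that [of "max C1 C2"]) (use C1 C2 in \<open>auto simp: le_max_iff_disj simp del: norm_scaleR\<close>)
  qed
  have bnd: "norm (y :: 'a) \<le> 1 + C / real n" if "norm (real n *\<^sub>R (y - 1)) \<le> C" "n > 0" for y n
  proof -
    have "real n * norm (y - 1) \<le> C"
      using that(1) unfolding norm_scaleR by simp
    then have "norm (y - 1) \<le> C / real n"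
      using that(2) by (simp add: field_simps)
    then show ?thesis
      using norm_triangle_ineq [of "y - 1" 1] by simp
  qed
  have bound: "norm (g n ^ n - e n ^ n) \<le> exp C * norm (real n *\<^sub>R (g n - e n))" if "n > 0" for n
  proof -
    have "norm (g n ^ n - e n ^ n) \<le> real n * (1 + C / real n) ^ n * norm (g n - e n)"
      using C that by (intro power_diff_norm_bound bnd) auto
    also have "\<dots> \<le> real n * exp C * norm (g n - e n)"
      using exp_ge_one_plus_x_over_n_power_n [of n C] C that
      by (intro mult_right_mono mult_left_mono) auto
    finally show ?thesis
      by (simp add: mult_ac)
  qed
  have "(\<lambda>n. exp C * norm (real n *\<^sub>R (g n - e n))) \<longlonglongrightarrow> 0"
    by (rule tendsto_mult_right_zero [OF tendsto_norm_zero [OF diff]])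
  then have "(\<lambda>n. g n ^ n - e n ^ n) \<longlonglongrightarrow> 0"
    by (rule Lim_null_comparison [rotated]) (rule eventually_sequentiallyI [of 1], rule bound, simp)
  moreover have "e n ^ n = exp x" if "n > 0" for n
  proof -
    have "exp ((1 / real n) *\<^sub>R x) ^ m = exp ((real m / real n) *\<^sub>R x)" for m
    proof (induction m)
      case (Suc m)
      have "(real (Suc m) / real n) *\<^sub>R x = (1 / real n) *\<^sub>R x + (real m / real n) *\<^sub>R x"
        by (simp only: scaleR_add_left [symmetric] add_divide_distrib [symmetric]) simp
      moreover have "exp ((1 / real n) *\<^sub>R x + (real m / real n) *\<^sub>R x)
          = exp ((1 / real n) *\<^sub>R x) * exp ((real m / real n) *\<^sub>R x)"
        by (rule exp_add_commuting) simp
      ultimately show ?case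
        by (simp only: Suc power_Suc)
    qed simp
    then show ?thesis
      using that by (simp add: e_def)
  qed
  then have "(\<lambda>n. e n ^ n) \<longlonglongrightarrow> exp x"
    by (intro tendsto_eventually) (auto intro!: eventually_sequentiallyI [of 1])
  ultimately show ?thesis
    using tendsto_add by fastforce
qed

text \<open>The exponential series converges uniformly on balls.\<close>

lemma continuous_on_exp_banach:
  "continuous_on UNIV (exp :: 'a::{real_normed_algebra_1,banach} \<Rightarrow> 'a)"
proof -
  have "continuous_on (cball 0 r) (exp :: 'a \<Rightarrow> 'a)" if "r > 0" for r
  proof (rule uniform_limit_theorem)
    show "\<forall>\<^sub>F n in sequentially. continuous_on (cball 0 r) (\<lambda>x :: 'a. \<Sum>i<n. x ^ i /\<^sub>R fact i)"
      by (intro always_eventually allI continuous_intros)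
    show "uniform_limit (cball 0 r) (\<lambda>n x :: 'a. \<Sum>i<n. x ^ i /\<^sub>R fact i) exp sequentially"
      unfolding exp_def
    proof (rule Weierstrass_m_test)
      show "norm (x ^ n /\<^sub>R fact n) \<le> r ^ n /\<^sub>R fact n" if "x \<in> cball 0 r" for n and x :: 'a
        using that order_trans [OF norm_power_ineq power_mono [of "norm x" r n]]
        by (simp add: mult_left_mono)
      show "summable (\<lambda>n. r ^ n /\<^sub>R fact n)"
        by (rule summable_exp_generic)
    qed
  qed auto
  then have "continuous_on (ball 0 r) (exp :: 'a \<Rightarrow> 'a)" for r
    by (metis ball_empty ball_subset_cball continuous_on_empty continuous_on_subset not_le_imp_less)
  then have "isCont exp x" for x :: 'a
    by (metis (no_types) centre_in_ball continuous_on_eq_continuous_at dist_0_norm gt_ex mem_ball open_ball)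
  then show ?thesis
    by (simp add: continuous_at_imp_continuous_on)
qed


lemma isCont_exp_banach: "isCont (exp :: 'a::{real_normed_algebra_1,banach} \<Rightarrow> 'a) x"
  using continuous_on_exp_banach continuous_on_eq_continuous_at open_UNIV by blast

text \<open>Complex matrices embed as an algebra into the real-linear endomorphisms; \<open>matrix_of_endo\<close> is a
  continuous left inverse, which is enough to transport limits back.\<close>

definition endo_of :: "complex^'n^'n \<Rightarrow> (complex^'n) endo" where
  "endo_of A = Abs_endo (Blinfun ((*v) A))"

definition matrix_of_endo :: "(complex^'n) endo \<Rightarrow> complex^'n^'n" where
  "matrix_of_endo f = (\<chi> i j. blinfun_apply (Rep_endo f) (axis j 1) $ i)"

lemma Rep_endo_of [simp]: "blinfun_apply (Rep_endo (endo_of A)) = (*v) A"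
  by (simp add: endo_of_def bounded_linear_Blinfun_apply matrix_vector_mul_bounded_linear)

lemma matrix_of_endo_of [simp]: "matrix_of_endo (endo_of A) = A"
  by (simp add: matrix_of_endo_def vec_eq_iff matrix_vector_mult_def axis_def if_distrib
      cong: if_cong)

lemma endo_eqI: "(\<And>v. blinfun_apply (Rep_endo f) v = blinfun_apply (Rep_endo g) v) \<Longrightarrow> f = g"
  by (simp add: Rep_endo_inject [symmetric] blinfun_eqI)

lemma Rep_endo_simps [simp]:
  "blinfun_apply (Rep_endo (f + g)) v = blinfun_apply (Rep_endo f) v + blinfun_apply (Rep_endo g) v"
  "blinfun_apply (Rep_endo (f - g)) v = blinfun_apply (Rep_endo f) v - blinfun_apply (Rep_endo g) v"
  "blinfun_apply (Rep_endo (r *\<^sub>R f)) v = r *\<^sub>R blinfun_apply (Rep_endo f) v"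
  "blinfun_apply (Rep_endo (f * g)) v = blinfun_apply (Rep_endo f) (blinfun_apply (Rep_endo g) v)"
  "blinfun_apply (Rep_endo 1) v = v"
  by (simp_all add: endo_defs blinfun.bilinear_simps)

lemma matrix_vector_mult_scaleR: "(r *\<^sub>R A) *v v = r *\<^sub>R (A *v v)" for A :: "complex^'n^'m"
  by (simp add: vec_eq_iff matrix_vector_mult_def scaleR_sum_right)

lemma matrix_vector_scaleR_right: "A *v (r *\<^sub>R v) = r *\<^sub>R (A *v v)" for A :: "complex^'n^'m"
  by (simp add: vec_eq_iff matrix_vector_mult_def scaleR_sum_right)

lemma endo_of_simps:
  "endo_of (A + B) = endo_of A + endo_of B"
  "endo_of (A - B) = endo_of A - endo_of B"
  "endo_of (r *\<^sub>R A) = r *\<^sub>R endo_of A"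
  "endo_of (A ** B) = endo_of A * endo_of B"
  "endo_of (mat 1) = 1"
  by (auto intro!: endo_eqI simp: matrix_vector_mult_add_rdistrib matrix_vector_mult_diff_rdistrib
      matrix_vector_mult_scaleR matrix_vector_mul_assoc)

lemma bounded_linear_endo_of: "bounded_linear endo_of"
  by (intro linear_conv_bounded_linear [THEN iffD1] linearI) (simp_all add: endo_of_simps)

lemma bounded_linear_matrix_of_endo: "bounded_linear (matrix_of_endo :: _ \<Rightarrow> complex^'n^'n)"
proof (intro bounded_linear_intro allI)
  fix f :: "(complex^'n) endo"
  have *: "norm (matrix_of_endo f $ i $ j) \<le> norm f" for i j
  proof -
    have "norm (blinfun_apply (Rep_endo f) (axis j 1) $ i) \<le> norm (blinfun_apply (Rep_endo f) (axis j 1))"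
      by (rule Finite_Cartesian_Product.norm_nth_le)
    also have "\<dots> \<le> norm f * norm (axis j 1 :: complex^'n)"
      unfolding norm_endo_def by (rule norm_blinfun)
    finally show ?thesis
      by (simp add: matrix_of_endo_def)
  qed
  have "norm (matrix_of_endo f) \<le> (\<Sum>i\<in>UNIV. \<Sum>j\<in>UNIV. norm (matrix_of_endo f $ i $ j))"
    unfolding norm_vec_def [where 'a = "complex^'n"] norm_vec_def [where 'a = complex]
    by (intro order_trans [OF L2_set_le_sum] sum_mono L2_set_le_sum) (auto simp: L2_set_nonneg)
  also have "\<dots> \<le> (\<Sum>i\<in>(UNIV::'n set). \<Sum>j\<in>(UNIV::'n set). norm f)"
    by (intro sum_mono *)
  finally show "norm (matrix_of_endo f) \<le> norm f * (real CARD('n) * real CARD('n))"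
    by (simp add: mult_ac)
qed (simp_all add: matrix_of_endo_def vec_eq_iff)

lemma endo_of_matrix_power: "endo_of (((**) X ^^ k) (mat 1)) = endo_of X ^ k"
  by (induction k) (simp_all add: endo_of_simps)

lemma mexp_sums: "(\<lambda>k. (1 / fact k) *\<^sub>R (((**) X ^^ k) (mat 1))) sums matrix_of_endo (exp (endo_of X))"
proof -
  have "(\<lambda>k. matrix_of_endo (endo_of X ^ k /\<^sub>R fact k)) sums matrix_of_endo (exp (endo_of X))"
    by (rule bounded_linear.sums [OF bounded_linear_matrix_of_endo exp_converges])
  moreover have "matrix_of_endo (endo_of X ^ k /\<^sub>R fact k) = (1 / fact k) *\<^sub>R (((**) X ^^ k) (mat 1))" for k
    by (simp add: linear_simps [OF bounded_linear_matrix_of_endo] endo_of_matrix_power [symmetric] inverse_eq_divide)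
  ultimately show ?thesis
    by simp
qed

lemma mexp_eq: "mexp X = matrix_of_endo (exp (endo_of X))"
  unfolding mexp_def by (rule sums_unique [OF mexp_sums, symmetric])

lemma endo_of_mexp: "endo_of (mexp X) = exp (endo_of X)"
proof -
  have "(\<lambda>k. endo_of ((1 / fact k) *\<^sub>R (((**) X ^^ k) (mat 1)))) sums endo_of (mexp X)"
    unfolding mexp_eq by (rule bounded_linear.sums [OF bounded_linear_endo_of mexp_sums])
  then have "(\<lambda>k. endo_of X ^ k /\<^sub>R fact k) sums endo_of (mexp X)"
    by (simp add: endo_of_simps endo_of_matrix_power inverse_eq_divide)
  then show ?thesis
    using exp_converges sums_unique2 by blast
qed

lemma endo_of_eq_iff: "endo_of A = endo_of B \<longleftrightarrow> A = B"
  by (metis matrix_of_endo_of)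

lemma mexp_add_commuting: "X ** Y = Y ** X \<Longrightarrow> mexp (X + Y) = mexp X ** mexp Y"
  by (simp add: endo_of_eq_iff [symmetric] endo_of_mexp endo_of_simps exp_add_commuting)

lemma mexp_0 [simp]: "mexp (0 :: complex^'n^'n) = mat 1"
proof -
  have "endo_of (0 :: complex^'n^'n) = 0"
    by (rule linear_0 [OF bounded_linear.linear [OF bounded_linear_endo_of]])
  then have "endo_of (mexp (0 :: complex^'n^'n)) = endo_of (mat 1)"
    by (simp add: endo_of_mexp endo_of_simps)
  then show ?thesis
    by (simp only: endo_of_eq_iff)
qed

lemma scaleR_matrix_mult:
  fixes A B :: "complex^'n^'n"
  shows "(r *\<^sub>R A) ** B = r *\<^sub>R (A ** B)" "A ** (r *\<^sub>R B) = r *\<^sub>R (A ** B)"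
  by (simp_all add: vec_eq_iff matrix_matrix_mult_def scaleR_sum_right)

lemma minus_matrix_mult:
  fixes A B :: "complex^'n^'n"
  shows "(- A) ** B = - (A ** B)" "A ** (- B) = - (A ** B)"
  by (simp_all add: vec_eq_iff matrix_matrix_mult_def sum_negf)

lemma diff_matrix_mult:
  fixes A B C :: "complex^'n^'n"
  shows "(A - B) ** C = A ** C - B ** C" "C ** (A - B) = C ** A - C ** B"
  by (simp_all add: vec_eq_iff matrix_matrix_mult_def sum_subtractf algebra_simps)

lemma mexp_minus_right: "mexp X ** mexp (- X) = mat 1"
  using mexp_add_commuting [of X "- X"] by (simp add: minus_matrix_mult)

lemma mexp_minus_left: "mexp (- X) ** mexp X = mat 1"
  using mexp_minus_right [of "- X"] by simp

lemma matrix_mult_add_rdistrib: "(A + B) ** C = A ** C + B ** C" for A B C :: "complex^'n^'n"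
  by (simp add: vec_eq_iff matrix_matrix_mult_def sum.distrib algebra_simps)

lemma bounded_bilinear_matrix_mult:
  "bounded_bilinear ((**) :: complex^'n^'n \<Rightarrow> complex^'n^'n \<Rightarrow> complex^'n^'n)"
  by (simp add: bilinear_conv_bounded_bilinear [symmetric] bilinear_def linear_iff
      matrix_add_ldistrib matrix_mult_add_rdistrib scaleR_matrix_mult)

lemma bounded_bilinear_matrix_vector_mult:
  "bounded_bilinear ((*v) :: complex^'n^'n \<Rightarrow> complex^'n \<Rightarrow> complex^'n)"
  by (simp add: bilinear_conv_bounded_bilinear [symmetric] bilinear_def linear_iff
      matrix_vector_mult_scaleR matrix_vector_scaleR_right matrix_vector_mult_add_rdistrib
      matrix_vector_right_distrib)

lemmas bounded_linear_matrix_vector_left = bounded_bilinear.bounded_linear_left [OF bounded_bilinear_matrix_vector_mult]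
lemmas bounded_linear_matrix_vector_right = bounded_bilinear.bounded_linear_right [OF bounded_bilinear_matrix_vector_mult]
lemmas matrix_mult_derivative = bounded_bilinear.has_vector_derivative [OF bounded_bilinear_matrix_mult]
lemmas matrix_vector_mult_derivative = bounded_bilinear.has_vector_derivative [OF bounded_bilinear_matrix_vector_mult]
lemmas matrix_mult_tendsto = bounded_bilinear.tendsto [OF bounded_bilinear_matrix_mult]
lemmas matrix_vector_mult_tendsto = bounded_bilinear.tendsto [OF bounded_bilinear_matrix_vector_mult]
lemmas matrix_vector_mult_continuous_on = bounded_bilinear.continuous_on [OF bounded_bilinear_matrix_vector_mult]

lemma mexp_has_vector_derivative:
  "((\<lambda>t. mexp (t *\<^sub>R X)) has_vector_derivative X ** mexp (t *\<^sub>R X)) (at t)"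
proof -
  have "((\<lambda>t. matrix_of_endo (exp (t *\<^sub>R endo_of X))) has_vector_derivative
      matrix_of_endo (endo_of X * exp (t *\<^sub>R endo_of X))) (at t)"
    by (rule bounded_linear.has_vector_derivative [OF bounded_linear_matrix_of_endo
          exp_scaleR_has_vector_derivative_left])
  moreover have "endo_of X * exp (t *\<^sub>R endo_of X) = endo_of (X ** mexp (t *\<^sub>R X))"
    by (simp add: endo_of_simps endo_of_mexp)
  ultimately show ?thesis
    by (simp only: mexp_eq [symmetric] endo_of_simps [symmetric] matrix_of_endo_of)
qed

lemma mexp_has_vector_derivative_0: "((\<lambda>t. mexp (t *\<^sub>R X)) has_vector_derivative X) (at 0)"
  using mexp_has_vector_derivative [of X 0] by simp

lemma mexp_vector_derivative_0: "((\<lambda>t. mexp (t *\<^sub>R X) *v v) has_vector_derivative X *v v) (at 0)"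
  using matrix_vector_mult_derivative [OF mexp_has_vector_derivative_0 has_vector_derivative_const] by simp

lemma isCont_mexp: "isCont mexp X"
proof -
  have "isCont (\<lambda>X. matrix_of_endo (exp (endo_of X))) X"
    by (intro isCont_o2 [OF _ bounded_linear.isCont [OF bounded_linear_matrix_of_endo continuous_ident]]
        isCont_o2 [OF bounded_linear.isCont [OF bounded_linear_endo_of continuous_ident]] isCont_exp_banach)
  then show ?thesis
    by (simp add: mexp_eq [abs_def])
qed

lemma matrix_power_tendsto_mexp:
  assumes "(\<lambda>n. real n *\<^sub>R (g n - mat 1)) \<longlonglongrightarrow> X"
  shows "(\<lambda>n. ((**) (g n) ^^ n) (mat 1)) \<longlonglongrightarrow> mexp X"
proof -
  have "(\<lambda>n. real n *\<^sub>R (endo_of (g n) - 1)) \<longlonglongrightarrow> endo_of X"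
    using bounded_linear.tendsto [OF bounded_linear_endo_of assms] by (simp add: endo_of_simps)
  then have "(\<lambda>n. matrix_of_endo (endo_of (g n) ^ n)) \<longlonglongrightarrow> matrix_of_endo (exp (endo_of X))"
    by (intro bounded_linear.tendsto [OF bounded_linear_matrix_of_endo] power_tendsto_exp)
  then show ?thesis
    by (simp add: mexp_eq endo_of_matrix_power [symmetric])
qed

text \<open>The \<open>k\<close>-th powers of \<open>g ** X ** g'\<close> and \<open>X\<close> are intertwined by \<open>g\<close>, term by term in the series.\<close>

lemma mexp_conj:
  fixes g X g' :: "complex^'n^'n"
  assumes "g' ** g = mat 1"
  shows "mexp (g ** X ** g') = g ** mexp X ** g'"
proof -
  have *: "((**) (g ** X ** g') ^^ k) (mat 1) ** g = g ** ((**) X ^^ k) (mat 1)" for k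
  proof (induction k)
    case (Suc k)
    have "((**) (g ** X ** g') ^^ Suc k) (mat 1) ** g = g ** X ** g' ** (((**) (g ** X ** g') ^^ k) (mat 1) ** g)"
      by (simp add: matrix_mul_assoc)
    also have "\<dots> = g ** X ** (g' ** g) ** ((**) X ^^ k) (mat 1)"
      by (simp add: Suc matrix_mul_assoc)
    finally show ?case
      by (simp add: assms matrix_mul_assoc)
  qed simp
  have "(\<lambda>k. ((1 / fact k) *\<^sub>R ((**) (g ** X ** g') ^^ k) (mat 1)) ** g) sums (mexp (g ** X ** g') ** g)"
    using bounded_linear.sums [OF bounded_bilinear.bounded_linear_left [OF bounded_bilinear_matrix_mult, of g]
        mexp_sums [of "g ** X ** g'"]] by (simp add: mexp_eq)
  moreover have "(\<lambda>k. g ** ((1 / fact k) *\<^sub>R ((**) X ^^ k) (mat 1))) sums (g ** mexp X)"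
    unfolding mexp_eq
    by (rule bounded_linear.sums [OF bounded_bilinear.bounded_linear_right [OF bounded_bilinear_matrix_mult] mexp_sums])
  ultimately have "mexp (g ** X ** g') ** g = g ** mexp X"
    by (simp add: scaleR_matrix_mult * sums_unique2)
  then have "mexp (g ** X ** g') ** (g ** g') = g ** mexp X ** g'"
    by (metis matrix_mul_assoc)
  moreover have "g ** g' = mat 1"
    using assms matrix_left_right_inverse by blast
  ultimately show ?thesis
    by simp
qed

lemma mexp_vector_sums:
  "(\<lambda>k. (1 / fact k) *\<^sub>R (((*v) X ^^ k) v)) sums (mexp X *v v)"
proof -
  have "((**) X ^^ k) (mat 1) *v v = ((*v) X ^^ k) v" for k
    by (induction k) (simp_all add: matrix_vector_mul_assoc [symmetric])
  moreover have "(\<lambda>k. ((1 / fact k) *\<^sub>R ((**) X ^^ k) (mat 1)) *v v) sums (mexp X *v v)"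
    unfolding mexp_eq
    by (rule bounded_linear.sums [OF bounded_linear_matrix_vector_left mexp_sums])
  ultimately show ?thesis
    by (simp add: matrix_vector_mult_scaleR)
qed

lemma mexp_eigenvector:
  assumes "X *v v = r *\<^sub>R v"
  shows "mexp X *v v = exp r *\<^sub>R v"
proof -
  have "((*v) X ^^ k) v = r ^ k *\<^sub>R v" for k
    by (induction k) (simp_all add: matrix_vector_scaleR_right assms)
  then have "(\<lambda>k. (r ^ k /\<^sub>R fact k) *\<^sub>R v) sums (mexp X *v v)"
    using mexp_vector_sums [of X v] by (simp add: inverse_eq_divide)
  moreover have "(\<lambda>k. (r ^ k /\<^sub>R fact k) *\<^sub>R v) sums (exp r *\<^sub>R v)"
    by (rule bounded_linear.sums [OF bounded_linear_scaleR_left exp_converges])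
  ultimately show ?thesis
    by (rule sums_unique2)
qed

section \<open>Hermitian products and simultaneous diagonalisation\<close>

lemma scaleR_eq_scale: "r *\<^sub>R v = complex_of_real r *s v" for v :: "complex^'n"
  unfolding vec_eq_iff vector_scaleR_component vector_smult_component by (simp add: scaleR_conv_of_real)

lemma vec_subspace_imp_subspace: "vec.subspace S \<Longrightarrow> subspace S" for S :: "(complex^'n) set"
  by (simp add: subspace_def vec.subspace_def scaleR_eq_scale)

lemma subspace_eigenspace: "vec.subspace {v. X *v v = r *\<^sub>R v}" for X :: "complex^'n^'n"
  by (auto simp: vec.subspace_def matrix_vector_right_distrib vector_scalar_commute scaleR_eq_scale
      vec.scale_right_distrib vec.scale_left_commute)

lemma matrix_vector_mult_sum: "A *v sum f I = (\<Sum>i\<in>I. A *v f i)" for A :: "complex^'n^'n"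
  by (rule linear_sum [OF bounded_linear.linear
        [OF bounded_linear_matrix_vector_right]])

text \<open>The first-order condition at a minimum: for small \<open>t\<close> of the right sign a nonzero linear
  term would dominate.\<close>

lemma linear_coefficient_zero:
  fixes b c :: real
  assumes "\<And>t. 0 \<le> 2 * t * b + t\<^sup>2 * c"
  shows "b = 0"
proof (rule ccontr)
  assume "b \<noteq> 0"
  define k where "k = \<bar>c\<bar> + 1"
  have k: "k > 0" "c < k"
    by (auto simp: k_def)
  have "0 \<le> 2 * (- b / k) * b + (- b / k)\<^sup>2 * c"
    by (rule assms)
  also have "\<dots> = (b\<^sup>2 / k\<^sup>2) * (c - 2 * k)"
    using k by (simp add: field_simps power2_eq_square)
  also have "\<dots> < 0"
    using k \<open>b \<noteq> 0\<close> by (intro mult_pos_neg) auto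
  finally show False
    by simp
qed

locale hermitian =
  fixes h :: "complex^'n \<Rightarrow> complex^'n \<Rightarrow> complex"
  assumes hermitian_product: "hermitian_product h"
begin

lemma
  shows h_add_left: "h (u + v) w = h u w + h v w"
    and h_scale_left: "h (z *s v) w = z * h v w"
    and h_swap: "h w v = cnj (h v w)"
    and h_pos: "v \<noteq> 0 \<Longrightarrow> Re (h v v) > 0"
  using hermitian_product unfolding hermitian_product_def by blast+

lemma h_cnj: "cnj (h v w) = h w v"
  by (rule h_swap [symmetric])

lemma h_add_right: "h u (v + w) = h u v + h u w"
  by (subst (1 2 3) h_cnj [symmetric]) (simp add: h_add_left)

lemma h_scale_right: "h v (z *s w) = cnj z * h v w"
  by (subst (1 2) h_cnj [symmetric]) (simp add: h_scale_left)

lemma h_scaleR_left: "h (r *\<^sub>R v) w = r *\<^sub>R h v w"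
  by (simp add: scaleR_eq_scale h_scale_left scaleR_conv_of_real)

lemma h_scaleR_right: "h v (r *\<^sub>R w) = r *\<^sub>R h v w"
  by (simp add: scaleR_eq_scale h_scale_right scaleR_conv_of_real)

lemma bounded_bilinear_h: "bounded_bilinear h"
  by (simp add: bilinear_conv_bounded_bilinear [symmetric] bilinear_def linear_iff
      h_add_left h_add_right h_scaleR_left h_scaleR_right)

lemmas h_simps = bounded_bilinear.zero_left [OF bounded_bilinear_h] bounded_bilinear.zero_right [OF bounded_bilinear_h]
  bounded_bilinear.diff_left [OF bounded_bilinear_h] bounded_bilinear.diff_right [OF bounded_bilinear_h]
  bounded_bilinear.minus_left [OF bounded_bilinear_h] bounded_bilinear.minus_right [OF bounded_bilinear_h]
  h_add_left h_add_right h_scale_left h_scale_right h_scaleR_left h_scaleR_right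

lemmas h_sum_left = bounded_bilinear.sum_left [OF bounded_bilinear_h]

lemma h_self_real: "complex_of_real (Re (h v v)) = h v v"
  using h_cnj [of v v] by (metis complex_is_Real_iff Reals_cnj_iff of_real_Re)

lemma h_self_eq_0: "h v v = 0 \<longleftrightarrow> v = 0"
  using h_pos [of v] by (cases "v = 0") (auto simp: h_simps)

lemma h_continuous_on: "continuous_on S f \<Longrightarrow> continuous_on S g \<Longrightarrow> continuous_on S (\<lambda>x. h (f x) (g x))"
  by (rule bounded_bilinear.continuous_on [OF bounded_bilinear_h])

definition selfadj :: "complex^'n^'n \<Rightarrow> bool" where
  "selfadj X \<longleftrightarrow> (\<forall>v w. h (X *v v) w = h v (X *v w))"

lemma selfadjD: "selfadj X \<Longrightarrow> h (X *v v) w = h v (X *v w)"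
  by (simp add: selfadj_def)

text \<open>A vector that maximises the Rayleigh quotient on the unit sphere of \<open>U\<close> is an eigenvector.\<close>

lemma selfadj_eigenvector:
  assumes X: "selfadj X" and U: "vec.subspace U" "U \<noteq> {0}" and inv: "\<And>u. u \<in> U \<Longrightarrow> X *v u \<in> U"
  obtains v r where "v \<in> U" "v \<noteq> 0" "X *v v = r *\<^sub>R v"
proof -
  have sU: "subspace U"
    by (rule vec_subspace_imp_subspace [OF U(1)])
  define C where "C = U \<inter> sphere 0 1"
  define f where "f v = Re (h (X *v v) v) / Re (h v v)" for v
  have "compact C"
    unfolding C_def using closed_subspace [OF sU] by (intro closed_Int_compact) auto
  moreover obtain u where "u \<in> U" "u \<noteq> 0"
    using U subspace_0 [OF sU] by blast
  then have "(1 / norm u) *\<^sub>R u \<in> C"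
    using sU by (auto simp: C_def subspace_scale)
  then have "C \<noteq> {}"
    by auto
  moreover have "continuous_on C f"
    unfolding f_def
    by (intro continuous_intros h_continuous_on matrix_vector_mult_continuous_on)
      (metis C_def IntD2 h_pos less_irrefl norm_zero mem_sphere_0 zero_neq_one)
  ultimately obtain v where v: "v \<in> C" and max: "\<And>u. u \<in> C \<Longrightarrow> f u \<le> f v"
    using continuous_attains_sup [of C f] by auto
  have v0: "v \<in> U" "v \<noteq> 0"
    using v by (auto simp: C_def)
  define r where "r = f v"
  \<comment> \<open>q is a positive semidefinite Hermitian form on U with q v = 0, so v lies in its radical\<close>
  define q where "q w = r * Re (h w w) - Re (h (X *v w) w)" for w
  have q: "q w \<ge> 0" if "w \<in> U" for w
  proof (cases "w = 0")
    case False
    then have "(1 / norm w) *\<^sub>R w \<in> C"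
      using sU that by (auto simp: C_def subspace_scale)
    moreover have "f ((1 / norm w) *\<^sub>R w) = f w"
      using False by (simp add: f_def h_simps matrix_vector_scaleR_right)
    ultimately have "f w \<le> r"
      using max r_def by fastforce
    then show ?thesis
      using h_pos [OF False] by (simp add: f_def q_def field_simps)
  qed (simp add: q_def h_simps)
  have qv: "q v = 0"
    using h_pos [OF v0(2)] by (simp add: q_def r_def f_def)
  \<comment> \<open>the radical condition is tested in the direction of y itself\<close>
  define y where "y = r *\<^sub>R v - X *v v"
  have "y \<in> U"
    unfolding y_def using v0 inv sU by (intro subspace_diff subspace_scale) auto
  have "0 \<le> 2 * t * Re (h y y) + t\<^sup>2 * q y" for t
  proof -
    have "h (X *v y) v = cnj (h (X *v v) y)"
      using selfadjD [OF X, of y v] by (simp add: h_cnj)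
    moreover have "h y v = cnj (h v y)"
      by (simp add: h_cnj)
    ultimately have "q (v + t *\<^sub>R y) = q v + 2 * t * (r * Re (h v y) - Re (h (X *v v) y)) + t\<^sup>2 * q y"
      unfolding q_def
      by (simp add: h_simps matrix_vector_right_distrib matrix_vector_scaleR_right algebra_simps power2_eq_square)
    moreover have "r * Re (h v y) - Re (h (X *v v) y) = Re (h y y)"
      by (subst (3) y_def) (simp add: h_simps)
    moreover have "v + t *\<^sub>R y \<in> U"
      using v0 \<open>y \<in> U\<close> sU by (intro subspace_add subspace_scale)
    ultimately show ?thesis
      using q [of "v + t *\<^sub>R y"] qv by simp
  qed
  then have "Re (h y y) = 0"
    by (rule linear_coefficient_zero)
  then have "y = 0"
    using h_pos [of y] by auto
  then show thesis
    using that [of v r] v0 by (simp add: y_def)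
qed

text \<open>On a nonzero invariant subspace of least dimension every operator of the family acts as a
  scalar, since its eigenspaces are invariant under the others.\<close>

lemma joint_eigenvector:
  assumes S: "\<And>X. X \<in> S \<Longrightarrow> selfadj X" "\<And>X Y. X \<in> S \<Longrightarrow> Y \<in> S \<Longrightarrow> X ** Y = Y ** X"
    and U: "vec.subspace U" "U \<noteq> {0}" and inv: "\<And>X u. X \<in> S \<Longrightarrow> u \<in> U \<Longrightarrow> X *v u \<in> U"
  obtains v where "v \<in> U" "v \<noteq> 0" "\<And>X. X \<in> S \<Longrightarrow> \<exists>r. X *v v = r *\<^sub>R v"
proof -
  let ?P = "\<lambda>T. vec.subspace T \<and> T \<subseteq> U \<and> T \<noteq> {0} \<and> (\<forall>X\<in>S. \<forall>u\<in>T. X *v u \<in> T)"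
  have "?P U"
    using U inv by auto
  from ex_has_least_nat [where P = ?P and m = vec.dim, OF this]
  obtain T where T: "?P T" and min: "\<And>T'. ?P T' \<Longrightarrow> vec.dim T \<le> vec.dim T'"
    by auto
  have scalar: "\<exists>r. \<forall>u\<in>T. X *v u = r *\<^sub>R u" if X: "X \<in> S" for X
  proof -
    obtain v r where v: "v \<in> T" "v \<noteq> 0" "X *v v = r *\<^sub>R v"
      using selfadj_eigenvector [OF S(1) [OF X], of T] T X by blast
    define E where "E = T \<inter> {u. X *v u = r *\<^sub>R u}"
    have "vec.subspace E"
      using T unfolding E_def by (intro vec.subspace_inter subspace_eigenspace) auto
    moreover have "X' *v u \<in> E" if "X' \<in> S" "u \<in> E" for X' u
    proof -
      have "X *v (X' *v u) = X' *v (X *v u)"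
        using S(2) [OF X that(1)] by (simp add: matrix_vector_mul_assoc)
      then show ?thesis
        using that T by (auto simp: E_def matrix_vector_scaleR_right)
    qed
    moreover have "E \<noteq> {0}"
      using v by (auto simp: E_def)
    ultimately have "?P E"
      using T by (auto simp: E_def)
    then have "E = T"
      using min T by (intro vec.subspace_dim_equal) (auto simp: E_def)
    then show ?thesis
      by (auto simp: E_def)
  qed
  obtain v where "v \<in> T" "v \<noteq> 0"
    using T vec.subspace_0 by blast
  show thesis
  proof (rule that)
    show "v \<in> U"
      using T \<open>v \<in> T\<close> by auto
    show "\<exists>r. X *v v = r *\<^sub>R v" if "X \<in> S" for X
      using scalar [OF that] \<open>v \<in> T\<close> by auto
  qed (rule \<open>v \<noteq> 0\<close>)
qed

text \<open>Indexing orthonormal bases by \<open>'n\<close> makes every operator of interest a matrix over one fixed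
  index type.\<close>

definition onb :: "('n \<Rightarrow> complex^'n) \<Rightarrow> bool" where
  "onb b \<longleftrightarrow> (\<forall>i j. h (b i) (b j) = (if i = j then 1 else 0)) \<and>
     (\<forall>v. v = (\<Sum>i\<in>UNIV. h v (b i) *s b i))"

lemma onb_orthonormal: "onb b \<Longrightarrow> h (b i) (b j) = (if i = j then 1 else 0)"
  by (simp add: onb_def)

lemma onb_expand: "onb b \<Longrightarrow> (\<Sum>i\<in>UNIV. h v (b i) *s b i) = v"
  unfolding onb_def by (drule conjunct2, drule spec, rule sym)

lemma onb_parseval:
  assumes "onb b"
  shows "h v w = (\<Sum>i\<in>UNIV. h v (b i) * cnj (h w (b i)))"
proof -
  have "h v w = h (\<Sum>i\<in>UNIV. h v (b i) *s b i) w"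
    by (simp add: onb_expand [OF assms])
  then show ?thesis
    by (simp add: h_sum_left h_simps h_cnj)
qed

lemma onb_ext: "onb b \<Longrightarrow> (\<And>i. h v (b i) = h w (b i)) \<Longrightarrow> v = w"
  by (metis (mono_tags, lifting) onb_expand sum.cong)

lemma onb_matrix_vector:
  fixes A :: "complex^'n^'n"
  shows "onb b \<Longrightarrow> A *v v = (\<Sum>i\<in>UNIV. h v (b i) *s (A *v b i))"
  by (subst (1) onb_expand [symmetric]) (simp_all add: matrix_vector_mult_sum vector_scalar_commute)

lemma onb_matrix_ext:
  fixes A B :: "complex^'n^'n"
  shows "onb b \<Longrightarrow> (\<And>i. A *v b i = B *v b i) \<Longrightarrow> A = B"
  unfolding matrix_eq by (metis (no_types, lifting) onb_matrix_vector sum.cong)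

lemma onb_nonzero: "onb b \<Longrightarrow> b i \<noteq> 0"
  using onb_orthonormal [of b i i] by (auto simp: h_simps)

lemma orthonormal_set_independent:
  assumes "finite B" "\<And>v w. v \<in> B \<Longrightarrow> w \<in> B \<Longrightarrow> h v w = (if v = w then 1 else 0)"
  shows "vec.independent B"
proof (rule vec.independent_if_scalars_zero [OF assms(1)])
  fix f x
  assume "(\<Sum>v\<in>B. f v *s v) = 0" "x \<in> B"
  then have "0 = h (\<Sum>v\<in>B. f v *s v) x"
    by (simp add: h_simps)
  also have "\<dots> = (\<Sum>v\<in>B. f v * (if v = x then 1 else 0))"
    using assms \<open>x \<in> B\<close> by (auto simp: h_sum_left h_simps intro!: sum.cong)
  also have "\<dots> = f x"
    using assms(1) \<open>x \<in> B\<close> by (simp add: if_distrib cong: if_cong)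
  finally show "f x = 0"
    by simp
qed

text \<open>A largest orthonormal set of joint eigenvectors is a basis: otherwise its orthogonal complement is
  nonzero and invariant, hence contains another joint eigenvector.\<close>

lemma joint_eigenbasis:
  assumes S: "\<And>X. X \<in> S \<Longrightarrow> selfadj X" "\<And>X Y. X \<in> S \<Longrightarrow> Y \<in> S \<Longrightarrow> X ** Y = Y ** X"
  obtains b l where "onb b" "\<And>X i. X \<in> S \<Longrightarrow> X *v b i = l i X *\<^sub>R b i"
proof -
  let ?eig = "\<lambda>v. \<forall>X\<in>S. \<exists>r. X *v v = r *\<^sub>R v"
  let ?P = "\<lambda>B. finite B \<and> (\<forall>v\<in>B. ?eig v) \<and> (\<forall>v\<in>B. \<forall>w\<in>B. h v w = (if v = w then 1 else 0))"
  have ind: "vec.independent B" if "?P B" for B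
    by (rule orthonormal_set_independent) (use that in auto)
  have "card B \<le> CARD('n)" if "?P B" for B
    using vec.independent_card_le_dim [OF subset_UNIV ind [OF that]] by (simp add: vec_dim_card del: vec.dim_UNIV)
  then have bound: "\<forall>B. ?P B \<longrightarrow> card B < Suc CARD('n)"
    by (intro allI impI le_imp_less_Suc)
  have "?P {}"
    by simp
  from Lattices_Big.ex_has_greatest_nat [where P = ?P, OF this bound]
  obtain B where B: "?P B" and max: "\<And>B'. ?P B' \<Longrightarrow> card B' \<le> card B"
    by auto
  define U where "U = {u. \<forall>v\<in>B. h u v = 0}"
  have sU: "vec.subspace U"
    by (auto simp: U_def vec.subspace_def h_simps)
  have "U = {0}"
  proof (rule ccontr)
    assume "U \<noteq> {0}"
    have inv: "X *v u \<in> U" if X: "X \<in> S" and "u \<in> U" for X u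
      unfolding U_def
    proof safe
      fix v assume "v \<in> B"
      then obtain r where "X *v v = r *\<^sub>R v"
        using B X by blast
      then have "h (X *v u) v = r *\<^sub>R h u v"
        using selfadjD [OF S(1) [OF X], of u v] by (simp add: h_simps)
      then show "h (X *v u) v = 0"
        using that \<open>v \<in> B\<close> by (simp add: U_def)
    qed
    obtain u where u: "u \<in> U" "u \<noteq> 0" "?eig u"
    proof (rule joint_eigenvector [of S U])
      show "X ** Y = Y ** X" if "X \<in> S" "Y \<in> S" for X Y
        by (rule S(2) [OF that])
    qed (use S(1) sU inv \<open>U \<noteq> {0}\<close> that in auto)
    define c where "c = 1 / sqrt (Re (h u u))"
    define w where "w = c *\<^sub>R u"
    have c: "c * c * Re (h u u) = 1" 
      using h_pos [OF u(2)] by (simp add: c_def)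
    have ww: "h w w = 1"
    proof -
      have "h w w = complex_of_real (c * c * Re (h u u))"
        using h_self_real [of u] by (simp add: w_def h_simps scaleR_conv_of_real [where 'a = complex])
      then show ?thesis
        unfolding c by simp
    qed
    have "w \<in> U"
      using u sU by (simp add: w_def scaleR_eq_scale vec.subspace_scale)
    then have wB: "h w v = 0" "h v w = 0" if "v \<in> B" for v
      using that h_cnj [of w v] by (auto simp: U_def)
    have "w \<notin> B"
      using wB ww by auto
    moreover have "?eig w"
      unfolding w_def matrix_vector_scaleR_right using u(3) by (metis scaleR_left_commute)
    then have "?P (insert w B)"
      using B ww wB \<open>w \<notin> B\<close> by auto
    ultimately show False
      using max [of "insert w B"] B by simp
  qed
  have expand: "v = (\<Sum>w\<in>B. h v w *s w)" for v
  proof -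
    have "h (v - (\<Sum>w\<in>B. h v w *s w)) x = 0" if "x \<in> B" for x
    proof -
      have "h (\<Sum>w\<in>B. h v w *s w) x = (\<Sum>w\<in>B. h v w * (if w = x then 1 else 0))"
        using B that by (auto simp: h_sum_left h_simps intro!: sum.cong)
      also have "\<dots> = h v x"
        using B that by (simp add: if_distrib cong: if_cong)
      finally show ?thesis
        by (simp add: h_simps)
    qed
    then have "v - (\<Sum>w\<in>B. h v w *s w) \<in> U"
      by (simp add: U_def)
    then show ?thesis
      using \<open>U = {0}\<close> by simp
  qed
  have "v \<in> vec.span B" for v
    by (subst expand) (intro vec.span_sum vec.span_scale vec.span_base)
  then have "card B = CARD('n)"
    using vec.dim_span_eq_card_independent [OF ind [OF B]] vec_dim_card [where 'a = complex and 'n = 'n]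
    by (metis UNIV_eq_I)
  then obtain b where b: "bij_betw b (UNIV :: 'n set) B"
    using B by (metis finite_same_card_bij finite_class.finite_UNIV)
  have "onb b"
    unfolding onb_def
  proof (intro conjI allI)
    show "h (b i) (b j) = (if i = j then 1 else 0)" for i j
      using B b by (metis UNIV_I bij_betw_def bij_betwE inj_eq)
    show "v = (\<Sum>i\<in>UNIV. h v (b i) *s b i)" for v
      by (subst expand) (rule sum.reindex_bij_betw [OF b, symmetric])
  qed
  moreover have "\<exists>r. X *v b i = r *\<^sub>R b i" if "X \<in> S" for X i
    using B b that by (metis UNIV_I bij_betwE)
  then have "X \<in> S \<Longrightarrow> X *v b i = (SOME r. X *v b i = r *\<^sub>R b i) *\<^sub>R b i" for X i
    by (rule someI_ex)
  ultimately show thesis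
    by (rule that)
qed

lemma selfadj_eigenbasis:
  assumes "selfadj X"
  obtains b l where "onb b" "\<And>i. X *v b i = l i *\<^sub>R b i"
proof (rule joint_eigenbasis [of "{X}"])
  fix b l assume "onb b" "\<And>Y i. Y \<in> {X} \<Longrightarrow> Y *v b i = l i Y *\<^sub>R b i"
  then show thesis
    using that [of b "\<lambda>i. l i X"] by simp
qed (use assms in auto)

lemma mexp_adjoint:
  assumes "\<And>v w. h (X *v v) w = h v (X' *v w)"
  shows "h (mexp X *v v) w = h v (mexp X' *v w)"
proof -
  have "h (((*v) X ^^ k) v) w = h v (((*v) X' ^^ k) w)" for k
    by (induction k arbitrary: w) (simp_all add: assms funpow_swap1 [of "(*v) X'"])
  moreover have "(\<lambda>k. h ((1 / fact k) *\<^sub>R (((*v) X ^^ k) v)) w) sums h (mexp X *v v) w"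
    by (rule bounded_linear.sums [OF bounded_bilinear.bounded_linear_left [OF bounded_bilinear_h] mexp_vector_sums])
  moreover have "(\<lambda>k. h v ((1 / fact k) *\<^sub>R (((*v) X' ^^ k) w))) sums h v (mexp X' *v w)"
    by (rule bounded_linear.sums [OF bounded_bilinear.bounded_linear_right [OF bounded_bilinear_h] mexp_vector_sums])
  ultimately show ?thesis
    by (simp add: h_simps sums_unique2)
qed

lemma mexp_selfadj: "selfadj X \<Longrightarrow> selfadj (mexp X)"
  unfolding selfadj_def using mexp_adjoint by blast

text \<open>The uniqueness of the Hermitian factor in a polar decomposition. The hypothesis says
  \<open>exp(2X) = exp(2Y)\<close>; an eigenvector of \<open>X\<close> only involves eigenvectors of \<open>Y\<close> for the same
  eigenvalue, because the real exponential is injective.\<close>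

lemma mexp_inj_on_selfadj:
  assumes X: "selfadj X" and Y: "selfadj Y"
    and eq: "\<And>v w. h (mexp X *v v) (mexp X *v w) = h (mexp Y *v v) (mexp Y *v w)"
  shows "X = Y"
proof -
  obtain b l where b: "onb b" and l: "\<And>i. X *v b i = l i *\<^sub>R b i"
    using selfadj_eigenbasis [OF X] by blast
  obtain c m where c: "onb c" and m: "\<And>i. Y *v c i = m i *\<^sub>R c i"
    using selfadj_eigenbasis [OF Y] by blast
  have eX: "h (mexp X *v v) (mexp X *v w) = h v (mexp X *v (mexp X *v w))"
    and eY: "h (mexp Y *v v) (mexp Y *v w) = h v (mexp Y *v (mexp Y *v w))" for v w
    using mexp_selfadj X Y by (simp_all add: selfadjD)
  have zero: "m j = l i" if "h (b i) (c j) \<noteq> 0" for i j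
  proof -
    have "h (b i) (mexp Y *v (mexp Y *v c j)) = h (b i) (mexp X *v (mexp X *v c j))"
      using eq eX eY by metis
    also have "\<dots> = h (mexp X *v (mexp X *v b i)) (c j)"
      using mexp_selfadj [OF X] by (simp add: selfadjD)
    finally have "(exp (m j))\<^sup>2 *\<^sub>R h (b i) (c j) = (exp (l i))\<^sup>2 *\<^sub>R h (b i) (c j)"
      using mexp_eigenvector [OF l] mexp_eigenvector [OF m]
      by (simp add: h_simps matrix_vector_scaleR_right power2_eq_square)
    then have "(exp (m j))\<^sup>2 = (exp (l i))\<^sup>2"
      using that by simp
    then show ?thesis
      by (simp add: power2_eq_iff) (metis exp_gt_zero exp_inj_iff less_asym neg_0_less_iff_less)
  qed
  show ?thesis
  proof (rule onb_matrix_ext [OF b], rule onb_ext [OF c])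
    fix i j
    show "h (X *v b i) (c j) = h (Y *v b i) (c j)"
      using zero [of i j] selfadjD [OF Y, of "b i" "c j"] by (auto simp: l m h_simps)
  qed
qed

end

section \<open>Groups with a polar decomposition and their Lie algebras\<close>

lemma matrix_inv_eqI:
  fixes A B :: "complex^'n^'n"
  assumes "A ** B = mat 1"
  shows "matrix_inv A = B"
proof -
  have "B ** A = mat 1"
    by (rule matrix_left_right_inverse [THEN iffD1, OF assms])
  with assms have "A ** matrix_inv A = mat 1 \<and> matrix_inv A ** A = mat 1"
    unfolding matrix_inv_def by (intro someI [of "\<lambda>C. A ** C = mat 1 \<and> C ** A = mat 1" B]) (rule conjI)
  then have "matrix_inv A = matrix_inv A ** (A ** B)"
    using assms by simp
  also have "\<dots> = B"
    using \<open>A ** matrix_inv A = mat 1 \<and> _\<close> by (simp add: matrix_mul_assoc)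
  finally show ?thesis .
qed

lemma det_tendsto: "(f \<longlongrightarrow> A) F \<Longrightarrow> ((\<lambda>x. det (f x)) \<longlongrightarrow> det A) F"
  for A :: "complex^'n^'n"
  unfolding det_def by (intro tendsto_intros)

lemma subspace_derivative:
  assumes "subspace S" "\<And>t. f t \<in> S" "(f has_vector_derivative D) (at 0)"
  shows "D \<in> (S :: 'a::euclidean_space set)"
proof (rule closed_sequentially [OF closed_subspace [OF assms(1)]])
  show "(\<lambda>n. real n *\<^sub>R (f (1 / real n) - f 0)) \<longlonglongrightarrow> D"
    by (rule has_vector_derivative_imp_difference_quotient [OF assms(3)])
  show "real n *\<^sub>R (f (1 / real n) - f 0) \<in> S" for n
    using assms by (intro subspace_scale subspace_diff)
qed

context hermitian
begin

lemma h_norm_lower_bound: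
  obtains m where "m > 0" "\<And>v. m * (norm v)\<^sup>2 \<le> Re (h v v)"
proof -
  have "continuous_on (sphere 0 1) (\<lambda>v. Re (h v v))"
    by (intro continuous_intros h_continuous_on)
  moreover have "sphere 0 1 \<noteq> ({} :: (complex^'n) set)"
    by simp
  ultimately obtain u where u: "u \<in> sphere 0 1" "\<And>v. v \<in> sphere 0 1 \<Longrightarrow> Re (h u u) \<le> Re (h v v)"
    using continuous_attains_inf [of "sphere 0 1" "\<lambda>v. Re (h v v)"] by auto
  show thesis
  proof (rule that [of "Re (h u u)"])
    show "Re (h u u) > 0"
      using u(1) by (intro h_pos) auto
    show "Re (h u u) * (norm v)\<^sup>2 \<le> Re (h v v)" for v
    proof (cases "v = 0")
      case False
      then have "Re (h u u) \<le> Re (h ((1 / norm v) *\<^sub>R v) ((1 / norm v) *\<^sub>R v))"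
        by (intro u(2)) simp
      also have "\<dots> = Re (h v v) / (norm v)\<^sup>2"
        by (simp add: h_simps power2_eq_square)
      finally show ?thesis
        using False by (simp add: field_simps)
    qed (simp add: h_simps)
  qed
qed

text \<open>The operator norm with respect to \<open>h\<close> is the spectral radius, and all norms are equivalent; the point is
  that the constant is the same for all \<open>X\<close>.\<close>

lemma selfadj_norm_bound:
  obtains C where "\<And>X L. selfadj X \<Longrightarrow> 0 \<le> L \<Longrightarrow> (\<And>v r. v \<noteq> 0 \<Longrightarrow> X *v v = r *\<^sub>R v \<Longrightarrow> \<bar>r\<bar> \<le> L) \<Longrightarrow> norm X \<le> C * L"
proof -
  obtain m where m: "m > 0" "\<And>v. m * (norm v)\<^sup>2 \<le> Re (h v v)"
    using h_norm_lower_bound by blast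
  obtain H where H: "\<And>v w. norm (h v w) \<le> norm v * norm w * H" "H > 0"
    using bounded_bilinear.pos_bounded [OF bounded_bilinear_h] by blast
  obtain M where M: "\<And>f. norm (matrix_of_endo f :: complex^'n^'n) \<le> norm f * M" "M > 0"
    using bounded_linear.pos_bounded [OF bounded_linear_matrix_of_endo] by blast
  show thesis
  proof (rule that [of "real CARD('n) * (H / m) * M"])
    fix X :: "complex^'n^'n" and L
    assume X: "selfadj X" and L: "0 \<le> L" "\<And>v r. v \<noteq> 0 \<Longrightarrow> X *v v = r *\<^sub>R v \<Longrightarrow> \<bar>r\<bar> \<le> L"
    obtain b l where b: "onb b" and l: "\<And>i. X *v b i = l i *\<^sub>R b i"
      using selfadj_eigenbasis [OF X] by blast
    have lL: "\<bar>l i\<bar> \<le> L" for i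
      using L(2) [OF onb_nonzero [OF b] l] .
    have nb: "(norm (b i))\<^sup>2 \<le> 1 / m" for i
      using m(2) [of "b i"] m(1) onb_orthonormal [OF b, of i i] by (simp add: field_simps)
    have "norm (X *v v) \<le> real CARD('n) * (H / m) * L * norm v" for v
    proof -
      have "norm (h v (b i) *s (l i *\<^sub>R b i)) \<le> (H / m) * L * norm v" for i
      proof -
        have "norm (h v (b i) *s (l i *\<^sub>R b i)) = norm (h v (b i)) * (\<bar>l i\<bar> * norm (b i))"
          by (simp add: norm_vec_def L2_set_def norm_mult power_mult_distrib sum_distrib_left [symmetric]
              real_sqrt_mult vector_smult_component)
        also have "\<dots> \<le> (norm v * norm (b i) * H) * (L * norm (b i))"
          using H lL L(1) by (intro mult_mono) auto
        also have "\<dots> = norm v * H * L * (norm (b i))\<^sup>2"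
          by (simp add: power2_eq_square)
        also have "\<dots> \<le> norm v * H * L * (1 / m)"
          using H L(1) nb by (intro mult_left_mono) auto
        finally show ?thesis
          by (simp add: mult_ac)
      qed
      then have "norm (\<Sum>i\<in>UNIV. h v (b i) *s (X *v b i)) \<le> (\<Sum>i\<in>(UNIV::'n set). (H / m) * L * norm v)"
        by (intro order_trans [OF norm_sum] sum_mono) (simp add: l)
      then show ?thesis
        by (simp add: onb_matrix_vector [OF b, of X v])
    qed
    then have "norm (endo_of X) \<le> real CARD('n) * (H / m) * L"
      unfolding norm_endo_def using H m L by (intro norm_blinfun_bound) auto
    then have "norm (endo_of X) * M \<le> real CARD('n) * (H / m) * L * M"
      using M(2) by (intro mult_right_mono) auto
    then show "norm X \<le> real CARD('n) * (H / m) * M * L"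
      using M(1) [of "endo_of X"] by (simp add: mult_ac)
  qed
qed

end

text \<open>These properties of the image of the Lie group suffice to recover its Lie algebra, as the set
  \<open>tangent\<close> below, without reference to charts.\<close>

locale polar_group = hermitian h for h :: "complex^'n \<Rightarrow> complex^'n \<Rightarrow> complex" +
  fixes G K p :: "(complex^'n^'n) set"
  assumes G_mult: "f \<in> G \<Longrightarrow> g \<in> G \<Longrightarrow> f ** g \<in> G"
    and G_det: "g \<in> G \<Longrightarrow> det g = 1"
    and K_one: "mat 1 \<in> K"
    and K_mult: "k \<in> K \<Longrightarrow> k' \<in> K \<Longrightarrow> k ** k' \<in> K"
    and K_inverse: "k \<in> K \<Longrightarrow> \<exists>k'\<in>K. k ** k' = mat 1"
    and K_compact: "compact K"
    and K_unitary: "k \<in> K \<Longrightarrow> h (k *v v) (k *v w) = h v w"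
    and p_subspace: "subspace p"
    and p_selfadj: "\<beta> \<in> p \<Longrightarrow> selfadj \<beta>"
    and polar: "G = {k ** mexp \<beta> | k \<beta>. k \<in> K \<and> \<beta> \<in> p}"
begin

lemma K_subset_G: "k \<in> K \<Longrightarrow> k \<in> G"
  using polar subspace_0 [OF p_subspace] by force

lemma mexp_in_G: "\<beta> \<in> p \<Longrightarrow> mexp \<beta> \<in> G"
  using polar K_one by force

lemma G_one: "mat 1 \<in> G"
  by (rule K_subset_G [OF K_one])

lemma matrix_inv_K:
  assumes "k \<in> K"
  shows "matrix_inv k \<in> K" "k ** matrix_inv k = mat 1" "matrix_inv k ** k = mat 1"
proof -
  obtain k' where "k' \<in> K" "k ** k' = mat 1"
    using K_inverse [OF assms] by auto
  then show "matrix_inv k \<in> K" "k ** matrix_inv k = mat 1" "matrix_inv k ** k = mat 1"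
    using matrix_inv_eqI matrix_left_right_inverse [THEN iffD1] by auto
qed

lemma matrix_inv_K_vector:
  "k \<in> K \<Longrightarrow> matrix_inv k *v (k *v v) = v" "k \<in> K \<Longrightarrow> k *v (matrix_inv k *v v) = v"
  by (simp_all add: matrix_vector_mul_assoc matrix_inv_K)

lemma K_adjoint: "k \<in> K \<Longrightarrow> h (k *v v) w = h v (matrix_inv k *v w)"
  using K_unitary [of k v "matrix_inv k *v w"] by (simp add: matrix_inv_K_vector)

text \<open>The polar decomposition identifies \<open>K\<close> and \<open>p\<close> inside \<open>G\<close>: by uniqueness, unitary elements have
  trivial Hermitian factor and positive elements have trivial unitary factor.\<close>

lemma unitary_in_K:
  assumes "g \<in> G" "\<And>v w. h (g *v v) (g *v w) = h v w"
  shows "g \<in> K"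
proof -
  obtain k \<beta> where k: "k \<in> K" "\<beta> \<in> p" "g = k ** mexp \<beta>"
    using assms(1) polar by auto
  have "\<beta> = 0"
  proof (rule mexp_inj_on_selfadj)
    show "h (mexp \<beta> *v v) (mexp \<beta> *v w) = h (mexp 0 *v v) (mexp 0 *v w)" for v w
      using assms(2) [of v w] K_unitary [OF k(1), of "mexp \<beta> *v v" "mexp \<beta> *v w"]
      by (simp add: k(3) matrix_vector_mul_assoc)
  qed (use k p_selfadj subspace_0 [OF p_subspace] in auto)
  then show ?thesis
    using k by simp
qed

lemma selfadj_in_p:
  assumes "selfadj X" "mexp X \<in> G"
  shows "X \<in> p"
proof -
  obtain k \<beta> where k: "k \<in> K" "\<beta> \<in> p" "mexp X = k ** mexp \<beta>"
    using assms(2) polar by auto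
  have "X = \<beta>"
  proof (rule mexp_inj_on_selfadj)
    show "h (mexp X *v v) (mexp X *v w) = h (mexp \<beta> *v v) (mexp \<beta> *v w)" for v w
      using K_unitary [OF k(1), of "mexp \<beta> *v v" "mexp \<beta> *v w"]
      by (simp add: k(3) matrix_vector_mul_assoc)
  qed (use assms k p_selfadj in auto)
  then show ?thesis
    using k by simp
qed

lemma matrix_inv_inv_K: "k \<in> K \<Longrightarrow> matrix_inv (matrix_inv k) = k"
  by (intro matrix_inv_eqI matrix_inv_K)

lemma K_adjoint': "k \<in> K \<Longrightarrow> h v (k *v w) = h (matrix_inv k *v v) w"
  using K_adjoint [of "matrix_inv k" v w] by (simp add: matrix_inv_K matrix_inv_inv_K)

lemma conj_by_vector: "conj_by k X *v v = k *v (X *v (matrix_inv k *v v))"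
  by (simp add: conj_by_def matrix_vector_mul_assoc matrix_mul_assoc)

lemma selfadj_conj_by: "k \<in> K \<Longrightarrow> selfadj X \<Longrightarrow> selfadj (conj_by k X)"
  by (simp add: selfadj_def conj_by_vector K_adjoint K_adjoint')

text \<open>Conjugation by \<open>k\<close> keeps \<open>exp \<beta>\<close> in \<open>G\<close> and \<open>\<beta>\<close> self-adjoint.\<close>

lemma conj_by_p:
  assumes k: "k \<in> K" and "\<beta> \<in> p"
  shows "conj_by k \<beta> \<in> p"
proof (rule selfadj_in_p)
  show "selfadj (conj_by k \<beta>)"
    by (intro selfadj_conj_by assms p_selfadj)
  have "mexp (conj_by k \<beta>) = k ** mexp \<beta> ** matrix_inv k"
    unfolding conj_by_def by (intro mexp_conj matrix_inv_K assms)
  then show "mexp (conj_by k \<beta>) \<in> G"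
    using assms by (simp add: G_mult K_subset_G mexp_in_G matrix_inv_K)
qed

text \<open>Since \<open>E\<close> is injective, \<open>exp (\<beta> n)\<close> is eventually bounded from above and from below, which
  bounds the eigenvalues of \<open>\<beta> n\<close> on both sides.\<close>

lemma bounded_logarithm:
  assumes \<beta>: "\<And>n. \<beta> n \<in> p" and lim: "(\<lambda>n. mexp (\<beta> n)) \<longlonglongrightarrow> E" and inj: "inj ((*v) E)"
  obtains R N where "\<And>n. n \<ge> N \<Longrightarrow> norm (\<beta> n) \<le> R"
proof -
  obtain C where C: "\<And>X L. selfadj X \<Longrightarrow> 0 \<le> L \<Longrightarrow> (\<And>v r. v \<noteq> 0 \<Longrightarrow> X *v v = r *\<^sub>R v \<Longrightarrow> \<bar>r\<bar> \<le> L) \<Longrightarrow> norm X \<le> C * L"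
    using selfadj_norm_bound by blast
  obtain B where B: "\<And>A v. norm ((A :: complex^'n^'n) *v v) \<le> norm A * norm v * B" "B > 0"
    using bounded_bilinear.pos_bounded [OF bounded_bilinear_matrix_vector_mult] by blast
  obtain \<delta> where \<delta>: "\<delta> > 0" "\<And>v. \<delta> * norm v \<le> norm (E *v v)"
    using linear_inj_bounded_below_pos [OF _ inj]
      bounded_linear.linear [OF bounded_linear_matrix_vector_right]
    by blast
  define M where "M = (norm E + \<delta> / (2 * B)) * B"
  have M: "M > 0"
    using B \<delta> by (auto simp: M_def intro!: mult_pos_pos add_nonneg_pos)
  obtain N where N: "\<And>n. n \<ge> N \<Longrightarrow> norm (mexp (\<beta> n) - E) < \<delta> / (2 * B)"
    using lim B \<delta> by (fastforce simp: LIMSEQ_iff dest: spec [of _ "\<delta> / (2 * B)"])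
  define L where "L = \<bar>ln (\<delta> / 2)\<bar> + \<bar>ln M\<bar>"
  show thesis
  proof (rule that)
    fix n assume n: "n \<ge> N"
    show "norm (\<beta> n) \<le> C * L"
    proof (rule C)
      fix v :: "complex^'n" and r
      assume v: "v \<noteq> 0" "\<beta> n *v v = r *\<^sub>R v"
      have e: "norm (mexp (\<beta> n) *v v) = exp r * norm v"
        by (simp add: mexp_eigenvector [OF v(2)])
      have "norm ((mexp (\<beta> n) - E) *v v) \<le> (\<delta> / (2 * B)) * norm v * B"
        using B(2) N [OF n] by (intro order_trans [OF B(1)] mult_right_mono) auto
      then have d: "norm (mexp (\<beta> n) *v v - E *v v) \<le> \<delta> / 2 * norm v"
        using B(2) by (simp add: matrix_vector_mult_diff_rdistrib)
      have "\<delta> / 2 * norm v \<le> exp r * norm v"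
        using d \<delta>(2) [of v] norm_triangle_ineq2 [of "E *v v" "mexp (\<beta> n) *v v"]
        by (simp add: e norm_minus_commute)
      then have "\<delta> / 2 \<le> exp r"
        using v by simp
      then have 1: "ln (\<delta> / 2) \<le> r"
        using \<delta>(1) by (metis exp_gt_zero half_gt_zero ln_exp ln_le_cancel_iff)
      have "exp r * norm v \<le> (norm E * norm v * B) + \<delta> / 2 * norm v"
        using d B(1) [of E v] norm_triangle_ineq2 [of "mexp (\<beta> n) *v v" "E *v v"] by (simp add: e)
      also have "\<dots> = M * norm v"
        using B(2) by (simp add: M_def field_simps)
      finally have "exp r \<le> M"
        using v by simp
      then have "r \<le> ln M"
        using M by (metis exp_gt_zero ln_exp ln_le_cancel_iff)
      with 1 show "\<bar>r\<bar> \<le> L"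
        by (auto simp: L_def)
    qed (use \<beta> p_selfadj in \<open>auto simp: L_def\<close>)
  qed
qed

text \<open>In a convergent sequence \<open>k n exp (\<beta> n)\<close> the unitary factors subconverge by compactness; the limit
  has determinant one, so the \<open>\<beta> n\<close> are bounded and subconverge as well.\<close>

lemma closed_G: "closed G"
  unfolding closed_sequential_limits
proof (intro allI impI, elim conjE)
  fix g l
  assume "\<forall>n. g n \<in> G" and lim: "g \<longlonglongrightarrow> l"
  then have "\<exists>k \<beta>. k \<in> K \<and> \<beta> \<in> p \<and> g n = k ** mexp \<beta>" for n
    using polar by blast
  then obtain k \<beta> where k: "\<And>n. k n \<in> K" and \<beta>: "\<And>n. \<beta> n \<in> p" and g: "\<And>n. g n = k n ** mexp (\<beta> n)"
    by metis
  have e: "mexp (\<beta> n) = matrix_inv (k n) ** g n" for n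
    by (simp add: g matrix_mul_assoc matrix_inv_K k)
  obtain q r where r: "strict_mono r" and q: "q \<in> K" "(\<lambda>n. matrix_inv (k (r n))) \<longlonglongrightarrow> q"
    using K_compact [unfolded compact_eq_seq_compact_metric]
    by (rule seq_compactE [where f = "\<lambda>n. matrix_inv (k n)"]) (auto simp: matrix_inv_K k o_def)
  have elim: "(\<lambda>n. mexp (\<beta> (r n))) \<longlonglongrightarrow> q ** l"
    unfolding e using LIMSEQ_subseq_LIMSEQ [OF lim r] q by (intro matrix_mult_tendsto) (auto simp: o_def)
  have "(\<lambda>n. det (g n)) \<longlonglongrightarrow> det l"
    by (rule det_tendsto [OF lim])
  then have "det l = 1"
    using \<open>\<forall>n. g n \<in> G\<close> by (simp add: G_det LIMSEQ_const_iff)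
  then have "invertible (q ** l)"
    using G_det [OF K_subset_G [OF q(1)]] by (simp add: invertible_det_nz det_mul)
  then have "inj ((*v) (q ** l))"
    by (simp add: inj_matrix_vector_mult)
  then obtain R N where R: "\<And>n. n \<ge> N \<Longrightarrow> norm (\<beta> (r n)) \<le> R"
    using bounded_logarithm [OF _ elim] \<beta> by metis
  have "compact (p \<inter> cball 0 R)"
    by (intro closed_Int_compact closed_subspace p_subspace) simp
  moreover have "\<beta> (r (n + N)) \<in> p \<inter> cball 0 R" for n
    using \<beta> R by simp
  ultimately obtain b s where s: "strict_mono s" and b: "b \<in> p" "(\<lambda>n. \<beta> (r (s n + N))) \<longlonglongrightarrow> b"
    unfolding compact_eq_seq_compact_metric
    by (elim seq_compactE [where f = "\<lambda>n. \<beta> (r (n + N))"]) (auto simp: o_def)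
  have "(\<lambda>n. mexp (\<beta> (r (s n + N)))) \<longlonglongrightarrow> mexp b"
    by (rule isCont_tendsto_compose [OF isCont_mexp b(2)])
  moreover have "(\<lambda>n. mexp (\<beta> (r (s n + N)))) \<longlonglongrightarrow> q ** l"
    using LIMSEQ_subseq_LIMSEQ [OF LIMSEQ_ignore_initial_segment [OF elim, of N] s] by (simp add: o_def)
  ultimately have "q ** l = mexp b"
    by (rule LIMSEQ_unique [symmetric])
  then have "l = matrix_inv q ** mexp b"
    by (metis matrix_inv_K(3) matrix_mul_assoc matrix_mul_lid q(1))
  then show "l \<in> G"
    using b q by (simp add: G_mult K_subset_G mexp_in_G matrix_inv_K)
qed

text \<open>The Lie algebra of \<open>G\<close>, as the set of velocities at the identity of arbitrary curves in \<open>G\<close>.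
  Only differentiability at \<open>0\<close> is asked for, so that curves coming from a chart qualify.\<close>

definition tangent :: "(complex^'n^'n) set" where
  "tangent = {X. \<exists>\<gamma> :: real \<Rightarrow> _. (\<forall>t. \<gamma> t \<in> G) \<and> \<gamma> 0 = mat 1 \<and> (\<gamma> has_vector_derivative X) (at 0)}"

lemma tangentI:
  "(\<And>t :: real. \<gamma> t \<in> G) \<Longrightarrow> \<gamma> 0 = mat 1 \<Longrightarrow> (\<gamma> has_vector_derivative X) (at 0) \<Longrightarrow> X \<in> tangent"
  by (auto simp: tangent_def)

lemma tangent_scale:
  assumes "X \<in> tangent"
  shows "r *\<^sub>R X \<in> tangent"
proof -
  obtain \<gamma> where \<gamma>: "\<And>t. \<gamma> t \<in> G" "\<gamma> 0 = mat 1" "(\<gamma> has_vector_derivative X) (at 0)"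
    using assms by (auto simp: tangent_def)
  have "((\<gamma> \<circ> (\<lambda>t. t * r)) has_vector_derivative r *\<^sub>R X) (at 0)"
    by (rule vector_diff_chain_at) (auto intro!: derivative_eq_intros simp: \<gamma> has_real_derivative_iff_has_vector_derivative [symmetric])
  then show ?thesis
    by (rule tangentI [rotated 2]) (simp_all add: \<gamma>)
qed

lemma matrix_power_in_G: "g \<in> G \<Longrightarrow> ((**) g ^^ n) (mat 1) \<in> G"
  by (induction n) (simp_all add: G_one G_mult)

text \<open>If \<open>\<gamma>\<close> has velocity \<open>X\<close>, then \<open>\<gamma> (1/n) ^ n\<close> tends to \<open>exp X\<close>, and \<open>G\<close> is closed.\<close>

lemma mexp_tangent:
  assumes "X \<in> tangent"
  shows "mexp X \<in> G"
proof -
  obtain \<gamma> where \<gamma>: "\<And>t. \<gamma> t \<in> G" "\<gamma> 0 = mat 1" "(\<gamma> has_vector_derivative X) (at 0)"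
    using assms by (auto simp: tangent_def)
  have "(\<lambda>n. real n *\<^sub>R (\<gamma> (1 / real n) - mat 1)) \<longlonglongrightarrow> X"
    using has_vector_derivative_imp_difference_quotient [OF \<gamma>(3)] by (simp add: \<gamma>)
  then have "(\<lambda>n. ((**) (\<gamma> (1 / real n)) ^^ n) (mat 1)) \<longlonglongrightarrow> mexp X"
    by (rule matrix_power_tendsto_mexp)
  then show ?thesis
    by (rule closed_sequentially [OF closed_G, rotated]) (simp add: matrix_power_in_G \<gamma>)
qed

lemma tangent_iff: "X \<in> tangent \<longleftrightarrow> (\<forall>t. mexp (t *\<^sub>R X) \<in> G)"
  using mexp_tangent tangent_scale tangentI [of "\<lambda>t. mexp (t *\<^sub>R X)" X] mexp_has_vector_derivative_0 [of X]
  by auto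

lemma tangent_add:
  assumes "X \<in> tangent" "Y \<in> tangent"
  shows "X + Y \<in> tangent"
proof (rule tangentI)
  show "mexp (t *\<^sub>R X) ** mexp (t *\<^sub>R Y) \<in> G" for t
    using assms by (simp add: G_mult tangent_iff)
  show "((\<lambda>t. mexp (t *\<^sub>R X) ** mexp (t *\<^sub>R Y)) has_vector_derivative X + Y) (at 0)"
    using matrix_mult_derivative [OF mexp_has_vector_derivative_0 [of X] mexp_has_vector_derivative_0 [of Y]]
    by (simp add: add.commute)
qed simp

lemma subspace_tangent: "subspace tangent"
proof (rule subspaceI)
  show "0 \<in> tangent"
    by (simp add: tangent_iff G_one)
qed (auto intro: tangent_add tangent_scale)

lemma tangent_conj:
  assumes "X \<in> tangent" "g \<in> G" "g' \<in> G" "g' ** g = mat 1"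
  shows "g ** X ** g' \<in> tangent"
  unfolding tangent_iff
proof
  fix t
  have "mexp (t *\<^sub>R (g ** X ** g')) = g ** mexp (t *\<^sub>R X) ** g'"
    using mexp_conj [OF assms(4), of "t *\<^sub>R X"] by (simp add: scaleR_matrix_mult)
  then show "mexp (t *\<^sub>R (g ** X ** g')) \<in> G"
    using assms by (simp add: G_mult tangent_iff)
qed

text \<open>The bracket is the derivative of the curve \<open>exp (tX) Y exp (-tX)\<close>, which stays in the closed
  subspace \<open>tangent\<close>.\<close>

lemma tangent_bracket:
  assumes X: "X \<in> tangent" and Y: "Y \<in> tangent"
  shows "X ** Y - Y ** X \<in> tangent"
proof (rule subspace_derivative [OF subspace_tangent])
  show "mexp (t *\<^sub>R X) ** Y ** mexp (t *\<^sub>R (- X)) \<in> tangent" for t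
    using mexp_minus_left [of "t *\<^sub>R X"] X Y mexp_tangent [OF tangent_scale [OF X, of t]]
      mexp_tangent [OF tangent_scale [OF X, of "- t"]]
    by (intro tangent_conj) auto
  have "((\<lambda>t. mexp (t *\<^sub>R X) ** Y ** mexp (t *\<^sub>R (- X))) has_vector_derivative
     (mexp (0 *\<^sub>R X) ** Y ** (- X) + (mexp (0 *\<^sub>R X) ** 0 + X ** Y) ** mexp (0 *\<^sub>R (- X)))) (at 0)"
    by (intro matrix_mult_derivative mexp_has_vector_derivative_0 has_vector_derivative_const)
  then show "((\<lambda>t. mexp (t *\<^sub>R X) ** Y ** mexp (t *\<^sub>R (- X))) has_vector_derivative X ** Y - Y ** X) (at 0)"
    by (simp add: minus_matrix_mult)
qed

lemma p_subset_tangent: "\<beta> \<in> p \<Longrightarrow> \<beta> \<in> tangent"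
  using subspace_scale [OF p_subspace] by (simp add: tangent_iff mexp_in_G)

lemma mexp_skew_in_K:
  assumes "Y \<in> tangent" "\<And>v w. h (Y *v v) w = - h v (Y *v w)"
  shows "mexp (t *\<^sub>R Y) \<in> K"
proof (rule unitary_in_K)
  show "mexp (t *\<^sub>R Y) \<in> G"
    using assms(1) by (simp add: tangent_iff)
  have "h (mexp (t *\<^sub>R Y) *v v) w = h v (mexp (- (t *\<^sub>R Y)) *v w)" for v w
  proof (rule mexp_adjoint)
    show "h ((t *\<^sub>R Y) *v v) w = h v ((- (t *\<^sub>R Y)) *v w)" for v w
      using assms(2) matrix_vector_mult_scaleR [of "- t" Y w] by (simp add: matrix_vector_mult_scaleR h_simps)
  qed
  then show "h (mexp (t *\<^sub>R Y) *v v) (mexp (t *\<^sub>R Y) *v w) = h v w" for v w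
    by (simp add: matrix_vector_mul_assoc mexp_minus_left)
qed

lemma bracket_skew:
  assumes "selfadj X" "selfadj Y"
  shows "h ((X ** Y - Y ** X) *v v) w = - h v ((X ** Y - Y ** X) *v w)"
  using assms
  by (simp add: matrix_vector_mult_diff_rdistrib matrix_vector_mul_assoc [symmetric] h_simps selfadjD)

end

section \<open>Irreducible subspaces of parabolic subgroups\<close>

text \<open>Applying \<open>T - e\<close> removes the component for the eigenvalue \<open>e\<close> and rescales the others, so the
  components can be isolated one after the other.\<close>

lemma eigencomponents_in_invariant_subspace:
  fixes T :: "'a::real_vector \<Rightarrow> 'a"
  assumes S: "subspace S" and T: "linear T" "\<And>x. x \<in> S \<Longrightarrow> T x \<in> S"
    and "finite D" "\<And>d. d \<in> D \<Longrightarrow> T (x d) = d *\<^sub>R x d" "sum x D \<in> S" "d \<in> D"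
  shows "x d \<in> S"
  using assms(4-)
proof (induction D arbitrary: x d rule: finite_induct)
  case (insert e D)
  have "T (sum x (insert e D)) - e *\<^sub>R sum x (insert e D) \<in> S"
    using insert.prems S T by (intro subspace_diff subspace_scale) auto
  also have "T (sum x (insert e D)) - e *\<^sub>R sum x (insert e D) = (\<Sum>d\<in>D. (d - e) *\<^sub>R x d)"
    using insert by (simp add: linear_add [OF T(1)] linear_sum [OF T(1)] scaleR_diff_left sum_subtractf
        scaleR_right_distrib scaleR_sum_right)
  finally have sum: "(\<Sum>d\<in>D. (d - e) *\<^sub>R x d) \<in> S" .
  have D: "x d \<in> S" if "d \<in> D" for d
  proof -
    have "(d - e) *\<^sub>R x d \<in> S"
    proof (rule insert.IH [OF _ sum that])
      show "T ((d - e) *\<^sub>R x d) = d *\<^sub>R ((d - e) *\<^sub>R x d)" if "d \<in> D" for d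
        using insert.prems that by (simp add: linear_scale [OF T(1)])
    qed
    then have "(1 / (d - e)) *\<^sub>R ((d - e) *\<^sub>R x d) \<in> S"
      by (rule subspace_scale [OF S])
    moreover have "d \<noteq> e"
      using insert.hyps that by auto
    ultimately show ?thesis
      by simp
  qed
  have "x e = sum x (insert e D) - sum x D"
    using insert by simp
  then have "x e \<in> S"
    using insert.prems D subspace_diff [OF S] subspace_sum [OF S] by metis
  then show ?case
    using insert.prems D by auto
qed simp

lemma matrix_vector_mult_sum_left: "sum A I *v v = (\<Sum>i\<in>I. A i *v v)" for A :: "'i \<Rightarrow> complex^'n^'n"
  by (rule linear_sum [OF bounded_linear.linear
        [OF bounded_linear_matrix_vector_left]])

lemma exp_mult_at_bot:
  assumes "d > (0 :: real)"
  shows "((\<lambda>s. exp (s * d)) \<longlongrightarrow> 0) at_bot"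
  using filterlim_compose [OF exp_at_bot filterlim_tendsto_pos_mult_at_bot [OF tendsto_const assms filterlim_ident]]
  by (simp add: mult.commute)

context hermitian
begin

lemma h_matrix_onb:
  fixes Y :: "complex^'n^'n"
  assumes "onb b"
  shows "h (Y *v v) w = (\<Sum>j\<in>UNIV. h v (b j) * h (Y *v b j) w)"
  by (simp add: onb_matrix_vector [OF assms, of Y v] h_sum_left h_simps)

lemma onb_entries_eqI:
  fixes X Y :: "complex^'n^'n"
  assumes "onb b" "\<And>i j. h (X *v b j) (b i) = h (Y *v b j) (b i)"
  shows "X = Y"
  using assms by (intro onb_matrix_ext onb_ext) auto

text \<open>Truncation of \<open>X\<close> to a set of matrix positions. In an eigenbasis of \<open>\<beta>\<close> with eigenvalues \<open>l\<close>, the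
  positions with \<open>l i - l j = d\<close> give the eigencomponent of \<open>X\<close> for the eigenvalue \<open>d\<close> of \<open>ad \<beta>\<close>.\<close>

definition entries_in :: "('n \<Rightarrow> complex^'n) \<Rightarrow> ('n \<times> 'n) set \<Rightarrow> complex^'n^'n \<Rightarrow> complex^'n^'n" where
  "entries_in b M X = matrix (\<lambda>v. \<Sum>i\<in>UNIV.
     (\<Sum>j\<in>UNIV. if (i, j) \<in> M then h v (b j) * h (X *v b j) (b i) else 0) *s b i)"

lemma h_entries_in:
  assumes b: "onb b"
  shows "h (entries_in b M X *v b j) (b i) = (if (i, j) \<in> M then h (X *v b j) (b i) else 0)"
proof -
  define f where "f i v = (\<Sum>j\<in>UNIV. if (i, j) \<in> M then h v (b j) * h (X *v b j) (b i) else 0)" for i v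
  have f_add: "f i (v + w) = f i v + f i w" for i v w
    unfolding f_def sum.distrib [symmetric] by (rule sum.cong) (auto simp: h_simps distrib_right)
  have f_scale: "f i (z *s v) = z * f i v" for i z v
    unfolding f_def sum_distrib_left by (rule sum.cong) (auto simp: h_simps)
  have "Vector_Spaces.linear (*s) (*s) (\<lambda>v. \<Sum>i\<in>UNIV. f i v *s b i)"
    by unfold_locales
      (simp_all add: f_add f_scale vec.scale_left_distrib sum.distrib sum_cmul [symmetric] vector_smult_assoc)
  then have "matrix (\<lambda>v. \<Sum>i\<in>UNIV. f i v *s b i) *v v = (\<Sum>i\<in>UNIV. f i v *s b i)" for v
    by (rule matrix_works)
  then have "entries_in b M X *v b j = (\<Sum>i\<in>UNIV. f i (b j) *s b i)"
    by (simp add: entries_in_def f_def)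
  also have "h \<dots> (b i) = f i (b j)"
    by (simp add: h_sum_left h_simps onb_orthonormal [OF b] if_distrib cong: if_cong)
  also have "\<dots> = (\<Sum>k\<in>UNIV. if j = k then (if (i, k) \<in> M then h (X *v b k) (b i) else 0) else 0)"
    unfolding f_def by (rule sum.cong) (auto simp: onb_orthonormal [OF b])
  finally show ?thesis
    by simp
qed

lemma h_eigen_adjoint:
  assumes "selfadj \<beta>" "\<beta> *v w = r *\<^sub>R w"
  shows "h (\<beta> *v v) w = r *\<^sub>R h v w"
  using assms by (simp add: selfadjD h_simps)

lemma eigenvector_iff_coefficients:
  assumes \<beta>: "selfadj \<beta>" and b: "onb b" and l: "\<And>i. \<beta> *v b i = l i *\<^sub>R b i"
  shows "\<beta> *v v = c *\<^sub>R v \<longleftrightarrow> (\<forall>i. h v (b i) \<noteq> 0 \<longrightarrow> l i = c)"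
proof
  assume v: "\<beta> *v v = c *\<^sub>R v"
  show "\<forall>i. h v (b i) \<noteq> 0 \<longrightarrow> l i = c"
  proof (intro allI impI)
    fix i assume "h v (b i) \<noteq> 0"
    then show "l i = c"
      using h_eigen_adjoint [OF \<beta> l, of v i] by (simp add: v h_simps)
  qed
next
  assume "\<forall>i. h v (b i) \<noteq> 0 \<longrightarrow> l i = c"
  then show "\<beta> *v v = c *\<^sub>R v"
    by (intro onb_ext [OF b]) (auto simp: h_eigen_adjoint [OF \<beta> l] h_simps)
qed

lemma mexp_eigen_adjoint:
  assumes "selfadj \<beta>" "\<beta> *v w = r *\<^sub>R w"
  shows "h (mexp (t *\<^sub>R \<beta>) *v v) w = exp (t * r) *\<^sub>R h v w"
proof -
  have "h (mexp (t *\<^sub>R \<beta>) *v v) w = h v (mexp (t *\<^sub>R \<beta>) *v w)"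
    using assms(1) by (intro mexp_adjoint) (simp add: matrix_vector_mult_scaleR h_simps selfadjD)
  also have "mexp (t *\<^sub>R \<beta>) *v w = exp (t * r) *\<^sub>R w"
    by (rule mexp_eigenvector) (simp add: matrix_vector_mult_scaleR assms)
  finally show ?thesis
    by (simp add: h_simps)
qed

lemma mexp_conj_entries:
  assumes "selfadj \<beta>" "\<And>i. \<beta> *v b i = l i *\<^sub>R b i"
  shows "h ((mexp (s *\<^sub>R \<beta>) ** X ** mexp (- s *\<^sub>R \<beta>)) *v b j) (b i) =
    exp (s * (l i - l j)) *\<^sub>R h (X *v b j) (b i)"
proof -
  have "mexp (- s *\<^sub>R \<beta>) *v b j = exp (- s * l j) *\<^sub>R b j"
    by (rule mexp_eigenvector) (metis assms(2) matrix_vector_mult_scaleR scaleR_scaleR)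
  then show ?thesis
    by (simp add: matrix_vector_mul_assoc [symmetric] matrix_vector_scaleR_right mexp_eigen_adjoint [OF assms]
        h_simps exp_add [symmetric] algebra_simps)
qed

end

context polar_group
begin

text \<open>The Lie algebra is invariant under \<open>ad \<beta>\<close>, which is diagonalisable with real eigenvalues.\<close>

lemma tangent_ad_component:
  assumes \<beta>: "\<beta> \<in> p" and b: "onb b" and l: "\<And>i. \<beta> *v b i = l i *\<^sub>R b i" and X: "X \<in> tangent"
  shows "entries_in b {(i, j). l i - l j = d} X \<in> tangent"
proof -
  define x where "x d = entries_in b {(i, j). l i - l j = d} X" for d
  define D where "D = range (\<lambda>(i, j). l i - l j)"
  have sa: "selfadj \<beta>"
    by (rule p_selfadj [OF \<beta>])
  have sum: "sum x D = X"
  proof (rule onb_entries_eqI [OF b])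
    fix i j
    have "l i - l j \<in> D"
      unfolding D_def by force
    then show "h (sum x D *v b j) (b i) = h (X *v b j) (b i)"
      by (simp add: x_def matrix_vector_mult_sum_left h_sum_left h_entries_in [OF b] D_def)
  qed
  show ?thesis
  proof (cases "d \<in> D")
    case True
    have "x d \<in> tangent"
    proof (rule eigencomponents_in_invariant_subspace [OF subspace_tangent])
      show "linear (\<lambda>Y. \<beta> ** Y - Y ** \<beta>)"
        by (intro linearI) (simp_all add: matrix_add_ldistrib matrix_mult_add_rdistrib scaleR_matrix_mult algebra_simps)
      show "\<beta> ** Y - Y ** \<beta> \<in> tangent" if "Y \<in> tangent" for Y
        by (intro tangent_bracket p_subset_tangent \<beta> that)
      show "\<beta> ** x d - x d ** \<beta> = d *\<^sub>R x d" for d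
        by (rule onb_entries_eqI [OF b])
          (auto simp: x_def matrix_vector_mult_diff_rdistrib matrix_vector_mul_assoc [symmetric] h_simps
            matrix_vector_mult_scaleR h_eigen_adjoint [OF sa l] l matrix_vector_scaleR_right h_entries_in [OF b]
            scaleR_diff_left [symmetric])
      show "sum x D \<in> tangent"
        using X by (simp add: sum)
    qed (use True in \<open>auto simp: D_def\<close>)
    then show ?thesis
      by (simp add: x_def)
  next
    case False
    then have empty: "{(i, j). l i - l j = d} = {}"
      by (auto simp: D_def)
    have "entries_in b {(i, j). l i - l j = d} X = 0"
      unfolding empty by (rule onb_entries_eqI [OF b]) (simp add: h_entries_in [OF b] h_simps)
    then show ?thesis
      using subspace_0 [OF subspace_tangent] by simp
  qed
qed

lemma tangent_ad_part:
  assumes "\<beta> \<in> p" and b: "onb b" and "\<And>i. \<beta> *v b i = l i *\<^sub>R b i" and "X \<in> tangent"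
  shows "entries_in b {(i, j). l i - l j \<in> E} X \<in> tangent"
proof -
  let ?D = "range (\<lambda>(i, j). l i - l j) \<inter> E"
  have "entries_in b {(i, j). l i - l j \<in> E} X = (\<Sum>d\<in>?D. entries_in b {(i, j). l i - l j = d} X)"
  proof (rule onb_entries_eqI [OF b])
    fix i j
    have "l i - l j \<in> ?D \<longleftrightarrow> l i - l j \<in> E"
      by force
    then show "h (entries_in b {(i, j). l i - l j \<in> E} X *v b j) (b i) =
        h ((\<Sum>d\<in>?D. entries_in b {(i, j). l i - l j = d} X) *v b j) (b i)"
      by (simp add: matrix_vector_mult_sum_left h_sum_left h_entries_in [OF b])
  qed
  also have "\<dots> \<in> tangent"
    using tangent_ad_component assms by (intro subspace_sum [OF subspace_tangent]) blast
  finally show ?thesis .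
qed

text \<open>Under conjugation by \<open>exp (s\<beta>)\<close> with \<open>s\<close> tending to minus infinity, the components of positive degree decay,
  that of degree zero is fixed, and the limit of the exponentials lies in \<open>G\<close> because the component of
  degree zero is again tangent.\<close>

lemma mexp_nonnegative_part_in_parabolic:
  assumes \<beta>: "\<beta> \<in> p" and b: "onb b" and l: "\<And>i. \<beta> *v b i = l i *\<^sub>R b i" and X: "X \<in> tangent"
  shows "mexp (t *\<^sub>R entries_in b {(i, j). l i - l j \<in> {0..}} X) \<in> parabolic G \<beta>"
proof -
  define Z where "Z = entries_in b {(i, j). l i - l j \<in> {0..}} X"
  define L where "L = entries_in b {(i, j). l i - l j \<in> {0}} X"
  define Z' where "Z' s = mexp (s *\<^sub>R \<beta>) ** Z ** mexp (- s *\<^sub>R \<beta>)" for s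
  define x where "x d = entries_in b {(i, j). l i - l j = d} X" for d
  define D where "D = range (\<lambda>(i, j). l i - l j) \<inter> {0..}"
  have sa: "selfadj \<beta>"
    by (rule p_selfadj [OF \<beta>])
  have inD: "l i - l j \<in> D \<longleftrightarrow> l i - l j \<ge> 0" for i j
    unfolding D_def by force
  have fin: "finite D"
    by (simp add: D_def)
  have tangent: "Z \<in> tangent" "L \<in> tangent"
    unfolding Z_def L_def using tangent_ad_part [OF \<beta> b l X] by blast+
  have Z'_entries: "h (Z' s *v b j) (b i) = exp (s * (l i - l j)) *\<^sub>R h (Z *v b j) (b i)" for s i j
    unfolding Z'_def by (rule mexp_conj_entries [OF sa l])
  have "Z' = (\<lambda>s. \<Sum>d\<in>D. exp (s * d) *\<^sub>R x d)"
    by (rule ext, rule onb_entries_eqI [OF b])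
      (use fin in \<open>auto simp: Z'_entries Z_def x_def h_entries_in [OF b] matrix_vector_mult_sum_left h_sum_left
        matrix_vector_mult_scaleR h_simps inD if_distrib cong: if_cong\<close>)
  moreover have "((\<lambda>s. \<Sum>d\<in>D. exp (s * d) *\<^sub>R x d) \<longlongrightarrow> (\<Sum>d\<in>D. (if d = 0 then 1 else 0) *\<^sub>R x d)) at_bot"
  proof (intro tendsto_intros)
    fix d assume "d \<in> D"
    show "((\<lambda>s. exp (s * d)) \<longlongrightarrow> (if d = 0 then 1 else 0)) at_bot"
    proof (cases "d = 0")
      case False
      then have "d > 0"
        using \<open>d \<in> D\<close> by (auto simp: D_def)
      then show ?thesis
        using False by (simp add: exp_mult_at_bot)
    qed simp
  qed
  moreover have "(\<Sum>d\<in>D. (if d = 0 then 1 else 0) *\<^sub>R x d) = L"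
  proof -
    have "0 \<in> D"
      using inD [of undefined undefined] by simp
    have "(\<Sum>d\<in>D. (if d = 0 then 1 else 0) *\<^sub>R x d) = (\<Sum>d\<in>D. if d = 0 then x d else 0)"
      by (rule sum.cong) auto
    then show ?thesis
      using fin \<open>0 \<in> D\<close> by (simp add: L_def x_def)
  qed
  ultimately have "(Z' \<longlongrightarrow> L) at_bot"
    by simp
  then have "((\<lambda>s. mexp (t *\<^sub>R Z' s)) \<longlongrightarrow> mexp (t *\<^sub>R L)) at_bot"
    by (intro isCont_tendsto_compose [OF isCont_mexp] tendsto_intros)
  moreover have "mexp (t *\<^sub>R Z' s) = mexp (s *\<^sub>R \<beta>) ** mexp (t *\<^sub>R Z) ** mexp (- s *\<^sub>R \<beta>)" for s
    using mexp_conj [OF mexp_minus_left, of "s *\<^sub>R \<beta>" "t *\<^sub>R Z"] by (simp add: Z'_def scaleR_matrix_mult)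
  ultimately show ?thesis
    using tangent by (auto simp: parabolic_def tangent_iff Z_def)
qed

lemma mexp_in_parabolic:
  assumes "\<beta> \<in> p"
  shows "mexp (t *\<^sub>R \<beta>) \<in> parabolic G \<beta>"
proof -
  have "mexp (s *\<^sub>R \<beta>) ** mexp (t *\<^sub>R \<beta>) ** mexp (- s *\<^sub>R \<beta>) = mexp (t *\<^sub>R \<beta>)" for s
  proof -
    have "mexp (s *\<^sub>R \<beta>) ** mexp (t *\<^sub>R \<beta>) ** mexp (- s *\<^sub>R \<beta>)
        = mexp (t *\<^sub>R \<beta>) ** mexp (s *\<^sub>R \<beta>) ** mexp (- s *\<^sub>R \<beta>)"
      using mexp_add_commuting [of "s *\<^sub>R \<beta>" "t *\<^sub>R \<beta>"] mexp_add_commuting [of "t *\<^sub>R \<beta>" "s *\<^sub>R \<beta>"]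
      by (simp add: scaleR_matrix_mult add.commute mult.commute)
    then show ?thesis
      using mexp_minus_right [of "s *\<^sub>R \<beta>"] by (simp add: matrix_mul_assoc [symmetric])
  qed
  then show ?thesis
    using p_subset_tangent [OF assms] by (auto simp: parabolic_def tangent_iff)
qed

text \<open>The matrix coefficient between eigenvectors for \<open>c\<close> and \<open>r < c\<close> is multiplied by \<open>exp (t (r - c))\<close>, which
  blows up as \<open>t\<close> tends to minus infinity; the limit exists only if the coefficient vanishes.\<close>

lemma parabolic_raises:
  assumes g: "g \<in> parabolic G \<beta>" and \<beta>: "selfadj \<beta>" and u: "\<beta> *v u = c *\<^sub>R u" and w: "\<beta> *v w = r *\<^sub>R w"
    and "r < c"
  shows "h (g *v u) w = 0"
proof -
  obtain m where m: "((\<lambda>t. mexp (t *\<^sub>R \<beta>) ** g ** mexp (- t *\<^sub>R \<beta>)) \<longlongrightarrow> m) at_bot"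
    using g by (auto simp: parabolic_def)
  have e: "h ((mexp (t *\<^sub>R \<beta>) ** g ** mexp (- t *\<^sub>R \<beta>)) *v u) w = exp (t * (r - c)) *\<^sub>R h (g *v u) w" for t
  proof -
    have "mexp (- t *\<^sub>R \<beta>) *v u = exp (- t * c) *\<^sub>R u"
      by (rule mexp_eigenvector) (metis u matrix_vector_mult_scaleR scaleR_scaleR)
    then show ?thesis
      by (simp add: matrix_vector_mul_assoc [symmetric] matrix_vector_scaleR_right mexp_eigen_adjoint [OF \<beta> w]
          h_simps exp_add [symmetric] algebra_simps)
  qed
  have "((\<lambda>t. h ((mexp (t *\<^sub>R \<beta>) ** g ** mexp (- t *\<^sub>R \<beta>)) *v u) w) \<longlongrightarrow> h (m *v u) w) at_bot"
    by (intro bounded_bilinear.tendsto [OF bounded_bilinear_h] matrix_vector_mult_tendsto m tendsto_const)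
  moreover have "((\<lambda>t. exp (t * (c - r))) \<longlongrightarrow> 0) at_bot"
    using \<open>r < c\<close> by (intro exp_mult_at_bot) simp
  ultimately have "((\<lambda>t. exp (t * (c - r)) *\<^sub>R h ((mexp (t *\<^sub>R \<beta>) ** g ** mexp (- t *\<^sub>R \<beta>)) *v u) w)
      \<longlongrightarrow> 0 *\<^sub>R h (m *v u) w) at_bot"
    by (intro tendsto_scaleR)
  moreover have "exp (t * (c - r)) *\<^sub>R h ((mexp (t *\<^sub>R \<beta>) ** g ** mexp (- t *\<^sub>R \<beta>)) *v u) w = h (g *v u) w" for t
    unfolding e scaleR_scaleR exp_add [symmetric] by (simp add: algebra_simps)
  ultimately show ?thesis
    by (simp add: tendsto_const_iff)
qed

end

locale irreducible_polar_group = polar_group +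
  assumes tangent_irreducible:
    "vec.subspace S \<Longrightarrow> (\<And>X u. X \<in> tangent \<Longrightarrow> u \<in> S \<Longrightarrow> X *v u \<in> S) \<Longrightarrow> S = {0} \<or> S = UNIV"
begin

text \<open>A substitute for the theorem of Poincare, Birkhoff and Witt. Split the Lie algebra into the strictly
  lowering part \<open>N\<close> and a part \<open>Q\<close> that preserves \<open>U\<close>, and let \<open>S\<close> be the least \<open>N\<close>-invariant
  subspace containing \<open>U\<close>. Commuting an element of \<open>Q\<close> past one of \<open>N\<close> produces an element of
  the Lie algebra, so the vectors of \<open>S\<close> that \<open>Q\<close> keeps in \<open>S\<close> form an \<open>N\<close>-invariant subspace, hence
  all of \<open>S\<close>. Thus \<open>S\<close> is invariant under the whole Lie algebra and equals \<open>V\<close>, whereas it is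
  contained in the sum \<open>T\<close> of \<open>U\<close> and of the eigenspaces below \<open>c\<close>.\<close>

lemma invariant_eigensubspace_is_top:
  assumes \<beta>: "\<beta> \<in> p" and b: "onb b" and l: "\<And>i. \<beta> *v b i = l i *\<^sub>R b i"
    and U: "vec.subspace U" "U \<noteq> {0}" "preserves (parabolic G \<beta>) U"
    and c: "\<And>u. u \<in> U \<Longrightarrow> \<beta> *v u = c *\<^sub>R u"
  shows "l i \<le> c" and "\<beta> *v v = c *\<^sub>R v \<Longrightarrow> v \<in> U"
proof -
  have sa: "selfadj \<beta>"
    by (rule p_selfadj [OF \<beta>])
  note eig = eigenvector_iff_coefficients [OF sa b l]
  define N where "N = {Y \<in> tangent. \<forall>i j. l i \<ge> l j \<longrightarrow> h (Y *v b j) (b i) = 0}"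
  define Q where "Q = {Z \<in> tangent. \<forall>u\<in>U. Z *v u \<in> U}"
  have split: "\<exists>Y\<in>N. \<exists>Z\<in>Q. X = Y + Z" if X: "X \<in> tangent" for X
  proof (intro bexI)
    let ?Y = "entries_in b {(i, j). l i - l j \<in> {..<0}} X"
    let ?Z = "entries_in b {(i, j). l i - l j \<in> {0..}} X"
    show "X = ?Y + ?Z"
      by (rule onb_entries_eqI [OF b])
        (auto simp: matrix_vector_mult_add_rdistrib h_simps h_entries_in [OF b])
    have tangent: "?Y \<in> tangent" "?Z \<in> tangent"
      by (rule tangent_ad_part [OF \<beta> b l X])+
    show "?Y \<in> N"
      using tangent(1) by (auto simp: N_def h_entries_in [OF b])
    have "?Z *v u \<in> U" if "u \<in> U" for u
    proof (rule subspace_derivative [OF vec_subspace_imp_subspace [OF U(1)]])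
      show "mexp (t *\<^sub>R ?Z) *v u \<in> U" for t
        using U(3) mexp_nonnegative_part_in_parabolic [OF \<beta> b l X] that by (auto simp: preserves_def)
    qed (rule mexp_vector_derivative_0)
    then show "?Z \<in> Q"
      using tangent(2) by (auto simp: Q_def)
  qed
  let ?stable = "\<lambda>S. vec.subspace S \<and> U \<subseteq> S \<and> (\<forall>Y\<in>N. \<forall>s\<in>S. Y *v s \<in> S)"
  define S where "S = \<Inter>{S. ?stable S}"
  have S: "vec.subspace S" "U \<subseteq> S" "\<And>Y s. Y \<in> N \<Longrightarrow> s \<in> S \<Longrightarrow> Y *v s \<in> S"
    and least: "\<And>S'. ?stable S' \<Longrightarrow> S \<subseteq> S'"
    unfolding S_def by (auto intro!: vec.subspace_Inter)
  have "?stable {v \<in> S. \<forall>Z\<in>Q. Z *v v \<in> S}"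
  proof (intro conjI ballI)
    show "vec.subspace {v \<in> S. \<forall>Z\<in>Q. Z *v v \<in> S}"
      using S(1) by (auto simp: vec.subspace_def matrix_vector_right_distrib vector_scalar_commute)
    show "U \<subseteq> {v \<in> S. \<forall>Z\<in>Q. Z *v v \<in> S}"
      using S(2) by (auto simp: Q_def)
    fix Y v assume Y: "Y \<in> N" and v: "v \<in> {v \<in> S. \<forall>Z\<in>Q. Z *v v \<in> S}"
    have "Z *v (Y *v v) \<in> S" if Z: "Z \<in> Q" for Z
    proof -
      have "Z ** Y - Y ** Z \<in> tangent"
        using Y Z by (intro tangent_bracket) (auto simp: N_def Q_def)
      then obtain Y' Z' where Y': "Y' \<in> N" "Z' \<in> Q" "Z ** Y - Y ** Z = Y' + Z'"
        using split by blast
      then have "Z ** Y = Y ** Z + Y' + Z'"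
        by (simp add: algebra_simps)
      then have "Z *v (Y *v v) = Y *v (Z *v v) + Y' *v v + Z' *v v"
        by (simp add: matrix_vector_mul_assoc matrix_vector_mult_add_rdistrib)
      then show ?thesis
        using S v Y Y' Z by (auto intro!: vec.subspace_add)
    qed
    then show "Y *v v \<in> {v \<in> S. \<forall>Z\<in>Q. Z *v v \<in> S}"
      using S Y v by auto
  qed
  then have QS: "Z *v v \<in> S" if "Z \<in> Q" "v \<in> S" for Z v
    using least that by blast
  have "S = {0} \<or> S = UNIV"
  proof (rule tangent_irreducible [OF S(1)])
    fix X u assume "X \<in> tangent" "u \<in> S"
    then obtain Y Z where "Y \<in> N" "Z \<in> Q" "X = Y + Z"
      using split by blast
    then show "X *v u \<in> S"
      using S QS \<open>u \<in> S\<close> by (auto simp: matrix_vector_mult_add_rdistrib intro!: vec.subspace_add)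
  qed
  moreover have "S \<noteq> {0}"
    using S(2) U vec.subspace_0 by blast
  ultimately have "S = UNIV"
    by simp
  define L where "L = {v. \<forall>i. c \<le> l i \<longrightarrow> h v (b i) = 0}"
  define T where "T = {u + y | u y. u \<in> U \<and> y \<in> L}"
  have sL: "vec.subspace L"
    by (auto simp: L_def vec.subspace_def h_simps)
  have U_coeff: "l i = c" if "u \<in> U" "h u (b i) \<noteq> 0" for u i
    using eig [of u c] c [OF that(1)] that(2) by auto
  have "?stable T"
  proof (intro conjI ballI)
    show "vec.subspace T"
      unfolding T_def by (rule vec.subspace_sums [OF U(1) sL])
    have "u + 0 \<in> T" if "u \<in> U" for u
      unfolding T_def using that vec.subspace_0 [OF sL] by blast
    then show "U \<subseteq> T"
      by auto
    fix Y v assume Y: "Y \<in> N" and "v \<in> T"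
    then obtain u y where v: "v = u + y" "u \<in> U" "y \<in> L"
      by (auto simp: T_def)
    have "h v (b j) * h (Y *v b j) (b i) = 0" if "c \<le> l i" for i j
    proof (cases "l j \<le> c")
      case True
      then show ?thesis
        using Y that by (simp add: N_def)
    next
      case False
      then have "h u (b j) = 0" "h y (b j) = 0"
        using U_coeff [OF v(2), of j] v(3) by (auto simp: L_def)
      then show ?thesis
        by (simp add: v h_simps)
    qed
    then have "Y *v v \<in> L"
      by (simp add: L_def h_matrix_onb [OF b, of Y v] sum.neutral)
    then have "0 + Y *v v \<in> T"
      unfolding T_def using vec.subspace_0 [OF U(1)] by blast
    then show "Y *v v \<in> T"
      by simp
  qed
  then have T: "v \<in> T" for v
    using least [of T] \<open>S = UNIV\<close> by blast
  show "l i \<le> c"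
  proof (rule ccontr)
    assume i: "\<not> l i \<le> c"
    obtain u y where u: "b i = u + y" "u \<in> U" "y \<in> L"
      using T [of "b i"] by (auto simp: T_def)
    have "h (u + y) (b i) = 0"
      using U_coeff [OF u(2), of i] u(3) i by (auto simp: L_def h_simps)
    then show False
      using onb_orthonormal [OF b, of i i] by (simp flip: u(1))
  qed
  assume v: "\<beta> *v v = c *\<^sub>R v"
  obtain u y where u: "v = u + y" "u \<in> U" "y \<in> L"
    using T [of v] by (auto simp: T_def)
  have "\<beta> *v y = c *\<^sub>R y"
    using v c [OF u(2)] by (simp add: u(1) matrix_vector_right_distrib scaleR_right_distrib)
  then have "h y (b i) = 0" for i
    using u(3) eig [of y c] by (auto simp: L_def)
  then have "y = 0"
    by (intro onb_ext [OF b]) (simp add: h_simps)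
  then show "v \<in> U"
    using u by simp
qed

text \<open>An irreducible subspace \<open>W\<close> is invariant under \<open>\<beta>\<close>, since \<open>exp (t\<beta>)\<close> belongs to the parabolic subgroup. As
  this subgroup only raises eigenvalues, it preserves the intersection of \<open>W\<close> with the highest eigenspace that
  \<open>W\<close> meets, so \<open>W\<close> lies in a single eigenspace and \<open>invariant_eigensubspace_is_top\<close> applies.\<close>

lemma parabolic_acts_irreducibly_iff:
  assumes \<beta>: "\<beta> \<in> p" and b: "onb b" and l: "\<And>i. \<beta> *v b i = l i *\<^sub>R b i"
    and c: "c \<in> range l" "\<And>i. l i \<le> c"
  shows "acts_irreducibly (parabolic G \<beta>) W \<longleftrightarrow> W = {v. \<beta> *v v = c *\<^sub>R v}"
proof -
  have sa: "selfadj \<beta>"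
    by (rule p_selfadj [OF \<beta>])
  note eig = eigenvector_iff_coefficients [OF sa b l]
  have top: "U = {v. \<beta> *v v = c *\<^sub>R v}"
    if U: "vec.subspace U" "U \<noteq> {0}" "preserves (parabolic G \<beta>) U" "\<And>u. u \<in> U \<Longrightarrow> \<beta> *v u = d *\<^sub>R u" for U d
  proof -
    have "c \<le> d"
      using c(1) invariant_eigensubspace_is_top(1) [OF \<beta> b l U] by auto
    moreover obtain u where "u \<in> U" "u \<noteq> 0"
      using U(1,2) vec.subspace_0 by blast
    then obtain i where "h u (b i) \<noteq> 0"
      using onb_ext [OF b, of u 0] by (auto simp: h_simps)
    then have "l i = d"
      using eig [of u d] U(4) [OF \<open>u \<in> U\<close>] by auto
    then have "d \<le> c"
      using c(2) by auto
    ultimately have "d = c"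
      by simp
    then show ?thesis
      using U(4) invariant_eigensubspace_is_top(2) [OF \<beta> b l U] by auto
  qed
  show ?thesis
  proof
    assume W: "acts_irreducibly (parabolic G \<beta>) W"
    then have W': "vec.subspace W" "W \<noteq> {0}" "preserves (parabolic G \<beta>) W"
      by (auto simp: acts_irreducibly_def)
    have sW: "subspace W"
      by (rule vec_subspace_imp_subspace [OF W'(1)])
    have \<beta>W: "\<beta> *v w \<in> W" if "w \<in> W" for w
    proof (rule subspace_derivative [OF sW])
      show "mexp (t *\<^sub>R \<beta>) *v w \<in> W" for t
        using W'(3) mexp_in_parabolic [OF \<beta>] that by (auto simp: preserves_def)
    qed (rule mexp_vector_derivative_0)
    define pr where "pr d w = (\<Sum>i | l i = d. h w (b i) *s b i)" for d w
    have h_pr: "h (pr d w) (b i) = (if l i = d then h w (b i) else 0)" for d w i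
      by (simp add: pr_def h_sum_left h_simps onb_orthonormal [OF b] if_distrib cong: if_cong)
    have eig_pr: "\<beta> *v pr d w = d *\<^sub>R pr d w" for d w
      by (simp add: eig h_pr)
    have sum_pr: "(\<Sum>d\<in>range l. pr d w) = w" for w
      by (rule onb_ext [OF b]) (simp add: h_sum_left h_pr)
    have pr_W: "pr d w \<in> W" if "w \<in> W" "d \<in> range l" for d w
    proof (rule eigencomponents_in_invariant_subspace [OF sW])
      show "linear ((*v) \<beta>)"
        by (rule bounded_linear.linear [OF bounded_linear_matrix_vector_right])
    qed (use that \<beta>W eig_pr sum_pr in auto)
    obtain w where w: "w \<in> W" "w \<noteq> 0"
      using W' vec.subspace_0 by blast
    define D where "D = {d \<in> range l. \<exists>w\<in>W. pr d w \<noteq> 0}"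
    have "D \<noteq> {}"
    proof
      assume "D = {}"
      then have "(\<Sum>d\<in>range l. pr d w) = 0"
        using w by (intro sum.neutral) (auto simp: D_def)
      then show False
        using w by (simp add: sum_pr)
    qed
    define d where "d = Max D"
    have finD: "finite D"
      by (simp add: D_def)
    have d: "d \<in> D"
      unfolding d_def by (rule Max_in [OF finD \<open>D \<noteq> {}\<close>])
    have max: "l i \<le> d" if "w \<in> W" "h w (b i) \<noteq> 0" for w i
    proof -
      have "h (pr (l i) w) (b i) \<noteq> 0"
        using that by (simp add: h_pr)
      then have "pr (l i) w \<noteq> 0"
        by (metis h_simps(1))
      then have "l i \<in> D"
        using that by (auto simp: D_def)
      then show ?thesis
        unfolding d_def by (rule Max_ge [OF finD])
    qed
    define U where "U = W \<inter> {v. \<beta> *v v = d *\<^sub>R v}"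
    have sU: "vec.subspace U"
      unfolding U_def by (intro vec.subspace_inter W' subspace_eigenspace)
    have "preserves (parabolic G \<beta>) U"
      unfolding preserves_def
    proof (intro ballI)
      fix g u assume g: "g \<in> parabolic G \<beta>" and u: "u \<in> U"
      have gu: "g *v u \<in> W"
        using W'(3) g u by (auto simp: preserves_def U_def)
      have "l i = d" if "h (g *v u) (b i) \<noteq> 0" for i
        using parabolic_raises [OF g sa _ l, of u d i] max [OF gu that] that u by (force simp: U_def)
      then show "g *v u \<in> U"
        using gu by (simp add: U_def eig)
    qed
    moreover have "U \<noteq> {0}"
    proof -
      obtain w where "w \<in> W" "pr d w \<noteq> 0"
        using d by (auto simp: D_def)
      then have "pr d w \<in> U"
        using d pr_W eig_pr by (auto simp: U_def D_def)
      then show ?thesis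
        using \<open>pr d w \<noteq> 0\<close> by auto
    qed
    ultimately have "U = W"
      using W sU unfolding acts_irreducibly_def by (metis U_def Int_lower1)
    then show "W = {v. \<beta> *v v = c *\<^sub>R v}"
      using top [OF W', of d] by (auto simp: U_def)
  next
    assume W: "W = {v. \<beta> *v v = c *\<^sub>R v}"
    obtain i where i: "c = l i"
      using c by auto
    show "acts_irreducibly (parabolic G \<beta>) W"
      unfolding acts_irreducibly_def
    proof (intro conjI allI impI)
      show "vec.subspace W"
        unfolding W by (rule subspace_eigenspace)
      show "W \<noteq> {0}"
        using l [of i] onb_nonzero [OF b, of i] by (auto simp: W i)
      show "preserves (parabolic G \<beta>) W"
        unfolding preserves_def W
      proof safe
        fix g u assume g: "g \<in> parabolic G \<beta>" and u: "\<beta> *v u = c *\<^sub>R u"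
        have "l i = c" if "h (g *v u) (b i) \<noteq> 0" for i
          using parabolic_raises [OF g sa u l, of i] c(2) [of i] that by force
        then show "\<beta> *v (g *v u) = c *\<^sub>R (g *v u)"
          by (simp add: eig)
      qed
      fix U assume "vec.subspace U \<and> U \<subseteq> W \<and> preserves (parabolic G \<beta>) U"
      then show "U = {0} \<or> U = W"
        using top [of U c] W by blast
    qed
  qed
qed

end

section \<open>Conjugacy of maximal abelian subspaces\<close>

text \<open>A real vector space is not a finite union of proper subspaces: on a line \<open>H + tZ\<close> each
  functional vanishes for at most one \<open>t\<close>.\<close>

lemma exists_avoiding_functionals:
  fixes a :: "'a::real_vector set"
  assumes "finite I" "subspace a"
    and lin: "\<And>i H Z t. i \<in> I \<Longrightarrow> H \<in> a \<Longrightarrow> Z \<in> a \<Longrightarrow> \<phi> i (H + t *\<^sub>R Z) = \<phi> i H + t * (\<phi> i Z :: real)"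
    and ne: "\<And>i. i \<in> I \<Longrightarrow> \<exists>Z\<in>a. \<phi> i Z \<noteq> 0"
  shows "\<exists>H\<in>a. \<forall>i\<in>I. \<phi> i H \<noteq> 0"
  using assms
proof (induction I rule: finite_induct)
  case empty
  then show ?case
    using subspace_0 by blast
next
  case (insert e I)
  then obtain H Z where H: "H \<in> a" "\<And>i. i \<in> I \<Longrightarrow> \<phi> i H \<noteq> 0" and Z: "Z \<in> a" "\<phi> e Z \<noteq> 0"
    by (metis insertI1 insertI2)
  have "finite {t. \<phi> i H + t * \<phi> i Z = 0}" if "i \<in> insert e I" for i
  proof (rule finite_subset)
    show "{t. \<phi> i H + t * \<phi> i Z = 0} \<subseteq> {- \<phi> i H / \<phi> i Z}"
      using H Z that by (auto simp: field_simps add_eq_0_iff2)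
  qed simp
  then have "finite (\<Union>i\<in>insert e I. {t. \<phi> i H + t * \<phi> i Z = 0})"
    using insert.hyps by blast
  then obtain t where "t \<notin> (\<Union>i\<in>insert e I. {t. \<phi> i H + t * \<phi> i Z = 0})"
    using ex_new_if_finite infinite_UNIV_char_0 by blast
  then have "\<forall>i\<in>insert e I. \<phi> i (H + t *\<^sub>R Z) \<noteq> 0"
    using insert.prems(2) H Z by auto
  then show ?case
    using H Z insert.prems(1) by (intro bexI [of _ "H + t *\<^sub>R Z"]) (auto intro: subspace_add subspace_scale)
qed

lemma mexp_invariant_subspace:
  assumes S: "subspace S" and X: "\<And>v. v \<in> S \<Longrightarrow> X *v v \<in> S" and v: "v \<in> S"
  shows "mexp X *v v \<in> S"
proof (rule closed_sequentially [OF closed_subspace [OF S] _ mexp_vector_sums [unfolded sums_def]])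
  have "((*v) X ^^ k) v \<in> S" for k
    by (induction k) (auto simp: X v)
  then show "(\<Sum>k<n. (1 / fact k) *\<^sub>R ((*v) X ^^ k) v) \<in> S" for n
    by (intro subspace_sum [OF S] subspace_scale [OF S])
qed

lemma invertible_matrix_image_eq:
  fixes k :: "complex^'n^'n"
  assumes W: "vec.subspace W" and k: "\<And>w. w \<in> W \<Longrightarrow> k *v w \<in> W" and inv: "k' ** k = mat 1"
  shows "(*v) k ` W = W"
proof (rule vec.subspace_dim_equal)
  have lin: "Vector_Spaces.linear (*s) (*s) ((*v) k)"
    by (rule matrix_vector_mul_linear_gen)
  show "vec.subspace ((*v) k ` W)"
    by (rule vec.linear_subspace_image [OF lin W])
  have "inj ((*v) k)"
    by (rule inj_on_inverseI [of _ "(*v) k'"]) (simp add: matrix_vector_mul_assoc inv)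
  then show "vec.dim W \<le> vec.dim ((*v) k ` W)"
    using vec.dim_image_eq [OF lin, of W] by (simp add: inj_on_subset)
qed (use W k in auto)

context polar_group
begin

lemma onb_unitary_image:
  assumes b: "onb b" and j: "j \<in> K"
  shows "onb (\<lambda>i. j *v b i)"
  unfolding onb_def
proof (intro conjI allI)
  show "h (j *v b i) (j *v b k) = (if i = k then 1 else 0)" for i k
    by (simp add: K_unitary [OF j] onb_orthonormal [OF b])
  show "v = (\<Sum>i\<in>UNIV. h v (j *v b i) *s (j *v b i))" for v
  proof -
    have "v = j *v (matrix_inv j *v v)"
      by (simp add: matrix_vector_mul_assoc matrix_inv_K j)
    also have "\<dots> = (\<Sum>i\<in>UNIV. h (matrix_inv j *v v) (b i) *s (j *v b i))"
      by (rule onb_matrix_vector [OF b])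
    finally show ?thesis
      by (simp add: K_adjoint' [OF j])
  qed
qed

lemma conj_by_eigenvector:
  assumes "k \<in> K" "X *v v = r *\<^sub>R v"
  shows "conj_by k X *v (k *v v) = r *\<^sub>R (k *v v)"
  by (simp add: conj_by_vector matrix_inv_K_vector assms matrix_vector_scaleR_right)

lemma matrix_inv_K_invariant:
  assumes "k \<in> K" "vec.subspace W" "\<And>w. w \<in> W \<Longrightarrow> k *v w \<in> W" "w \<in> W"
  shows "matrix_inv k *v w \<in> W"
proof -
  have "w \<in> (*v) k ` W"
    using invertible_matrix_image_eq [of W k "matrix_inv k"] assms matrix_inv_K by auto
  then obtain u where "u \<in> W" "w = k *v u"
    by auto
  then show ?thesis
    by (simp add: matrix_inv_K_vector assms(1))
qed

text \<open>Maximise the trace of \<open>X\<close> times a conjugate \<open>j H j\<^bsup>-1\<^esup>\<close> over the elements \<open>j\<close> of \<open>K\<close> that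
  preserve \<open>W\<close>. With \<open>Y = [j H j\<^bsup>-1\<^esup>, X]\<close>, a skew element of the Lie algebra that preserves \<open>W\<close>,
  the derivative at the maximum in the direction \<open>Y\<close> is the trace of \<open>Y\<^sup>2\<close>, a negative multiple of the square
  norm of \<open>Y\<close>; so \<open>Y\<close> vanishes. The subspace \<open>W\<close> is carried along for
  the proof that conjugate face spaces come from conjugate faces.\<close>

lemma commuting_conjugate:
  assumes X: "X \<in> p" "\<And>w. w \<in> W \<Longrightarrow> X *v w \<in> W" and H: "H \<in> p" "\<And>w. w \<in> W \<Longrightarrow> H *v w \<in> W"
    and W: "vec.subspace W"
  obtains j where "j \<in> K" "\<And>w. w \<in> W \<Longrightarrow> j *v w \<in> W" "X ** conj_by j H = conj_by j H ** X"
proof -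
  obtain b \<eta> where b: "onb b" and \<eta>: "\<And>i. H *v b i = \<eta> i *\<^sub>R b i"
    using selfadj_eigenbasis [OF p_selfadj [OF H(1)]] by blast
  have sW: "subspace W"
    by (rule vec_subspace_imp_subspace [OF W])
  \<comment> \<open>the trace of X times the conjugate, written in the eigenbasis j b of the conjugate so that no inverse of j occurs\<close>
  define f where "f j = (\<Sum>i\<in>UNIV. \<eta> i * Re (h (X *v (j *v b i)) (j *v b i)))" for j
  define C where "C = K \<inter> (\<Inter>w\<in>W. (\<lambda>j. j *v w) -` W)"
  have "closed ((\<lambda>j :: complex^'n^'n. j *v w) -` W)" for w
    by (intro continuous_closed_vimage closed_subspace sW)
      (simp add: bounded_linear.isCont [OF bounded_linear_matrix_vector_left])
  then have "compact C"
    unfolding C_def by (intro compact_Int_closed K_compact closed_INT) auto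
  moreover have "mat 1 \<in> C"
    by (simp add: C_def K_one)
  moreover have "continuous_on C f"
    unfolding f_def
    by (intro continuous_intros h_continuous_on matrix_vector_mult_continuous_on)
  ultimately obtain j where j: "j \<in> C" and max: "\<And>k. k \<in> C \<Longrightarrow> f k \<le> f j"
    using continuous_attains_sup [of C f] by auto
  have jK: "j \<in> K" and jW: "\<And>w. w \<in> W \<Longrightarrow> j *v w \<in> W"
    using j by (auto simp: C_def)
  define c where "c i = j *v b i" for i
  have c: "onb c"
    unfolding c_def by (rule onb_unitary_image [OF b jK])
  define H' where "H' = conj_by j H"
  have H'p: "H' \<in> p"
    unfolding H'_def by (rule conj_by_p [OF jK H(1)])
  have H'c: "H' *v c i = \<eta> i *\<^sub>R c i" for i
    unfolding H'_def c_def by (rule conj_by_eigenvector [OF jK \<eta>])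
  have H'W: "H' *v w \<in> W" if "w \<in> W" for w
    unfolding H'_def conj_by_vector using matrix_inv_K_invariant [OF jK W] jW H(2) that by blast
  define Y where "Y = H' ** X - X ** H'"
  have YW: "Y *v w \<in> W" if "w \<in> W" for w
    using H'W X(2) that sW
    by (auto simp: Y_def matrix_vector_mult_diff_rdistrib matrix_vector_mul_assoc [symmetric] intro: subspace_diff)
  have e: "mexp (t *\<^sub>R Y) ** j \<in> C" for t
  proof -
    have "mexp (t *\<^sub>R Y) \<in> K"
      unfolding Y_def
      by (intro mexp_skew_in_K tangent_bracket p_subset_tangent bracket_skew p_selfadj X H'p)
    moreover have "mexp (t *\<^sub>R Y) *v w \<in> W" if "w \<in> W" for w
      using YW sW that by (intro mexp_invariant_subspace) (auto simp: matrix_vector_mult_scaleR subspace_scale)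
    ultimately show ?thesis
      using jW by (auto simp: C_def K_mult jK matrix_vector_mul_assoc [symmetric])
  qed
  define x where "x i k = h (X *v c k) (c i)" for i k
  have Y: "h (Y *v c k) (c i) = (\<eta> i - \<eta> k) *\<^sub>R x i k" for i k
    by (simp add: Y_def x_def matrix_vector_mult_diff_rdistrib matrix_vector_mul_assoc [symmetric] h_simps
        h_eigen_adjoint [OF p_selfadj [OF H'p] H'c] H'c matrix_vector_scaleR_right scaleR_diff_left)
  have x_swap: "cmod (x i k) = cmod (x k i)" for i k
    using h_cnj [of "X *v c i" "c k"] selfadjD [OF p_selfadj [OF X(1)], of "c k" "c i"] complex_mod_cnj [of "x k i"]
    by (simp add: x_def)
  have hY: "h (Y *v c i) (X *v c i) = complex_of_real (\<Sum>k\<in>UNIV. (\<eta> k - \<eta> i) * (cmod (x k i))\<^sup>2)" for i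
    unfolding onb_parseval [OF c, of "Y *v c i" "X *v c i"] Y x_def [symmetric] of_real_sum
    by (rule sum.cong) (auto simp: scaleR_conv_of_real mult.assoc complex_norm_square [symmetric] simp del: of_real_power)
  define D where "D = (\<Sum>i\<in>UNIV. \<eta> i * (\<Sum>k\<in>UNIV. (\<eta> k - \<eta> i) * (cmod (x k i))\<^sup>2))"
  have "((\<lambda>t. f (mexp (t *\<^sub>R Y) ** j)) has_real_derivative 2 * D) (at 0)"
  proof -
    have "((\<lambda>t. h (X *v (mexp (t *\<^sub>R Y) *v c i)) (mexp (t *\<^sub>R Y) *v c i)) has_vector_derivative
        h (X *v (mexp (0 *\<^sub>R Y) *v c i)) (Y *v c i) + h (X *v (Y *v c i)) (mexp (0 *\<^sub>R Y) *v c i)) (at 0)" for i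
      by (intro bounded_bilinear.has_vector_derivative [OF bounded_bilinear_h] mexp_vector_derivative_0
          bounded_linear.has_vector_derivative [OF bounded_linear_matrix_vector_right])
    moreover have "h (X *v c i) (Y *v c i) + h (X *v (Y *v c i)) (c i) =
        2 * complex_of_real (\<Sum>k\<in>UNIV. (\<eta> k - \<eta> i) * (cmod (x k i))\<^sup>2)" for i
      using h_cnj [of "Y *v c i" "X *v c i"] selfadjD [OF p_selfadj [OF X(1)], of "Y *v c i" "c i"]
      by (simp add: hY del: of_real_sum)
    ultimately have "((\<lambda>t. h (X *v (mexp (t *\<^sub>R Y) *v c i)) (mexp (t *\<^sub>R Y) *v c i)) has_vector_derivative
        2 * complex_of_real (\<Sum>k\<in>UNIV. (\<eta> k - \<eta> i) * (cmod (x k i))\<^sup>2)) (at 0)" for i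
      by (simp del: of_real_sum)
    from bounded_linear.has_vector_derivative [OF bounded_linear_Re this]
    have "((\<lambda>t. Re (h (X *v (mexp (t *\<^sub>R Y) *v c i)) (mexp (t *\<^sub>R Y) *v c i))) has_real_derivative
        2 * (\<Sum>k\<in>UNIV. (\<eta> k - \<eta> i) * (cmod (x k i))\<^sup>2)) (at 0)" for i
      by (simp add: has_real_derivative_iff_has_vector_derivative del: of_real_sum)
    then have "((\<lambda>t. \<Sum>i\<in>UNIV. \<eta> i * Re (h (X *v (mexp (t *\<^sub>R Y) *v c i)) (mexp (t *\<^sub>R Y) *v c i))) has_real_derivative
        (\<Sum>i\<in>UNIV. \<eta> i * (2 * (\<Sum>k\<in>UNIV. (\<eta> k - \<eta> i) * (cmod (x k i))\<^sup>2)))) (at 0)"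
      by (intro DERIV_sum DERIV_cmult)
    moreover have "(\<Sum>i\<in>UNIV. \<eta> i * (2 * (\<Sum>k\<in>UNIV. (\<eta> k - \<eta> i) * (cmod (x k i))\<^sup>2))) = 2 * D"
      by (simp add: D_def sum_distrib_left mult_ac)
    ultimately show ?thesis
      by (simp add: f_def c_def matrix_vector_mul_assoc [symmetric])
  qed
  then have "2 * D = 0"
    by (rule DERIV_local_max [where d = 1]) (use max e in auto)
  have "- 2 * D = (\<Sum>i\<in>UNIV. \<Sum>k\<in>UNIV. (\<eta> i - \<eta> k)\<^sup>2 * (cmod (x k i))\<^sup>2)"
  proof -
    have D1: "D = (\<Sum>i\<in>UNIV. \<Sum>k\<in>UNIV. \<eta> i * (\<eta> k - \<eta> i) * (cmod (x k i))\<^sup>2)"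
      by (simp add: D_def sum_distrib_left mult_ac)
    then have D2: "D = (\<Sum>i\<in>UNIV. \<Sum>k\<in>UNIV. \<eta> k * (\<eta> i - \<eta> k) * (cmod (x k i))\<^sup>2)"
      by (subst (asm) sum.swap) (simp add: x_swap)
    have "- 2 * D = - (D + D)"
      by simp
    also have "\<dots> = (\<Sum>i\<in>UNIV. \<Sum>k\<in>UNIV. (\<eta> i - \<eta> k)\<^sup>2 * (cmod (x k i))\<^sup>2)"
      by (subst (1) D1, subst D2)
        (simp add: sum.distrib [symmetric] sum_negf [symmetric] power2_eq_square algebra_simps)
    finally show ?thesis .
  qed
  then have "(\<Sum>i\<in>UNIV. \<Sum>k\<in>UNIV. (\<eta> i - \<eta> k)\<^sup>2 * (cmod (x k i))\<^sup>2) = 0"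
    using \<open>2 * D = 0\<close> by simp
  then have "(\<eta> i - \<eta> k)\<^sup>2 * (cmod (x k i))\<^sup>2 = 0" for i k
    by (simp add: sum_nonneg_eq_0_iff sum_nonneg)
  then have "h (Y *v c k) (c i) = 0" for i k
    unfolding Y by (metis mult_eq_0_iff norm_eq_zero power_eq_0_iff right_minus_eq scale_eq_0_iff x_swap)
  then have "Y = 0"
    by (intro onb_entries_eqI [OF c]) (simp add: h_simps)
  then show thesis
    using that [of j] jK jW by (simp add: Y_def H'_def)
qed

lemma conj_by_simps:
  "conj_by k (X + Y) = conj_by k X + conj_by k Y"
  "conj_by k (X - Y) = conj_by k X - conj_by k Y"
  "conj_by k (r *\<^sub>R X) = r *\<^sub>R conj_by k X"
  by (simp_all add: conj_by_def matrix_add_ldistrib matrix_mult_add_rdistrib diff_matrix_mult scaleR_matrix_mult)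

lemma conj_by_one [simp]: "conj_by (mat 1) X = X" for X :: "complex^'n^'n"
proof -
  have "matrix_inv (mat 1 :: complex^'n^'n) = mat 1"
    by (rule matrix_inv_eqI) simp
  then show ?thesis
    by (simp add: conj_by_def)
qed

lemma conj_by_inverse:
  assumes "k \<in> K"
  shows "conj_by (matrix_inv k) (conj_by k X) = X" "conj_by k (conj_by (matrix_inv k) X) = X"
proof -
  have "matrix_inv k ** (k ** X ** matrix_inv k) ** k = (matrix_inv k ** k) ** X ** (matrix_inv k ** k)"
    "k ** (matrix_inv k ** X ** k) ** matrix_inv k = (k ** matrix_inv k) ** X ** (k ** matrix_inv k)"
    by (simp_all only: matrix_mul_assoc)
  then show "conj_by (matrix_inv k) (conj_by k X) = X" "conj_by k (conj_by (matrix_inv k) X) = X"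
    by (simp_all add: conj_by_def matrix_inv_inv_K matrix_inv_K assms)
qed

lemma conj_by_mult:
  assumes "k \<in> K"
  shows "conj_by k (X ** Y) = conj_by k X ** conj_by k Y"
proof -
  have "conj_by k X ** conj_by k Y = k ** X ** (matrix_inv k ** k) ** Y ** matrix_inv k"
    unfolding conj_by_def by (simp only: matrix_mul_assoc)
  then show ?thesis
    by (simp add: conj_by_def matrix_inv_K assms matrix_mul_assoc)
qed

lemma matrix_inv_mult_K:
  assumes "k \<in> K" "j \<in> K"
  shows "matrix_inv (k ** j) = matrix_inv j ** matrix_inv k"
proof (rule matrix_inv_eqI)
  have "k ** j ** (matrix_inv j ** matrix_inv k) = k ** (j ** matrix_inv j) ** matrix_inv k"
    by (simp only: matrix_mul_assoc)
  then show "k ** j ** (matrix_inv j ** matrix_inv k) = mat 1"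
    by (simp add: matrix_inv_K assms)
qed

lemma conj_by_comp: "k \<in> K \<Longrightarrow> j \<in> K \<Longrightarrow> conj_by (k ** j) X = conj_by k (conj_by j X)"
  by (simp add: conj_by_def matrix_inv_mult_K matrix_mul_assoc)

lemma maximal_abelian_conj_by:
  assumes k: "k \<in> K" and a: "maximal_abelian_in p a"
  shows "maximal_abelian_in p (conj_by k ` a)"
proof -
  have ab: "abelian_subalgebra (conj_by j ` c)" if j: "j \<in> K" and c: "abelian_subalgebra c" for j c
  proof -
    have "linear (conj_by j)"
      by (intro linearI conj_by_simps)
    then have "subspace (conj_by j ` c)"
      using c by (intro linear_subspace_image) (auto simp: abelian_subalgebra_def)
    then show ?thesis
      using c by (auto simp: abelian_subalgebra_def conj_by_mult [OF j, symmetric])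
  qed
  have a': "a \<subseteq> p" "abelian_subalgebra a"
    and max: "\<And>c. c \<subseteq> p \<Longrightarrow> abelian_subalgebra c \<Longrightarrow> a \<subseteq> c \<Longrightarrow> c = a"
    using a by (auto simp: maximal_abelian_in_def)
  show ?thesis
    unfolding maximal_abelian_in_def
  proof (intro conjI allI impI)
    show "conj_by k ` a \<subseteq> p"
      using a' conj_by_p [OF k] by auto
    show "abelian_subalgebra (conj_by k ` a)"
      by (rule ab [OF k a'(2)])
    fix c assume c: "c \<subseteq> p \<and> abelian_subalgebra c \<and> conj_by k ` a \<subseteq> c"
    have "conj_by (matrix_inv k) ` c = a"
    proof (rule max)
      show "conj_by (matrix_inv k) ` c \<subseteq> p"
        using c conj_by_p matrix_inv_K [OF k] by blast
      show "abelian_subalgebra (conj_by (matrix_inv k) ` c)"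
        using c ab matrix_inv_K [OF k] by blast
      show "a \<subseteq> conj_by (matrix_inv k) ` c"
        using c conj_by_inverse(1) [OF k] by (metis image_eqI image_subset_iff subsetI)
    qed
    then have "conj_by k ` a = conj_by k ` conj_by (matrix_inv k) ` c"
      by simp
    then show "c = conj_by k ` a"
      by (simp add: image_image conj_by_inverse [OF k])
  qed
qed

text \<open>Choose \<open>H\<close> such that weights of \<open>a\<close> that agree on \<open>H\<close> agree on \<open>a\<close>. A matrix that commutes with \<open>H\<close>
  then preserves the weight spaces, so it commutes with \<open>a\<close> and belongs to \<open>a\<close> by maximality.\<close>

lemma regular_element:
  assumes a: "maximal_abelian_in p a"
  obtains H where "H \<in> a" "\<And>X. X \<in> p \<Longrightarrow> X ** H = H ** X \<Longrightarrow> X \<in> a"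
proof -
  have ap: "a \<subseteq> p" and sa: "subspace a" and comm: "\<And>X Y. X \<in> a \<Longrightarrow> Y \<in> a \<Longrightarrow> X ** Y = Y ** X"
    and max: "\<And>c. c \<subseteq> p \<Longrightarrow> abelian_subalgebra c \<Longrightarrow> a \<subseteq> c \<Longrightarrow> c = a"
    using a by (auto simp: maximal_abelian_in_def abelian_subalgebra_def)
  obtain b l where b: "onb b" and l: "\<And>X i. X \<in> a \<Longrightarrow> X *v b i = l i X *\<^sub>R b i"
    using joint_eigenbasis [of a] comm ap p_selfadj by (metis subsetD)
  have lin: "l i (X + t *\<^sub>R Z) = l i X + t * l i Z" if "X \<in> a" "Z \<in> a" for i X Z t
  proof -
    have "X + t *\<^sub>R Z \<in> a"
      using that sa by (simp add: subspace_add subspace_scale)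
    then have "l i (X + t *\<^sub>R Z) *\<^sub>R b i = (l i X + t * l i Z) *\<^sub>R b i"
      using l [of "X + t *\<^sub>R Z" i] that
      by (simp add: matrix_vector_mult_add_rdistrib matrix_vector_mult_scaleR l scaleR_add_left)
    then show ?thesis
      using onb_nonzero [OF b] by simp
  qed
  define I where "I = {(i, k). \<exists>Z\<in>a. l i Z \<noteq> l k Z}"
  have "\<exists>H\<in>a. \<forall>q\<in>I. (\<lambda>(i, k) Z. l i Z - l k Z) q H \<noteq> 0"
  proof (rule exists_avoiding_functionals [OF _ sa])
    show "finite I"
      by (rule finite_subset [of _ UNIV]) auto
  qed (auto simp: I_def lin algebra_simps)
  then obtain H where H: "H \<in> a" "\<And>i k Z. l i H = l k H \<Longrightarrow> Z \<in> a \<Longrightarrow> l i Z = l k Z"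
    by (fastforce simp: I_def)
  show thesis
  proof (rule that [OF H(1)])
    fix X assume X: "X \<in> p" "X ** H = H ** X"
    have XZ: "X ** Z = Z ** X" if Z: "Z \<in> a" for Z
    proof (rule onb_entries_eqI [OF b])
      fix i k
      have entry: "h ((X ** Z) *v b k) (b i) = l k Z *\<^sub>R h (X *v b k) (b i)"
        "h ((Z ** X) *v b k) (b i) = l i Z *\<^sub>R h (X *v b k) (b i)" if Z: "Z \<in> a" for Z
        using h_eigen_adjoint [OF p_selfadj l [OF Z], of "X *v b k" i] ap Z
        by (auto simp: matrix_vector_mul_assoc [symmetric] l [OF Z] matrix_vector_scaleR_right h_simps)
      show "h ((X ** Z) *v b k) (b i) = h ((Z ** X) *v b k) (b i)"
      proof (cases "h (X *v b k) (b i) = 0")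
        case False
        then have "l k H = l i H"
          using entry [OF H(1)] X(2) by simp
        then show ?thesis
          using H(2) Z entry [OF Z] by metis
      qed (simp add: entry [OF Z])
    qed
    define c where "c = {Z + t *\<^sub>R X | Z t. Z \<in> a}"
    have "c = a"
    proof (rule max)
      show "c \<subseteq> p"
        using ap X p_subspace by (auto simp: c_def intro!: subspace_add subspace_scale)
      show "a \<subseteq> c"
        unfolding c_def by (force intro: exI [of _ 0])
      show "abelian_subalgebra c"
        unfolding abelian_subalgebra_def
      proof (intro conjI ballI subspaceI)
        show "0 \<in> c"
          unfolding c_def using subspace_0 [OF sa] by force
        fix Y Y' r assume "Y \<in> c" "Y' \<in> c"
        then obtain Z t Z' t' where Z: "Z \<in> a" "Y = Z + t *\<^sub>R X" "Z' \<in> a" "Y' = Z' + t' *\<^sub>R X"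
          by (auto simp: c_def)
        have "Y + Y' = (Z + Z') + (t + t') *\<^sub>R X"
          by (simp add: Z algebra_simps)
        then show "Y + Y' \<in> c"
          unfolding c_def using Z subspace_add [OF sa] by blast
        have "r *\<^sub>R Y = r *\<^sub>R Z + (r * t) *\<^sub>R X"
          by (simp add: Z algebra_simps)
        then show "r *\<^sub>R Y \<in> c"
          unfolding c_def using Z subspace_scale [OF sa] by blast
        show "Y ** Y' - Y' ** Y = 0"
          using Z comm [of Z Z'] XZ [of Z] XZ [of Z']
          by (simp add: matrix_add_ldistrib matrix_mult_add_rdistrib scaleR_matrix_mult scaleR_right_distrib mult.commute)
      qed
    qed
    moreover have "0 + 1 *\<^sub>R X \<in> c"
      unfolding c_def using subspace_0 [OF sa] by blast
    ultimately show "X \<in> a"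
      by simp
  qed
qed

text \<open>Some conjugate of a regular element of \<open>a\<close> commutes with \<open>X\<close>; conjugate back.\<close>

lemma conj_into_maximal_abelian:
  assumes a: "maximal_abelian_in p a" and aW: "\<And>Z w. Z \<in> a \<Longrightarrow> w \<in> W \<Longrightarrow> Z *v w \<in> W"
    and X: "X \<in> p" "\<And>w. w \<in> W \<Longrightarrow> X *v w \<in> W" and W: "vec.subspace W"
  obtains k where "k \<in> K" "\<And>w. w \<in> W \<Longrightarrow> k *v w \<in> W" "conj_by k X \<in> a"
proof -
  obtain H where H: "H \<in> a" "\<And>X. X \<in> p \<Longrightarrow> X ** H = H ** X \<Longrightarrow> X \<in> a"
    using regular_element [OF a] by blast
  have Hp: "H \<in> p"
    using H(1) a by (auto simp: maximal_abelian_in_def)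
  obtain j where j: "j \<in> K" "\<And>w. w \<in> W \<Longrightarrow> j *v w \<in> W" "X ** conj_by j H = conj_by j H ** X"
    using commuting_conjugate [OF X Hp aW [OF H(1)] W] by blast
  have "conj_by (matrix_inv j) (X ** conj_by j H) = conj_by (matrix_inv j) (conj_by j H ** X)"
    by (simp only: j(3))
  then have "conj_by (matrix_inv j) X ** H = H ** conj_by (matrix_inv j) X"
    by (simp only: conj_by_mult [OF matrix_inv_K(1) [OF j(1)]] conj_by_inverse(1) [OF j(1)])
  then have "conj_by (matrix_inv j) X \<in> a"
    using H(2) conj_by_p X matrix_inv_K j by blast
  then show thesis
    using that [of "matrix_inv j"] matrix_inv_K [OF j(1)] matrix_inv_K_invariant [OF j(1) W j(2)] by blast
qed

text \<open>Move a regular element of \<open>a'\<close> into \<open>a\<close>; the centraliser of the conjugate is the conjugate of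
  \<open>a'\<close>, and it contains \<open>a\<close>.\<close>

lemma maximal_abelian_conjugate:
  assumes a: "maximal_abelian_in p a" "\<And>Z w. Z \<in> a \<Longrightarrow> w \<in> W \<Longrightarrow> Z *v w \<in> W"
    and a': "maximal_abelian_in p a'" "\<And>Z w. Z \<in> a' \<Longrightarrow> w \<in> W \<Longrightarrow> Z *v w \<in> W"
    and W: "vec.subspace W"
  obtains k where "k \<in> K" "\<And>w. w \<in> W \<Longrightarrow> k *v w \<in> W" "conj_by k ` a' = a"
proof -
  obtain H where H: "H \<in> a'" "\<And>X. X \<in> p \<Longrightarrow> X ** H = H ** X \<Longrightarrow> X \<in> a'"
    using regular_element [OF a'(1)] by blast
  have Hp: "H \<in> p"
    using H(1) a' by (auto simp: maximal_abelian_in_def)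
  obtain k where k: "k \<in> K" "\<And>w. w \<in> W \<Longrightarrow> k *v w \<in> W" "conj_by k H \<in> a"
    using conj_into_maximal_abelian [OF a Hp a'(2) [OF H(1)] W] by blast
  have "a \<subseteq> conj_by k ` a'"
  proof
    fix Z assume Z: "Z \<in> a"
    have "Z ** conj_by k H = conj_by k H ** Z"
      using a(1) Z k(3) by (auto simp: maximal_abelian_in_def abelian_subalgebra_def)
    then have "conj_by (matrix_inv k) (Z ** conj_by k H) = conj_by (matrix_inv k) (conj_by k H ** Z)"
      by simp
    then have "conj_by (matrix_inv k) Z ** H = H ** conj_by (matrix_inv k) Z"
      by (simp add: conj_by_mult matrix_inv_K k conj_by_inverse)
    moreover have "conj_by (matrix_inv k) Z \<in> p"
      using a(1) Z matrix_inv_K [OF k(1)] by (intro conj_by_p) (auto simp: maximal_abelian_in_def)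
    ultimately have "conj_by (matrix_inv k) Z \<in> a'"
      by (intro H(2))
    then show "Z \<in> conj_by k ` a'"
      by (metis conj_by_inverse(2) image_eqI k(1))
  qed
  moreover have "maximal_abelian_in p (conj_by k ` a')"
    by (rule maximal_abelian_conj_by [OF k(1) a'(1)])
  ultimately have "conj_by k ` a' = a"
    using a(1) unfolding maximal_abelian_in_def by blast
  then show thesis
    using that k by blast
qed

end

section \<open>The gradient map and its polytope\<close>

lemma subspace_projection:
  fixes S :: "'a::euclidean_space set"
  assumes "subspace S"
  obtains \<pi> where "bounded_linear \<pi>" "\<And>w. \<pi> w \<in> S" "\<And>w. w \<in> S \<Longrightarrow> \<pi> w = w"
proof -
  obtain B where B: "B \<subseteq> S" "pairwise orthogonal B" "\<And>x. x \<in> B \<Longrightarrow> norm x = 1" "independent B" "span B = S"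
    using orthonormal_basis_subspace [OF assms] by metis
  have fin: "finite B"
    using B(4) independent_imp_finite by blast
  show thesis
  proof (rule that)
    show "bounded_linear (\<lambda>w. \<Sum>e\<in>B. (w \<bullet> e) *\<^sub>R e)"
      by (intro bounded_linear_intros)
    show "(\<Sum>e\<in>B. (w \<bullet> e) *\<^sub>R e) \<in> S" for w
      using B(1) by (intro subspace_sum [OF assms] subspace_scale [OF assms]) auto
    show "(\<Sum>e\<in>B. (w \<bullet> e) *\<^sub>R e) = w" if "w \<in> S" for w
      using orthonormal_basis_expand [OF B(2,3) _ fin, of w] that B(5) by simp
  qed
qed

text \<open>The Riesz representation for a product \<open>s\<close> that is bilinear only on \<open>S\<close>: extend it by a projection
  \<open>\<pi>\<close> onto \<open>S\<close> to a form on the whole space with matrix \<open>T\<close>. The functional \<open>\<phi> \<circ> \<pi>\<close>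
  vanishes on the kernel of this form, so its gradient lies in the range of \<open>T\<close>.\<close>

lemma riesz_subspace:
  fixes S :: "'a::euclidean_space set" and s :: "'a \<Rightarrow> 'a \<Rightarrow> real"
  assumes S: "subspace S"
    and add: "\<And>X Y Z. X \<in> S \<Longrightarrow> Y \<in> S \<Longrightarrow> Z \<in> S \<Longrightarrow> s (X + Y) Z = s X Z + s Y Z"
    and scale: "\<And>r X Z. X \<in> S \<Longrightarrow> Z \<in> S \<Longrightarrow> s (r *\<^sub>R X) Z = r * s X Z"
    and sym: "\<And>X Z. X \<in> S \<Longrightarrow> Z \<in> S \<Longrightarrow> s X Z = s Z X"
    and pos: "\<And>X. X \<in> S \<Longrightarrow> X \<noteq> 0 \<Longrightarrow> s X X > 0"
    and \<phi>: "\<And>X Y. X \<in> S \<Longrightarrow> Y \<in> S \<Longrightarrow> \<phi> (X + Y) = \<phi> X + \<phi> Y" "\<And>r X. X \<in> S \<Longrightarrow> \<phi> (r *\<^sub>R X) = r * \<phi> X"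
  obtains m where "m \<in> S" "\<And>Z. Z \<in> S \<Longrightarrow> s m Z = \<phi> Z"
proof -
  obtain \<pi> where \<pi>: "bounded_linear \<pi>" "\<And>w. \<pi> w \<in> S" "\<And>w. w \<in> S \<Longrightarrow> \<pi> w = w"
    using subspace_projection [OF S] by blast
  note \<pi>_lin = linear_add [OF bounded_linear.linear [OF \<pi>(1)]] linear_scale [OF bounded_linear.linear [OF \<pi>(1)]]
  have represent: "(\<Sum>e\<in>Basis. f e *\<^sub>R e) \<bullet> Z = f Z" if f: "linear f" for f :: "'a \<Rightarrow> real" and Z
  proof -
    have "f Z = f (\<Sum>e\<in>Basis. (Z \<bullet> e) *\<^sub>R e)"
      by (simp add: euclidean_representation)
    also have "\<dots> = (\<Sum>e\<in>Basis. f e *\<^sub>R e) \<bullet> Z"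
      by (simp add: linear_sum [OF f] linear_scale [OF f] inner_sum_right inner_commute [of _ Z] mult.commute)
    finally show ?thesis ..
  qed
  have lin: "linear (\<lambda>Z. s (\<pi> Z) (\<pi> X))" "linear (\<lambda>Z. \<phi> (\<pi> Z))" for X
    by (intro linearI; simp add: \<pi>_lin add scale \<phi> \<pi>(2))+
  moreover have "(\<lambda>Z. s (\<pi> X) (\<pi> Z)) = (\<lambda>Z. s (\<pi> Z) (\<pi> X))" for X
    by (intro ext sym \<pi>(2))
  ultimately have lin': "linear (\<lambda>Z. s (\<pi> X) (\<pi> Z))" for X
    by simp
  define T where "T X = (\<Sum>e\<in>Basis. s (\<pi> X) (\<pi> e) *\<^sub>R e)" for X
  define y where "y = (\<Sum>e\<in>Basis. \<phi> (\<pi> e) *\<^sub>R e)"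
  have T: "T X \<bullet> Z = s (\<pi> X) (\<pi> Z)" and y: "y \<bullet> Z = \<phi> (\<pi> Z)" for X Z
    unfolding T_def y_def using represent [OF lin'] represent [OF lin(2)] by auto
  have "linear T"
    unfolding T_def
    by (intro linearI) (simp_all add: linear_add [OF lin(1)] linear_scale [OF lin(1)] scaleR_add_left
        sum.distrib scaleR_sum_right)
  then have range: "subspace (range T)"
    by (rule linear_subspace_image [OF _ subspace_UNIV])
  have "y \<in> orthogonal_comp (orthogonal_comp (range T))"
    unfolding orthogonal_comp_def orthogonal_def
  proof clarify
    fix w assume "\<forall>x\<in>range T. x \<bullet> w = 0"
    then have "s (\<pi> w) (\<pi> w) = 0"
      using T by auto
    then have "\<pi> w = 0"
      using pos [OF \<pi>(2), of w] by auto
    then show "w \<bullet> y = 0"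
      using y [of w] \<phi>(2) [OF subspace_0 [OF S], of 0] by (simp add: inner_commute)
  qed
  then obtain X where X: "T X = y"
    using orthogonal_comp_self [OF range] by auto
  show thesis
  proof (rule that [of "\<pi> X"])
    show "s (\<pi> X) Z = \<phi> Z" if "Z \<in> S" for Z
      using T [of X Z] y [of Z] X \<pi>(3) [OF that] by simp
  qed (rule \<pi>(2))
qed

locale moment_setting = irreducible_polar_group h G K p
  for h :: "complex^'n \<Rightarrow> complex^'n \<Rightarrow> complex" and G K p +
  fixes s :: "complex^'n^'n \<Rightarrow> complex^'n^'n \<Rightarrow> real" and a :: "(complex^'n^'n) set"
  assumes scalar_product: "invariant_scalar_product K p s"
    and maximal_abelian: "maximal_abelian_in p a"
begin

lemma a_subset_p: "X \<in> a \<Longrightarrow> X \<in> p"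
  and subspace_a: "subspace a"
  and a_commute: "X \<in> a \<Longrightarrow> Y \<in> a \<Longrightarrow> X ** Y = Y ** X"
  using maximal_abelian by (auto simp: maximal_abelian_in_def abelian_subalgebra_def)

lemma
  shows s_add: "X \<in> p \<Longrightarrow> Y \<in> p \<Longrightarrow> Z \<in> p \<Longrightarrow> s (X + Y) Z = s X Z + s Y Z"
    and s_scale: "X \<in> p \<Longrightarrow> Z \<in> p \<Longrightarrow> s (r *\<^sub>R X) Z = r * s X Z"
    and s_sym: "X \<in> p \<Longrightarrow> Z \<in> p \<Longrightarrow> s X Z = s Z X"
    and s_pos: "X \<in> p \<Longrightarrow> X \<noteq> 0 \<Longrightarrow> s X X > 0"
    and s_invariant: "k \<in> K \<Longrightarrow> X \<in> p \<Longrightarrow> Z \<in> p \<Longrightarrow> s (conj_by k X) (conj_by k Z) = s X Z"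
  using scalar_product unfolding invariant_scalar_product_def by blast+

lemma s_diff: "X \<in> p \<Longrightarrow> Y \<in> p \<Longrightarrow> Z \<in> p \<Longrightarrow> s (X - Y) Z = s X Z - s Y Z"
  using s_add [of X "(-1) *\<^sub>R Y" Z] s_scale [of Y Z "-1"] subspace_scale [OF p_subspace, of Y "-1"] by simp

lemma s_sum:
  assumes "\<And>i. i \<in> I \<Longrightarrow> X i \<in> p" "Z \<in> p"
  shows "s (\<Sum>i\<in>I. u i *\<^sub>R X i) Z = (\<Sum>i\<in>I. u i * s (X i) Z)"
proof -
  have 0: "s 0 Z = 0"
    using s_scale [of Z Z 0] assms(2) by simp
  show ?thesis
    using assms(1)
  proof (induction I rule: infinite_finite_induct)
    case (insert i I)
    then have "u i *\<^sub>R X i \<in> p" "(\<Sum>i\<in>I. u i *\<^sub>R X i) \<in> p"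
      using p_subspace by (auto intro: subspace_sum subspace_scale)
    then show ?case
      using insert assms(2) by (simp add: s_add s_scale)
  qed (simp_all add: 0)
qed

lemma s_separates:
  assumes "subspace S" "S \<subseteq> p" "X \<in> S" "Y \<in> S" "\<And>Z. Z \<in> S \<Longrightarrow> s X Z = s Y Z"
  shows "X = Y"
proof -
  have "X - Y \<in> S"
    using assms by (simp add: subspace_diff)
  then have "s (X - Y) (X - Y) = 0"
    using assms by (subst s_diff) auto
  then show ?thesis
    using s_pos [of "X - Y"] assms \<open>X - Y \<in> S\<close> by fastforce
qed

lemma s_representable:
  assumes "subspace S" "S \<subseteq> p"
    and "\<And>X Y. X \<in> S \<Longrightarrow> Y \<in> S \<Longrightarrow> \<phi> (X + Y) = \<phi> X + \<phi> Y" "\<And>r X. X \<in> S \<Longrightarrow> \<phi> (r *\<^sub>R X) = r * \<phi> X"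
  obtains m where "m \<in> S" "\<And>Z. Z \<in> S \<Longrightarrow> s m Z = \<phi> Z"
proof (rule riesz_subspace [of S s \<phi>])
  show "s X Z = s Z X" if "X \<in> S" "Z \<in> S" for X Z
    using that assms by (intro s_sym) auto
  show "s (X + Y) Z = s X Z + s Y Z" if "X \<in> S" "Y \<in> S" "Z \<in> S" for X Y Z
    using that assms by (intro s_add) auto
  show "s (r *\<^sub>R X) Z = r * s X Z" if "X \<in> S" "Z \<in> S" for r X Z
    using that assms by (intro s_scale) auto
  show "s X X > 0" if "X \<in> S" "X \<noteq> 0" for X
    using that assms by (intro s_pos) auto
qed (use assms that in auto)

abbreviation mu :: "complex^'n \<Rightarrow> complex^'n^'n" where
  "mu v \<equiv> abelian_gradient_map h p s a (vec.span {v})"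

definition rayleigh :: "complex^'n^'n \<Rightarrow> complex^'n \<Rightarrow> real" where
  "rayleigh \<beta> v = Re (h (\<beta> *v v) v) / Re (h v v)"

lemma rayleigh_linear:
  "rayleigh (X + Y) v = rayleigh X v + rayleigh Y v" "rayleigh (r *\<^sub>R X) v = r * rayleigh X v"
  by (simp_all add: rayleigh_def matrix_vector_mult_add_rdistrib matrix_vector_mult_scaleR h_simps add_divide_distrib)

lemma rayleigh_complex:
  assumes "selfadj \<beta>"
  shows "h (\<beta> *v v) v / h v v = complex_of_real (rayleigh \<beta> v)"
proof -
  have "cnj (h (\<beta> *v v) v) = h (\<beta> *v v) v"
    using assms by (simp add: h_cnj selfadjD)
  then have "h (\<beta> *v v) v = complex_of_real (Re (h (\<beta> *v v) v))"
    by (metis Reals_cnj_iff of_real_Re)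
  then show ?thesis
    by (simp add: rayleigh_def h_self_real)
qed

lemma rayleigh_scale: "z \<noteq> 0 \<Longrightarrow> rayleigh \<beta> (z *s v) = rayleigh \<beta> v"
proof -
  assume z: "z \<noteq> 0"
  have "Re (h (\<beta> *v (z *s v)) (z *s v)) = (cmod z)\<^sup>2 * Re (h (\<beta> *v v) v)"
    "Re (h (z *s v) (z *s v)) = (cmod z)\<^sup>2 * Re (h v v)"
    using arg_cong [OF complex_norm_square [of z, symmetric], of "\<lambda>w. Re (w * h (\<beta> *v v) v)"]
      arg_cong [OF complex_norm_square [of z, symmetric], of "\<lambda>w. Re (w * h v v)"]
    by (simp_all add: vector_scalar_commute h_simps mult_ac flip: of_real_power)
  then show ?thesis
    using z by (simp add: rayleigh_def)
qed

text \<open>The Rayleigh quotient takes the same value at all nonzero points of a line, so the defining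
  condition of the gradient map is one condition per \<open>\<beta>\<close> and has exactly one solution.\<close>

lemma gradient_map_line:
  assumes "v \<noteq> 0"
  shows "gradient_map h p s (vec.span {v}) \<in> p"
    and "\<beta> \<in> p \<Longrightarrow> s (gradient_map h p s (vec.span {v})) \<beta> = rayleigh \<beta> v"
proof -
  obtain m where m: "m \<in> p" "\<And>\<beta>. \<beta> \<in> p \<Longrightarrow> s m \<beta> = rayleigh \<beta> v"
    using s_representable [OF p_subspace order_refl, of "\<lambda>\<beta>. rayleigh \<beta> v"] rayleigh_linear by blast
  have eq: "complex_of_real (s m' \<beta>) = h (\<beta> *v w) w / h w w \<longleftrightarrow> s m' \<beta> = rayleigh \<beta> v"
    if "w \<in> vec.span {v} - {0}" "\<beta> \<in> p" for m' \<beta> w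
  proof -
    obtain z where "w = z *s v" "z \<noteq> 0"
      using \<open>w \<in> _\<close> by (auto simp: vec.span_singleton)
    then show ?thesis
      using rayleigh_complex [OF p_selfadj [OF that(2)], of w] rayleigh_scale [of z \<beta> v] by simp
  qed
  have v: "v \<in> vec.span {v} - {0}"
    using assms by (simp add: vec.span_base)
  have "gradient_map h p s (vec.span {v}) = m"
    unfolding gradient_map_def
  proof (rule the_equality)
    fix m' assume m': "m' \<in> p \<and> (\<forall>w\<in>vec.span {v} - {0}. \<forall>\<beta>\<in>p. complex_of_real (s m' \<beta>) = h (\<beta> *v w) w / h w w)"
    show "m' = m"
    proof (rule s_separates [OF p_subspace order_refl])
      show "s m' Z = s m Z" if "Z \<in> p" for Z
        using m' eq [OF v that] v that m by auto
    qed (use m m' in auto)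
  next
    show "m \<in> p \<and> (\<forall>w\<in>vec.span {v} - {0}. \<forall>\<beta>\<in>p. complex_of_real (s m \<beta>) = h (\<beta> *v w) w / h w w)"
      using m eq by blast
  qed
  then show "gradient_map h p s (vec.span {v}) \<in> p"
    "\<beta> \<in> p \<Longrightarrow> s (gradient_map h p s (vec.span {v})) \<beta> = rayleigh \<beta> v"
    using m by auto
qed

lemma mu_in_a: "v \<noteq> 0 \<Longrightarrow> mu v \<in> a"
  and s_mu: "v \<noteq> 0 \<Longrightarrow> Z \<in> a \<Longrightarrow> s (mu v) Z = rayleigh Z v"
proof -
  assume v: "v \<noteq> 0"
  let ?X = "gradient_map h p s (vec.span {v})"
  have X: "?X \<in> p" "\<And>\<beta>. \<beta> \<in> p \<Longrightarrow> s ?X \<beta> = rayleigh \<beta> v"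
    using gradient_map_line [OF v] by auto
  have ap: "a \<subseteq> p"
    using a_subset_p by blast
  obtain m where m: "m \<in> a" "\<And>Z. Z \<in> a \<Longrightarrow> s m Z = rayleigh Z v"
    using s_representable [OF subspace_a ap, of "\<lambda>\<beta>. rayleigh \<beta> v"] rayleigh_linear by blast
  have "mu v = m"
    unfolding abelian_gradient_map_def orth_proj_def o_def
  proof (rule the_equality)
    show "m \<in> a \<and> (\<forall>Z\<in>a. s (?X - m) Z = 0)"
      using m X a_subset_p by (simp add: s_diff)
    fix Y assume Y: "Y \<in> a \<and> (\<forall>Z\<in>a. s (?X - Y) Z = 0)"
    show "Y = m"
    proof (rule s_separates [OF subspace_a ap])
      show "s Y Z = s m Z" if "Z \<in> a" for Z
        using Y m that X a_subset_p s_diff [of ?X Y Z] by simp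
    qed (use Y m in auto)
  qed
  then show "mu v \<in> a" "Z \<in> a \<Longrightarrow> s (mu v) Z = rayleigh Z v"
    using m by auto
qed

lemma mu_eqI:
  assumes "v \<noteq> 0" "m \<in> a" "\<And>Z. Z \<in> a \<Longrightarrow> s m Z = rayleigh Z v"
  shows "mu v = m"
  using assms mu_in_a s_mu a_subset_p by (intro s_separates [OF subspace_a]) auto

end

text \<open>A simultaneous eigenbasis for \<open>a\<close>; the functionals \<open>l i\<close> are the weights of \<open>V\<close>, and \<open>wt i\<close> below
  are the points of \<open>a\<close> that represent them.\<close>

locale weight_basis = moment_setting h G K p s a
  for h :: "complex^'n \<Rightarrow> complex^'n \<Rightarrow> complex" and G K p s a +
  fixes b :: "'n \<Rightarrow> complex^'n" and l :: "'n \<Rightarrow> complex^'n^'n \<Rightarrow> real"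
  assumes onb: "onb b" and weight: "X \<in> a \<Longrightarrow> X *v b i = l i X *\<^sub>R b i"
begin

lemma a_selfadj: "Z \<in> a \<Longrightarrow> selfadj Z"
  by (intro p_selfadj a_subset_p)

abbreviation amp :: "complex^'n \<Rightarrow> 'n \<Rightarrow> real" where
  "amp v i \<equiv> (cmod (h v (b i)))\<^sup>2"

lemma h_self_amp: "Re (h v v) = (\<Sum>i\<in>UNIV. amp v i)"
proof -
  have "h v v = complex_of_real (\<Sum>i\<in>UNIV. amp v i)"
    unfolding onb_parseval [OF onb, of v v] of_real_sum by (rule sum.cong) (simp_all only: complex_norm_square)
  then show ?thesis
    by simp
qed

lemma h_weight_amp: 
  assumes "Z \<in> a"
  shows "Re (h (Z *v v) v) = (\<Sum>i\<in>UNIV. l i Z * amp v i)"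
proof -
  have "h (Z *v v) v = complex_of_real (\<Sum>i\<in>UNIV. l i Z * amp v i)"
    unfolding onb_parseval [OF onb, of "Z *v v" v] of_real_sum
      h_eigen_adjoint [OF a_selfadj [OF assms] weight [OF assms]]
    by (rule sum.cong) (simp_all add: scaleR_conv_of_real mult.assoc complex_norm_square [symmetric] del: of_real_power)
  then show ?thesis
    by simp
qed

lemma rayleigh_weights: "Z \<in> a \<Longrightarrow> rayleigh Z v = (\<Sum>i\<in>UNIV. l i Z * amp v i) / (\<Sum>i\<in>UNIV. amp v i)"
  by (simp add: rayleigh_def h_weight_amp h_self_amp)

lemma amp_sum_pos: "v \<noteq> 0 \<Longrightarrow> (\<Sum>i\<in>UNIV. amp v i) > 0"
  using h_pos [of v] by (simp add: h_self_amp)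

abbreviation wt :: "'n \<Rightarrow> complex^'n^'n" where
  "wt i \<equiv> mu (b i)"

lemma wt_in_a: "wt i \<in> a"
  by (rule mu_in_a [OF onb_nonzero [OF onb]])

lemma s_wt: "Z \<in> a \<Longrightarrow> s (wt i) Z = l i Z"
  by (simp add: s_mu onb_nonzero [OF onb] rayleigh_def weight h_simps onb_orthonormal [OF onb])

lemma s_combination: "Z \<in> a \<Longrightarrow> s (\<Sum>i\<in>UNIV. u i *\<^sub>R wt i) Z = (\<Sum>i\<in>UNIV. u i * l i Z)"
  using wt_in_a a_subset_p by (subst s_sum) (auto simp: s_wt)

lemma combination_in_a: "(\<Sum>i\<in>UNIV. u i *\<^sub>R wt i) \<in> a"
  by (intro subspace_sum [OF subspace_a] subspace_scale [OF subspace_a] wt_in_a)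

lemma mu_combination:
  assumes "v \<noteq> 0"
  shows "mu v = (\<Sum>i\<in>UNIV. (amp v i / (\<Sum>k\<in>UNIV. amp v k)) *\<^sub>R wt i)"
proof (rule mu_eqI [OF assms combination_in_a])
  fix Z assume "Z \<in> a"
  then show "s (\<Sum>i\<in>UNIV. (amp v i / (\<Sum>k\<in>UNIV. amp v k)) *\<^sub>R wt i) Z = rayleigh Z v"
    by (simp add: s_combination rayleigh_weights sum_divide_distrib mult.commute)
qed

text \<open>The set \<open>P\<close> of the theorem.\<close>

abbreviation moment_polytope :: "(complex^'n^'n) set" where
  "moment_polytope \<equiv> abelian_gradient_map h p s a ` proj_space"

lemma moment_polytope_mu: "moment_polytope = {mu v | v. v \<noteq> 0}"
  by (auto simp: proj_space_def)

text \<open>A convex combination with coefficients \<open>u i\<close> is the image of the vector with coefficients \<open>sqrt (u i)\<close>.\<close>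

lemma moment_polytope_combinations:
  "moment_polytope = {\<Sum>i\<in>UNIV. u i *\<^sub>R wt i | u. (\<forall>i. 0 \<le> u i) \<and> sum u UNIV = 1}"
  unfolding moment_polytope_mu
proof (intro equalityI subsetI)
  fix x assume "x \<in> {mu v | v. v \<noteq> 0}"
  then obtain v where v: "v \<noteq> 0" "x = mu v"
    by auto
  then show "x \<in> {\<Sum>i\<in>UNIV. u i *\<^sub>R wt i | u. (\<forall>i. 0 \<le> u i) \<and> sum u UNIV = 1}"
    using mu_combination [OF v(1)] amp_sum_pos [OF v(1)]
    by (auto intro!: exI [of _ "\<lambda>i. amp v i / (\<Sum>k\<in>UNIV. amp v k)"] simp: sum_divide_distrib [symmetric] sum_nonneg)
next
  fix x assume "x \<in> {\<Sum>i\<in>UNIV. u i *\<^sub>R wt i | u. (\<forall>i. 0 \<le> u i) \<and> sum u UNIV = 1}"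
  then obtain u where u: "\<And>i. 0 \<le> u i" "sum u UNIV = 1" and x: "x = (\<Sum>i\<in>UNIV. u i *\<^sub>R wt i)"
    by auto
  define v where "v = (\<Sum>i\<in>UNIV. complex_of_real (sqrt (u i)) *s b i)"
  have "h v (b i) = complex_of_real (sqrt (u i))" for i
    by (simp add: v_def h_sum_left h_simps onb_orthonormal [OF onb] if_distrib cong: if_cong)
  then have amp: "amp v i = u i" for i
    using u(1) by simp
  have "v \<noteq> 0"
    using u(2) amp by (auto simp: h_simps)
  then have "mu v = x"
    using mu_combination [of v] u(2) by (simp add: amp x)
  then show "x \<in> {mu v | v. v \<noteq> 0}"
    using \<open>v \<noteq> 0\<close> by auto
qed

lemma moment_polytope_convex_hull: "moment_polytope = convex hull (range wt)"
proof
  have "(\<Sum>i\<in>UNIV. u i *\<^sub>R wt i) \<in> convex hull (range wt)" if "\<And>i. 0 \<le> u i" "sum u UNIV = 1" for u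
    using that by (intro convex_sum) (auto intro: hull_inc)
  then show "moment_polytope \<subseteq> convex hull (range wt)"
    by (auto simp: moment_polytope_combinations)
  show "convex hull (range wt) \<subseteq> moment_polytope"
  proof (rule hull_minimal)
    show "range wt \<subseteq> moment_polytope"
      using onb_nonzero [OF onb] by (auto simp: moment_polytope_mu)
    show "convex moment_polytope"
      unfolding convex_def moment_polytope_combinations
    proof clarify
      fix r t :: real and u w :: "'n \<Rightarrow> real"
      assume *: "0 \<le> r" "0 \<le> t" "r + t = 1" "\<forall>i. 0 \<le> u i" "sum u UNIV = 1" "\<forall>i. 0 \<le> w i" "sum w UNIV = 1"
      show "\<exists>u'. r *\<^sub>R (\<Sum>i\<in>UNIV. u i *\<^sub>R wt i) + t *\<^sub>R (\<Sum>i\<in>UNIV. w i *\<^sub>R wt i) = (\<Sum>i\<in>UNIV. u' i *\<^sub>R wt i)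
          \<and> (\<forall>i. 0 \<le> u' i) \<and> sum u' UNIV = 1"
        using * by (intro exI [of _ "\<lambda>i. r * u i + t * w i"])
          (simp add: scaleR_sum_right sum.distrib scaleR_add_left sum_distrib_left [symmetric])
    qed
  qed
qed

text \<open>The surjectivity part of the convexity theorem for \<open>exp a\<close>. At a maximum \<open>v\<close> of
  \<open>\<Prod> |v i|\<^bsup>2 u i\<^esup> / |v|\<^sup>2\<close> on the cone, the logarithmic derivative along \<open>exp (tZ) v\<close> is
  twice the difference between \<open>\<Sum> u i * l i Z\<close> and the Rayleigh quotient of \<open>Z\<close>. The vector
  \<open>v0\<close> ensures that the maximum is positive.\<close>

lemma polytope_attained_on_invariant_cone:
  assumes closed: "closedin (top_of_set (- {0})) \<Omega>"
    and scale: "\<And>v r. v \<in> \<Omega> \<Longrightarrow> r > (0 :: real) \<Longrightarrow> r *\<^sub>R v \<in> \<Omega>"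
    and inv: "\<And>v Z. v \<in> \<Omega> \<Longrightarrow> Z \<in> a \<Longrightarrow> mexp Z *v v \<in> \<Omega>"
    and generic: "v0 \<in> \<Omega>" "\<And>i. h v0 (b i) \<noteq> 0"
    and x: "x \<in> moment_polytope"
  obtains v where "v \<in> \<Omega>" "v \<noteq> 0" "mu v = x"
proof -
  obtain u where u: "\<And>i. 0 \<le> u i" "sum u UNIV = 1" and xu: "x = (\<Sum>i\<in>UNIV. u i *\<^sub>R wt i)"
    using x by (auto simp: moment_polytope_combinations)
  define I where "I = {i. u i > 0}"
  have sumI: "sum (\<lambda>i. u i * f i) I = (\<Sum>i\<in>UNIV. u i * f i)" for f :: "'n \<Rightarrow> real"
    by (rule sum.mono_neutral_left) (use u(1) in \<open>auto simp: I_def less_le\<close>)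
  have sumI1: "sum u I = 1"
    using sumI [of "\<lambda>_. 1"] u(2) by simp
  define F where "F v = (\<Prod>i\<in>I. amp v i powr u i) / (\<Sum>i\<in>UNIV. amp v i)" for v
  define C where "C = \<Omega> \<inter> sphere 0 1"
  have \<Omega>0: "v \<noteq> 0" if "v \<in> \<Omega>" for v
    using closedin_subset [OF closed] that by auto
  obtain T where T: "closed T" "\<Omega> = - {0} \<inter> T"
    using closed by (auto simp: closedin_closed)
  have "C = T \<inter> sphere 0 1"
    by (auto simp: C_def T)
  then have "compact C"
    using T(1) by (simp add: closed_Int_compact)
  have normalize: "(1 / norm v) *\<^sub>R v \<in> C" if "v \<in> \<Omega>" for v
    using that scale [OF that, of "1 / norm v"] \<Omega>0 [OF that] by (simp add: C_def)
  have F_scale: "F (r *\<^sub>R v) = F v" if "r > 0" for r v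
  proof -
    have amp: "amp (r *\<^sub>R v) i = r\<^sup>2 * amp v i" for i
      by (simp add: h_simps power_mult_distrib)
    have "(\<Prod>i\<in>I. amp (r *\<^sub>R v) i powr u i) = (\<Prod>i\<in>I. (r\<^sup>2) powr u i) * (\<Prod>i\<in>I. amp v i powr u i)"
      unfolding amp prod.distrib [symmetric] by (intro prod.cong refl powr_mult)
    also have "(\<Prod>i\<in>I. (r\<^sup>2) powr u i) = r\<^sup>2"
      using that by (simp add: powr_sum [symmetric] sumI1)
    finally show ?thesis
      using that unfolding F_def amp sum_distrib_left [symmetric] by simp
  qed
  have "continuous_on C F"
    unfolding F_def
    by (intro continuous_intros continuous_on_prod continuous_on_powr' h_continuous_on)
      (use amp_sum_pos \<Omega>0 in \<open>auto simp: C_def I_def less_imp_neq [symmetric]\<close>)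
  then obtain v where v: "v \<in> C" and maxC: "\<And>w. w \<in> C \<Longrightarrow> F w \<le> F v"
    using continuous_attains_sup [OF \<open>compact C\<close>, of F] normalize [OF generic(1)] by blast
  have max: "F w \<le> F v" if "w \<in> \<Omega>" for w
    using maxC [OF normalize [OF that]] F_scale [of "1 / norm w" w] \<Omega>0 [OF that] by simp
  have v\<Omega>: "v \<in> \<Omega>" "v \<noteq> 0"
    using v \<Omega>0 by (auto simp: C_def)
  have N: "(\<Sum>i\<in>UNIV. amp v i) > 0"
    by (rule amp_sum_pos [OF v\<Omega>(2)])
  have "F v0 > 0"
    unfolding F_def using amp_sum_pos [OF \<Omega>0 [OF generic(1)]] generic(2)
    by (intro divide_pos_pos prod_pos) auto
  then have "F v > 0"
    using max [OF generic(1)] by simp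
  then have "(\<Prod>i\<in>I. amp v i powr u i) \<noteq> 0"
    unfolding F_def by (metis div_0 less_irrefl)
  then have A: "(\<Prod>i\<in>I. amp v i powr u i) > 0"
    using prod_nonneg [of I "\<lambda>i. amp v i powr u i"] by (simp add: less_le)
  have "mu v = x"
  proof (rule mu_eqI [OF v\<Omega>(2)])
    show "x \<in> a"
      unfolding xu by (rule combination_in_a)
    fix Z assume Z: "Z \<in> a"
    define L where "L = (\<Sum>i\<in>UNIV. u i * l i Z)"
    \<comment> \<open>up to a positive constant, the reciprocal of F along the curve exp (tZ) v; it is minimal at 0\<close>
    define g where "g t = (\<Sum>i\<in>UNIV. amp v i * exp (2 * t * (l i Z - L)))" for t
    have "g 0 \<le> g t" for t
    proof -
      define w where "w = mexp (t *\<^sub>R Z) *v v"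
      have w: "w \<in> \<Omega>"
        unfolding w_def using v\<Omega>(1) Z by (intro inv subspace_scale [OF subspace_a])
      have amp: "amp w i = exp (2 * t * l i Z) * amp v i" for i
        by (simp add: w_def mexp_eigen_adjoint [OF a_selfadj [OF Z] weight [OF Z]] power_mult_distrib
            exp_double [symmetric] mult.assoc)
      have "(\<Prod>i\<in>I. amp w i powr u i) = (\<Prod>i\<in>I. exp (2 * t * (u i * l i Z))) * (\<Prod>i\<in>I. amp v i powr u i)"
        unfolding amp prod.distrib [symmetric]
        by (intro prod.cong refl) (simp add: powr_mult exp_powr_real mult_ac)
      also have "(\<Prod>i\<in>I. exp (2 * t * (u i * l i Z))) = exp (2 * t * L)"
        by (simp add: exp_sum [symmetric] sum_distrib_left [symmetric] sumI L_def)
      finally have Fw: "F w = (\<Prod>i\<in>I. amp v i powr u i) * (exp (2 * t * L) / (\<Sum>i\<in>UNIV. amp w i))"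
        by (simp add: F_def)
      have Fv: "F v = (\<Prod>i\<in>I. amp v i powr u i) * (1 / (\<Sum>i\<in>UNIV. amp v i))"
        by (simp add: F_def)
      have "exp (2 * t * L) / (\<Sum>i\<in>UNIV. amp w i) \<le> 1 / (\<Sum>i\<in>UNIV. amp v i)"
        using max [OF w] unfolding Fw Fv by (rule mult_left_le_imp_le [OF _ A])
      then have "exp (2 * t * L) * (\<Sum>i\<in>UNIV. amp v i) \<le> (\<Sum>i\<in>UNIV. amp w i)"
        using N amp_sum_pos [OF \<Omega>0 [OF w]] by (simp add: divide_simps)
      then have "(\<Sum>i\<in>UNIV. amp v i) \<le> exp (- (2 * t * L)) * (\<Sum>i\<in>UNIV. amp w i)"
        by (simp add: exp_minus field_simps)
      also have "\<dots> = g t"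
        unfolding g_def sum_distrib_left
      proof (rule sum.cong)
        fix i
        have "exp (2 * t * (l i Z - L)) = exp (- (2 * t * L)) * exp (2 * t * l i Z)"
          unfolding exp_add [symmetric] by (simp add: right_diff_distrib)
        then show "exp (- (2 * t * L)) * amp w i = amp v i * exp (2 * t * (l i Z - L))"
          by (simp add: amp)
      qed simp
      finally show ?thesis
        by (simp add: g_def)
    qed
    moreover have "(g has_real_derivative (\<Sum>i\<in>UNIV. amp v i * (2 * (l i Z - L)))) (at 0)"
      unfolding g_def by (auto intro!: derivative_eq_intros sum.cong)
    ultimately have "(\<Sum>i\<in>UNIV. amp v i * (2 * (l i Z - L))) = 0"
      by (intro DERIV_local_min [where d = 1]) auto
    then have "2 * ((\<Sum>i\<in>UNIV. l i Z * amp v i) - L * (\<Sum>i\<in>UNIV. amp v i)) = 0"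
      by (simp add: sum_distrib_left sum_subtractf algebra_simps)
    then have "rayleigh Z v = L"
      using N by (simp add: rayleigh_weights [OF Z] field_simps)
    then show "s x Z = rayleigh Z v"
      by (simp add: xu s_combination [OF Z] L_def)
  qed
  then show thesis
    using that v\<Omega> by blast
qed

end

section \<open>Faces modulo the Weyl group\<close>

lemma bij_betw_orbits_quotient:
  assumes E: "equiv X E" and r: "\<And>F. F \<in> \<F> \<Longrightarrow> r F \<in> X"
    and eq: "\<And>F F'. F \<in> \<F> \<Longrightarrow> F' \<in> \<F> \<Longrightarrow> orb F = orb F' \<longleftrightarrow> (r F, r F') \<in> E"
    and onto: "\<And>x. x \<in> X \<Longrightarrow> \<exists>F\<in>\<F>. (r F, x) \<in> E"
  shows "\<exists>f. bij_betw f (orb ` \<F>) (X // E)"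
proof -
  define f where "f q = E `` {r (SOME F. F \<in> \<F> \<and> orb F = q)}" for q
  have f: "f (orb F) = E `` {r F}" if "F \<in> \<F>" for F
  proof -
    have "(SOME F'. F' \<in> \<F> \<and> orb F' = orb F) \<in> \<F> \<and> orb (SOME F'. F' \<in> \<F> \<and> orb F' = orb F) = orb F"
      by (rule someI [of "\<lambda>F'. F' \<in> \<F> \<and> orb F' = orb F" F]) (simp add: that)
    then show ?thesis
      unfolding f_def using eq that by (intro equiv_class_eq [OF E]) blast
  qed
  have "bij_betw f (orb ` \<F>) (X // E)"
  proof (rule bij_betw_imageI)
    show "inj_on f (orb ` \<F>)"
      by (rule inj_onI) (use f eq eq_equiv_class_iff [OF E] r in force)
    show "f ` orb ` \<F> = X // E"
    proof (intro equalityI subsetI)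
      fix q assume "q \<in> f ` orb ` \<F>"
      then obtain F where "F \<in> \<F>" "q = E `` {r F}"
        using f by auto
      then show "q \<in> X // E"
        using r by (simp add: quotientI)
    next
      fix q assume "q \<in> X // E"
      then obtain x where x: "x \<in> X" "q = E `` {x}"
        by (auto elim: quotientE)
      then obtain F where "F \<in> \<F>" "(r F, x) \<in> E"
        using onto by blast
      then have "q = f (orb F)"
        using equiv_class_eq [OF E] x f by simp
      then show "q \<in> f ` orb ` \<F>"
        using \<open>F \<in> \<F>\<close> by blast
    qed
  qed
  then show ?thesis
    by blast
qed

context moment_setting
begin

text \<open>The cone over the lines that \<open>\<mu>\<^sub>a\<close> maps into \<open>F\<close>. For a face it is a linear subspace; this form does
  not refer to a basis, which makes equivariance under the Weyl group immediate.\<close>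

definition face_space :: "(complex^'n^'n) set \<Rightarrow> (complex^'n) set" where
  "face_space F = {v. v = 0 \<or> mu v \<in> F}"

abbreviation N :: "(complex^'n^'n) set" where
  "N \<equiv> normalizer_in K a"

lemma N_iff: "k \<in> N \<longleftrightarrow> k \<in> K \<and> conj_by k ` a = a"
  by (simp add: normalizer_in_def)

lemma N_one: "mat 1 \<in> N"
  by (simp add: N_iff K_one)

lemma N_inverse: "k \<in> N \<Longrightarrow> matrix_inv k \<in> N"
proof -
  assume k: "k \<in> N"
  then have "conj_by (matrix_inv k) ` a = conj_by (matrix_inv k) ` conj_by k ` a"
    by (simp add: N_iff)
  then show ?thesis
    using k by (auto simp: N_iff matrix_inv_K image_image conj_by_inverse)
qed

lemma N_mult: "k \<in> N \<Longrightarrow> j \<in> N \<Longrightarrow> k ** j \<in> N"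
  by (simp add: N_iff K_mult conj_by_comp flip: image_image)

lemma matrix_K_nonzero: "k \<in> K \<Longrightarrow> v \<noteq> 0 \<Longrightarrow> k *v v \<noteq> 0"
  by (metis h_self_eq_0 K_unitary)

lemma mu_equivariant:
  assumes k: "k \<in> N" and v: "v \<noteq> 0"
  shows "mu (k *v v) = conj_by k (mu v)"
proof (rule mu_eqI)
  have kK: "k \<in> K" and ka: "conj_by k ` a = a"
    using k by (auto simp: N_iff)
  show "k *v v \<noteq> 0"
    by (rule matrix_K_nonzero [OF kK v])
  show "conj_by k (mu v) \<in> a"
    using ka mu_in_a [OF v] by blast
  fix Z assume "Z \<in> a"
  then obtain Y where Y: "Y \<in> a" "Z = conj_by k Y"
    using ka by blast
  have "s (conj_by k (mu v)) Z = rayleigh Y v"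
    using Y by (simp add: s_invariant kK a_subset_p mu_in_a v s_mu)
  also have "\<dots> = rayleigh Z (k *v v)"
    by (simp add: rayleigh_def Y(2) conj_by_vector K_unitary [OF kK] matrix_inv_K_vector [OF kK])
  finally show "s (conj_by k (mu v)) Z = rayleigh Z (k *v v)" .
qed

lemma face_space_conj_by:
  assumes k: "k \<in> N"
  shows "face_space (conj_by k ` F) = (*v) k ` face_space F"
proof -
  have kK: "k \<in> K"
    using k by (simp add: N_iff)
  have sub: "(*v) j ` face_space F \<subseteq> face_space (conj_by j ` F)" if "j \<in> N" for j F
  proof
    fix x assume "x \<in> (*v) j ` face_space F"
    then obtain v where v: "v = 0 \<or> mu v \<in> F" "x = j *v v"
      by (auto simp: face_space_def)
    show "x \<in> face_space (conj_by j ` F)"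
    proof (cases "v = 0")
      case False
      then show ?thesis
        using mu_equivariant [OF that False] v by (simp add: face_space_def)
    qed (simp add: v face_space_def)
  qed
  have "face_space (conj_by k ` F) = (*v) k ` (*v) (matrix_inv k) ` face_space (conj_by k ` F)"
    by (simp add: image_image matrix_vector_mul_assoc matrix_inv_K kK)
  also have "\<dots> \<subseteq> (*v) k ` face_space (conj_by (matrix_inv k) ` conj_by k ` F)"
    using sub [OF N_inverse [OF k]] by (intro image_mono)
  also have "conj_by (matrix_inv k) ` conj_by k ` F = F"
    by (simp add: image_image conj_by_inverse kK)
  finally show ?thesis
    using sub [OF k] by blast
qed

lemma weyl_act_coset:
  assumes k: "k \<in> N" and F: "F \<subseteq> a"
  shows "weyl_act ((\<lambda>z. k ** z) ` centralizer_in K a) F = conj_by k ` F"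
proof -
  have kK: "k \<in> K"
    using k by (simp add: N_iff)
  have "conj_by (k ** z) ` F = conj_by k ` F" if "z \<in> centralizer_in K a" for z
    using that F kK by (auto simp: centralizer_in_def conj_by_comp intro!: image_cong)
  moreover have "mat 1 \<in> centralizer_in K a"
    by (simp add: centralizer_in_def K_one)
  ultimately show ?thesis
    by (auto simp: weyl_act_def)
qed

lemma weyl_orbit:
  assumes "F \<subseteq> a"
  shows "(\<lambda>w. weyl_act w F) ` weyl_group K a = {conj_by k ` F | k. k \<in> N}"
  using weyl_act_coset [OF _ assms] by (auto simp: weyl_group_def image_image)

text \<open>Orbits are indexed by the normaliser, because the centraliser of \<open>a\<close> acts trivially on subsets of \<open>a\<close>.\<close>

lemma weyl_orbit_eq_iff:
  assumes "F \<subseteq> a" "F' \<subseteq> a"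
  shows "(\<lambda>w. weyl_act w F) ` weyl_group K a = (\<lambda>w. weyl_act w F') ` weyl_group K a \<longleftrightarrow>
    (\<exists>k\<in>N. F' = conj_by k ` F)"
proof -
  have "{conj_by k ` F | k. k \<in> N} = {conj_by k ` F' | k. k \<in> N}" if k: "k \<in> N" "F' = conj_by k ` F" for k
  proof -
    have kK: "k \<in> K"
      using k by (simp add: N_iff)
    have F: "F = conj_by (matrix_inv k) ` F'"
      by (simp add: k(2) image_image conj_by_inverse kK)
    have "\<exists>i\<in>N. conj_by j ` F = conj_by i ` F'" if "j \<in> N" for j
      using that N_mult [OF that N_inverse [OF k(1)]] kK
      by (intro bexI [of _ "j ** matrix_inv k"]) (simp_all add: F image_image conj_by_comp matrix_inv_K N_iff)
    moreover have "\<exists>i\<in>N. conj_by j ` F' = conj_by i ` F" if "j \<in> N" for j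
      using that N_mult [OF that k(1)] kK
      by (intro bexI [of _ "j ** k"]) (simp_all add: k(2) image_image conj_by_comp N_iff)
    ultimately show ?thesis
      by blast
  qed
  moreover have "\<exists>k\<in>N. F' = conj_by k ` F"
    if "{conj_by k ` F | k. k \<in> N} = {conj_by k ` F' | k. k \<in> N}"
  proof -
    have "conj_by (mat 1) ` F' \<in> {conj_by k ` F' | k. k \<in> N}"
      using N_one by blast
    then show ?thesis
      unfolding that [symmetric] by auto
  qed
  ultimately show ?thesis
    unfolding weyl_orbit [OF assms(1)] weyl_orbit [OF assms(2)] by (metis (no_types, lifting))
qed

end

context weight_basis
begin

definition top_weight :: "complex^'n^'n \<Rightarrow> real \<Rightarrow> bool" where
  "top_weight \<beta> c \<longleftrightarrow> c \<in> range (\<lambda>i. l i \<beta>) \<and> (\<forall>i. l i \<beta> \<le> c)"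

text \<open>The value at \<open>\<beta>\<close> is an average of eigenvalues, which reaches the largest one only if
  no other eigenvalue contributes.\<close>

lemma s_mu_top:
  assumes \<beta>: "\<beta> \<in> a" and c: "top_weight \<beta> c" and v: "v \<noteq> 0"
  shows "s (mu v) \<beta> \<le> c" and "s (mu v) \<beta> = c \<longleftrightarrow> \<beta> *v v = c *\<^sub>R v"
proof -
  have eq: "(c - s (mu v) \<beta>) * (\<Sum>i\<in>UNIV. amp v i) = (\<Sum>i\<in>UNIV. (c - l i \<beta>) * amp v i)"
    using amp_sum_pos [OF v] unfolding s_mu [OF v \<beta>] rayleigh_weights [OF \<beta>]
    by (simp add: field_simps sum_subtractf sum_distrib_left)
  have nonneg: "(c - l i \<beta>) * amp v i \<ge> 0" for i
    using c by (simp add: top_weight_def)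
  have "(c - s (mu v) \<beta>) * (\<Sum>i\<in>UNIV. amp v i) \<ge> 0"
    unfolding eq by (intro sum_nonneg nonneg)
  then show "s (mu v) \<beta> \<le> c"
    using amp_sum_pos [OF v] by (simp add: zero_le_mult_iff)
  have "s (mu v) \<beta> = c \<longleftrightarrow> (\<Sum>i\<in>UNIV. (c - l i \<beta>) * amp v i) = 0"
    unfolding eq [symmetric] using amp_sum_pos [OF v] by auto
  also have "\<dots> \<longleftrightarrow> (\<forall>i. (c - l i \<beta>) * amp v i = 0)"
    using nonneg by (subst sum_nonneg_eq_0_iff) auto
  also have "\<dots> \<longleftrightarrow> (\<forall>i. h v (b i) \<noteq> 0 \<longrightarrow> l i \<beta> = c)"
    by (rule all_cong1) auto
  also have "\<dots> \<longleftrightarrow> \<beta> *v v = c *\<^sub>R v"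
    by (rule eigenvector_iff_coefficients [OF a_selfadj [OF \<beta>] onb weight [OF \<beta>], symmetric])
  finally show "s (mu v) \<beta> = c \<longleftrightarrow> \<beta> *v v = c *\<^sub>R v" .
qed

lemma face_space_exposed:
  assumes "\<beta> \<in> a" "top_weight \<beta> c"
  shows "face_space {x \<in> moment_polytope. s x \<beta> = c} = {v. \<beta> *v v = c *\<^sub>R v}"
proof (rule Set.set_eqI)
  fix v
  show "v \<in> face_space {x \<in> moment_polytope. s x \<beta> = c} \<longleftrightarrow> v \<in> {v. \<beta> *v v = c *\<^sub>R v}"
  proof (cases "v = 0")
    case False
    then have "mu v \<in> moment_polytope"
      unfolding moment_polytope_mu by blast
    then show ?thesis
      using s_mu_top(2) [OF assms False] False by (simp add: face_space_def)
  qed (simp add: face_space_def)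
qed

lemma moment_polytope_subset_a: "moment_polytope \<subseteq> a"
  using mu_in_a by (auto simp: moment_polytope_mu)

lemma face_mu_face_space: "F \<subseteq> moment_polytope \<Longrightarrow> F = mu ` (face_space F - {0})"
  by (auto simp: face_space_def moment_polytope_mu)

lemma exposed_is_face:
  assumes \<beta>: "\<beta> \<in> a" and c: "top_weight \<beta> c"
  shows "{x \<in> moment_polytope. s x \<beta> = c} \<in> nonempty_faces moment_polytope"
proof -
  have cx: "convex moment_polytope"
    unfolding moment_polytope_convex_hull by simp
  have Pp: "x \<in> p" if "x \<in> moment_polytope" for x
    using that moment_polytope_subset_a a_subset_p by blast
  have comb: "s (r *\<^sub>R x + t *\<^sub>R y) \<beta> = r * s x \<beta> + t * s y \<beta>" if "x \<in> moment_polytope" "y \<in> moment_polytope" for r t x y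
    using that Pp a_subset_p [OF \<beta>] subspace_scale [OF p_subspace] by (simp add: s_add s_scale)
  have le: "s x \<beta> \<le> c" if "x \<in> moment_polytope" for x
    using that s_mu_top(1) [OF \<beta> c] by (auto simp: moment_polytope_mu)
  have "{x \<in> moment_polytope. s x \<beta> = c} face_of moment_polytope"
    unfolding face_of_def
  proof (intro conjI ballI impI)
    show "convex {x \<in> moment_polytope. s x \<beta> = c}"
      using cx by (auto simp: convex_def comb distrib_right [symmetric])
    fix x y z assume x: "x \<in> moment_polytope" and y: "y \<in> moment_polytope"
      and z: "z \<in> {x \<in> moment_polytope. s x \<beta> = c}" "z \<in> open_segment x y"
    then obtain u where u: "0 < u" "u < 1" "z = (1 - u) *\<^sub>R x + u *\<^sub>R y"
      by (auto simp: in_segment)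
    have "c = (1 - u) * s x \<beta> + u * s y \<beta>"
      using z(1) comb [OF x y, of "1 - u" u] by (simp add: u(3))
    then have "(1 - u) * (c - s x \<beta>) + u * (c - s y \<beta>) = 0"
      by (simp add: algebra_simps)
    moreover have "(1 - u) * (c - s x \<beta>) \<ge> 0" "u * (c - s y \<beta>) \<ge> 0"
      using le x y u by auto
    ultimately have "(1 - u) * (c - s x \<beta>) = 0" "u * (c - s y \<beta>) = 0"
      by linarith+
    then show "x \<in> {x \<in> moment_polytope. s x \<beta> = c}" "y \<in> {x \<in> moment_polytope. s x \<beta> = c}"
      using u x y by auto
  qed auto
  moreover obtain i where "l i \<beta> = c"
    using c by (auto simp: top_weight_def)
  then have "wt i \<in> {x \<in> moment_polytope. s x \<beta> = c}"
    using onb_nonzero [OF onb] by (auto simp: moment_polytope_mu s_wt [OF \<beta>])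
  ultimately show ?thesis
    by (auto simp: nonempty_faces_def)
qed

text \<open>Faces of a polytope are exposed, and by the Riesz representation on \<open>a\<close> the exposing functional is
  \<open>s\<close> against some \<open>\<beta>\<close>. For the face \<open>P\<close> itself \<open>\<beta>\<close> may be zero.\<close>

lemma face_is_exposed:
  assumes F: "F \<in> nonempty_faces moment_polytope"
  obtains \<beta> c where "\<beta> \<in> a" "top_weight \<beta> c" "F = {x \<in> moment_polytope. s x \<beta> = c}"
proof -
  have "polytope moment_polytope"
    unfolding moment_polytope_convex_hull polytope_def by (intro exI [of _ "range wt"]) simp
  then have "F exposed_face_of moment_polytope"
    using F by (simp add: nonempty_faces_def exposed_face_of_polyhedron polytope_imp_polyhedron)
  then obtain y c where y: "\<And>x. x \<in> moment_polytope \<Longrightarrow> y \<bullet> x \<le> c" and Fy: "F = moment_polytope \<inter> {x. y \<bullet> x = c}"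
    by (auto simp: exposed_face_of_def)
  have ap: "a \<subseteq> p"
    using a_subset_p by blast
  obtain \<beta> where \<beta>: "\<beta> \<in> a" "\<And>Z. Z \<in> a \<Longrightarrow> s \<beta> Z = y \<bullet> Z"
    using s_representable [OF subspace_a ap, of "(\<bullet>) y"] by (auto simp: inner_add_right)
  have sy: "s Z \<beta> = y \<bullet> Z" if "Z \<in> a" for Z
    using \<beta> that s_sym [of Z \<beta>] a_subset_p by simp
  have le: "l i \<beta> \<le> c" for i
    using y [of "wt i"] sy [OF wt_in_a] s_wt [OF \<beta>(1)] onb_nonzero [OF onb] by (auto simp: moment_polytope_mu)
  have "c \<in> range (\<lambda>i. l i \<beta>)"
  proof (rule ccontr)
    assume "c \<notin> range (\<lambda>i. l i \<beta>)"
    then have lt: "l i \<beta> < c" for i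
      using le [of i] by (force simp: less_le)
    obtain x where "x \<in> F"
      using F by (auto simp: nonempty_faces_def)
    then obtain u where u: "\<And>i. 0 \<le> u i" "sum u UNIV = 1" "x = (\<Sum>i\<in>UNIV. u i *\<^sub>R wt i)"
      by (auto simp: Fy moment_polytope_combinations)
    have "c = s x \<beta>"
      using \<open>x \<in> F\<close> sy moment_polytope_subset_a by (auto simp: Fy)
    also have "\<dots> = (\<Sum>i\<in>UNIV. u i * l i \<beta>)"
      by (simp add: u(3) s_combination [OF \<beta>(1)])
    finally have "(\<Sum>i\<in>UNIV. u i * (c - l i \<beta>)) = 0"
      by (simp add: right_diff_distrib sum_subtractf sum_distrib_right [symmetric] u(2))
    then have "u i * (c - l i \<beta>) = 0" for i
      using u(1) le by (subst (asm) sum_nonneg_eq_0_iff) auto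
    then have "u i = 0" for i
      using lt [of i] by (metis less_irrefl mult_eq_0_iff right_minus_eq)
    then show False
      using u(2) by simp
  qed
  then have "top_weight \<beta> c"
    using le by (simp add: top_weight_def)
  moreover have "F = {x \<in> moment_polytope. s x \<beta> = c}"
    unfolding Fy using sy moment_polytope_subset_a by auto
  ultimately show thesis
    using that \<beta>(1) by blast
qed

lemma face_space_parabolic:
  assumes F: "F \<in> nonempty_faces moment_polytope"
  shows "\<exists>\<beta>\<in>a. acts_irreducibly (parabolic G \<beta>) (face_space F)"
proof -
  obtain \<beta> c where \<beta>: "\<beta> \<in> a" "top_weight \<beta> c" "F = {x \<in> moment_polytope. s x \<beta> = c}"
    using face_is_exposed [OF F] by blast
  then have "acts_irreducibly (parabolic G \<beta>) (face_space F)"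
    unfolding \<beta>(3) face_space_exposed [OF \<beta>(1,2)]
    by (subst parabolic_acts_irreducibly_iff [OF a_subset_p onb weight]) (auto simp: top_weight_def)
  then show ?thesis
    using \<beta>(1) by blast
qed

lemma face_space_invariant:
  assumes F: "F \<in> nonempty_faces moment_polytope" and "Z \<in> a" "v \<in> face_space F"
  shows "vec.subspace (face_space F)" "Z *v v \<in> face_space F"
proof -
  obtain \<beta> c where \<beta>: "\<beta> \<in> a" "top_weight \<beta> c" "F = {x \<in> moment_polytope. s x \<beta> = c}"
    using face_is_exposed [OF F] by blast
  have eq: "face_space F = {v. \<beta> *v v = c *\<^sub>R v}"
    unfolding \<beta>(3) face_space_exposed [OF \<beta>(1,2)] ..
  have "\<beta> *v (Z *v v) = Z *v (\<beta> *v v)"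
    by (simp add: matrix_vector_mul_assoc a_commute [OF \<beta>(1) assms(2)])
  then show "Z *v v \<in> face_space F"
    using assms(3) by (simp add: eq matrix_vector_scaleR_right)
  show "vec.subspace (face_space F)"
    unfolding eq by (rule subspace_eigenspace)
qed

text \<open>The element \<open>k\<close> need not normalise \<open>a\<close>, but \<open>a\<close> and its conjugate by \<open>k\<close> both preserve the
  space of \<open>F'\<close>. They are conjugate by some \<open>j\<close> in the stabiliser of that space, and \<open>j ** k\<close>
  normalises \<open>a\<close> and still maps one face space to the other.\<close>

lemma faces_conjugate:
  assumes F: "F \<in> nonempty_faces moment_polytope" and F': "F' \<in> nonempty_faces moment_polytope"
    and k: "k \<in> K" "face_space F' = (*v) k ` face_space F"
  shows "\<exists>n\<in>N. F' = conj_by n ` F"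
proof -
  have sub: "vec.subspace (face_space F')"
    using face_space_invariant(1) [OF F' subspace_0 [OF subspace_a], of 0] by (simp add: face_space_def)
  have ka: "Z *v w \<in> face_space F'" if Z: "Z \<in> conj_by k ` a" and w: "w \<in> face_space F'" for Z w
  proof -
    obtain Y v where Y: "Y \<in> a" "Z = conj_by k Y" "v \<in> face_space F" "w = k *v v"
      using Z w k(2) by auto
    then show ?thesis
      using face_space_invariant(2) [OF F Y(1,3)] k(2) by (auto simp: conj_by_vector matrix_inv_K_vector [OF k(1)])
  qed
  obtain j where j: "j \<in> K" "\<And>w. w \<in> face_space F' \<Longrightarrow> j *v w \<in> face_space F'" "conj_by j ` conj_by k ` a = a"
    using maximal_abelian_conjugate [OF maximal_abelian face_space_invariant(2) [OF F']
      maximal_abelian_conj_by [OF k(1) maximal_abelian] ka sub] by blast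
  have n: "j ** k \<in> N"
    using j k by (simp add: N_iff K_mult conj_by_comp image_image)
  have "face_space (conj_by (j ** k) ` F) = (*v) j ` (*v) k ` face_space F"
    unfolding face_space_conj_by [OF n] by (simp add: image_image matrix_vector_mul_assoc)
  also have "\<dots> = face_space F'"
    unfolding k(2) [symmetric] using matrix_inv_K [OF j(1)] by (intro invertible_matrix_image_eq sub j)
  finally have eq: "face_space (conj_by (j ** k) ` F) = face_space F'" .
  have FP: "F \<subseteq> moment_polytope" "F' \<subseteq> moment_polytope"
    using F F' by (auto simp: nonempty_faces_def dest: face_of_imp_subset)
  have "conj_by (j ** k) ` F \<subseteq> moment_polytope"
  proof
    fix x assume "x \<in> conj_by (j ** k) ` F"
    then obtain v where "v \<noteq> 0" "x = conj_by (j ** k) (mu v)"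
      using FP by (auto simp: moment_polytope_mu)
    then have "x = mu ((j ** k) *v v)" "(j ** k) *v v \<noteq> 0"
      using mu_equivariant [OF n] matrix_K_nonzero [of "j ** k" v] n by (simp_all add: N_iff)
    then show "x \<in> moment_polytope"
      unfolding moment_polytope_mu by blast
  qed
  then have "conj_by (j ** k) ` F = F'"
    using face_mu_face_space [of "conj_by (j ** k) ` F"] face_mu_face_space [OF FP(2)] eq by simp
  then show ?thesis
    using n by blast
qed

text \<open>Conjugate \<open>\<beta>\<close> into \<open>a\<close>; its top eigenspace is moved to the space of the face exposed by the conjugate.\<close>

lemma parabolic_irrep_from_face:
  assumes \<beta>: "\<beta> \<in> p" and W: "acts_irreducibly (parabolic G \<beta>) W"
  shows "\<exists>F\<in>nonempty_faces moment_polytope. \<exists>k\<in>K. W = (*v) k ` face_space F"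
proof -
  obtain b' m where b': "hermitian.onb h b'" and m: "\<And>i. \<beta> *v b' i = m i *\<^sub>R b' i"
    using selfadj_eigenbasis [OF p_selfadj [OF \<beta>]] by blast
  define c where "c = Max (range m)"
  have c: "c \<in> range m" "\<And>i. m i \<le> c"
    unfolding c_def by (intro Max_in) auto
  have W: "W = {v. \<beta> *v v = c *\<^sub>R v}"
    using parabolic_acts_irreducibly_iff [OF \<beta> b' m c] W by blast
  obtain k where k: "k \<in> K" "conj_by k \<beta> \<in> a"
    using conj_into_maximal_abelian [OF maximal_abelian _ \<beta>, of UNIV] by auto
  let ?\<beta> = "conj_by k \<beta>"
  have eig: "?\<beta> *v (k *v v) = r *\<^sub>R (k *v v) \<longleftrightarrow> \<beta> *v v = r *\<^sub>R v" for v r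
  proof
    assume "?\<beta> *v (k *v v) = r *\<^sub>R (k *v v)"
    then have "conj_by (matrix_inv k) ?\<beta> *v (matrix_inv k *v (k *v v)) = r *\<^sub>R (matrix_inv k *v (k *v v))"
      by (rule conj_by_eigenvector [OF matrix_inv_K(1) [OF k(1)]])
    then show "\<beta> *v v = r *\<^sub>R v"
      by (simp add: conj_by_inverse matrix_inv_K_vector k(1))
  qed (rule conj_by_eigenvector [OF k(1)])
  have "top_weight ?\<beta> c"
    unfolding top_weight_def
  proof (intro conjI allI)
    obtain i where i: "c = m i"
      using c by auto
    have "?\<beta> *v (k *v b' i) = c *\<^sub>R (k *v b' i)"
      using m [of i] by (simp add: eig i)
    moreover have "k *v b' i \<noteq> 0"
      by (rule matrix_K_nonzero [OF k(1) onb_nonzero [OF b']])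
    then obtain j where "h (k *v b' i) (b j) \<noteq> 0"
      using onb_ext [OF onb, of "k *v b' i" 0] by (auto simp: h_simps)
    ultimately have "l j ?\<beta> = c"
      using eigenvector_iff_coefficients [OF a_selfadj [OF k(2)] onb weight [OF k(2)], of "k *v b' i" c] by simp
    then show "c \<in> range (\<lambda>i. l i ?\<beta>)"
      by auto
    fix i
    have "\<beta> *v (matrix_inv k *v b i) = l i ?\<beta> *\<^sub>R (matrix_inv k *v b i)"
      using eig [of "matrix_inv k *v b i" "l i ?\<beta>"] weight [OF k(2), of i] by (simp add: matrix_inv_K_vector k(1))
    moreover have "matrix_inv k *v b i \<noteq> 0"
      by (rule matrix_K_nonzero [OF matrix_inv_K(1) [OF k(1)] onb_nonzero [OF onb]])
    then obtain j where "h (matrix_inv k *v b i) (b' j) \<noteq> 0"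
      using onb_ext [OF b', of "matrix_inv k *v b i" 0] by (auto simp: h_simps)
    ultimately have "m j = l i ?\<beta>"
      using eigenvector_iff_coefficients [OF p_selfadj [OF \<beta>] b' m, of "matrix_inv k *v b i" "l i ?\<beta>"] by simp
    then show "l i ?\<beta> \<le> c"
      using c(2) [of j] by simp
  qed
  note top = this
  have "W = (*v) (matrix_inv k) ` {v. ?\<beta> *v v = c *\<^sub>R v}"
  proof (intro equalityI subsetI)
    fix w assume "w \<in> W"
    then have "k *v w \<in> {v. ?\<beta> *v v = c *\<^sub>R v}"
      by (simp add: W eig)
    moreover have "w = matrix_inv k *v (k *v w)"
      by (simp add: matrix_inv_K_vector k(1))
    ultimately show "w \<in> (*v) (matrix_inv k) ` {v. ?\<beta> *v v = c *\<^sub>R v}"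
      by blast
  next
    fix w assume "w \<in> (*v) (matrix_inv k) ` {v. ?\<beta> *v v = c *\<^sub>R v}"
    then obtain v where v: "w = matrix_inv k *v v" "?\<beta> *v v = c *\<^sub>R v"
      by auto
    then show "w \<in> W"
      using eig [of w c] by (simp add: W matrix_inv_K_vector k(1))
  qed
  then show ?thesis
    using exposed_is_face [OF k(2) top] face_space_exposed [OF k(2) top] matrix_inv_K(1) [OF k(1)] by blast
qed

lemma equiv_irrep_equiv: "equiv (parabolic_irreps G p) (irrep_equiv G K p)"
proof (rule equivI)
  show "irrep_equiv G K p \<subseteq> parabolic_irreps G p \<times> parabolic_irreps G p"
    by (auto simp: irrep_equiv_def)
  show "refl_on (parabolic_irreps G p) (irrep_equiv G K p)"
    by (rule refl_onI) (auto simp: irrep_equiv_def intro!: bexI [of _ "mat 1"] K_one)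
  show "sym (irrep_equiv G K p)"
  proof (rule symI, clarify)
    fix Q W Q' W' assume "((Q, W), (Q', W')) \<in> irrep_equiv G K p"
    then obtain k where k: "k \<in> K" "W' = (*v) k ` W" "(Q, W) \<in> parabolic_irreps G p" "(Q', W') \<in> parabolic_irreps G p"
      by (auto simp: irrep_equiv_def)
    have "W = (*v) (matrix_inv k) ` W'"
      by (simp add: k(2) image_image matrix_vector_mul_assoc matrix_inv_K k(1))
    then show "((Q', W'), (Q, W)) \<in> irrep_equiv G K p"
      using k matrix_inv_K(1) [OF k(1)] by (auto simp: irrep_equiv_def)
  qed
  show "trans (irrep_equiv G K p)"
  proof (rule transI, clarify)
    fix Q W Q' W' Q'' W''
    assume "((Q, W), (Q', W')) \<in> irrep_equiv G K p" "((Q', W'), (Q'', W'')) \<in> irrep_equiv G K p"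
    then obtain k j where "k \<in> K" "j \<in> K" "W' = (*v) k ` W" "W'' = (*v) j ` W'"
      "(Q, W) \<in> parabolic_irreps G p" "(Q'', W'') \<in> parabolic_irreps G p"
      by (auto simp: irrep_equiv_def)
    then show "((Q, W), (Q'', W'')) \<in> irrep_equiv G K p"
      by (auto simp: irrep_equiv_def image_image matrix_vector_mul_assoc intro!: bexI [of _ "j ** k"] K_mult)
  qed
qed

text \<open>By the preceding lemmas the assignment of \<open>face_space F\<close> to \<open>F\<close> respects and reflects the two
  equivalences and meets every class. The choice of an exposing element for each face does not affect
  the class, which depends on the subspace only.\<close>

theorem faces_irreps_bijection:
  "\<exists>f. bij_betw f (faces_mod_weyl K a moment_polytope) (parabolic_irreps G p // irrep_equiv G K p)"
  unfolding faces_mod_weyl_def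
proof -
  define B where "B F = (SOME \<beta>. \<beta> \<in> a \<and> acts_irreducibly (parabolic G \<beta>) (face_space F))" for F
  have B: "B F \<in> a" "acts_irreducibly (parabolic G (B F)) (face_space F)" if "F \<in> nonempty_faces moment_polytope" for F
  proof -
    have "B F \<in> a \<and> acts_irreducibly (parabolic G (B F)) (face_space F)"
      unfolding B_def by (rule someI_ex) (use face_space_parabolic [OF that] in blast)
    then show "B F \<in> a" "acts_irreducibly (parabolic G (B F)) (face_space F)"
      by auto
  qed
  define r where "r F = (parabolic G (B F), face_space F)" for F
  have rX: "r F \<in> parabolic_irreps G p" if "F \<in> nonempty_faces moment_polytope" for F
    using B [OF that] a_subset_p by (auto simp: r_def parabolic_irreps_def)
  have Fa: "F \<subseteq> a" if "F \<in> nonempty_faces moment_polytope" for F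
    using that by (intro order_trans [OF face_of_imp_subset moment_polytope_subset_a]) (simp add: nonempty_faces_def)
  show "\<exists>f. bij_betw f ((\<lambda>F. (\<lambda>w. weyl_act w F) ` weyl_group K a) ` nonempty_faces moment_polytope)
      (parabolic_irreps G p // irrep_equiv G K p)"
  proof (rule bij_betw_orbits_quotient [OF equiv_irrep_equiv, where r = r])
    fix F F' assume F: "F \<in> nonempty_faces moment_polytope" "F' \<in> nonempty_faces moment_polytope"
    have "(\<exists>k\<in>N. F' = conj_by k ` F) \<longleftrightarrow> (\<exists>k\<in>K. face_space F' = (*v) k ` face_space F)"
      using faces_conjugate [OF F] face_space_conj_by by (metis N_iff)
    then show "(\<lambda>w. weyl_act w F) ` weyl_group K a = (\<lambda>w. weyl_act w F') ` weyl_group K a \<longleftrightarrow>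
        (r F, r F') \<in> irrep_equiv G K p"
      using weyl_orbit_eq_iff [OF Fa Fa] F rX [OF F(1)] rX [OF F(2)] by (simp add: r_def irrep_equiv_def)
  next
    fix x assume x: "x \<in> parabolic_irreps G p"
    then obtain \<beta> W where W: "\<beta> \<in> p" "x = (parabolic G \<beta>, W)" "acts_irreducibly (parabolic G \<beta>) W"
      by (auto simp: parabolic_irreps_def)
    then obtain F k where "F \<in> nonempty_faces moment_polytope" "k \<in> K" "W = (*v) k ` face_space F"
      using parabolic_irrep_from_face by blast
    then show "\<exists>F\<in>nonempty_faces moment_polytope. (r F, x) \<in> irrep_equiv G K p"
      using rX x W(2) by (auto simp: r_def irrep_equiv_def)
  qed (rule rX)
qed

end

section \<open>Connected Lie groups and irreducibility\<close>

lemma finite_union_interior_empty: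
  assumes "finite I" "\<And>i. i \<in> I \<Longrightarrow> closed (S i)" "\<And>i. i \<in> I \<Longrightarrow> interior (S i) = {}"
  shows "interior (\<Union>i\<in>I. S i) = {}"
  using assms
proof (induction I rule: finite_induct)
  case (insert i I)
  then have "interior (S i \<union> (\<Union>i\<in>I. S i)) = interior (S i)"
    by (intro interior_closed_Un_empty_interior) auto
  then show ?case
    using insert by simp
qed simp

locale connected_lie_group_rep =
  fixes G :: "'g::{t2_space,second_countable_topology} monoid" (structure)
    and A :: "('g, 'e::euclidean_space) chart set"
    and c :: "('g, 'e) chart"
    and \<tau> :: "'g \<Rightarrow> complex^'n^'n"
  assumes lie: "lie_group G A" and conn: "connected (UNIV :: 'g set)"
    and chart: "c \<in> A" "\<one> \<in> fst c"
    and rep: "irreducible_SL_representation G A \<tau>"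
begin

lemma is_group: "group G" and carrier_UNIV: "carrier G = UNIV"
  using lie by (auto simp: lie_group_def)

lemma mult_inv [simp]:
  "x \<otimes> inv x = \<one>" "inv x \<otimes> x = \<one>"
  "\<one> \<otimes> x = x" "x \<otimes> \<one> = x"
  "inv (inv x) = x"
  "inv x \<otimes> (x \<otimes> y) = y" "x \<otimes> (inv x \<otimes> y) = y"
  "inv \<one> = \<one>" "inv (x \<otimes> y) = inv y \<otimes> inv x"
  "(y \<otimes> inv x) \<otimes> x = y"
proof -
  interpret group G
    by (rule is_group)
  have c: "x \<in> carrier G" "y \<in> carrier G"
    by (simp_all add: carrier_UNIV)
  have assoc: "u \<otimes> v \<otimes> w = u \<otimes> (v \<otimes> w)" for u v w
    by (rule m_assoc) (simp_all add: carrier_UNIV)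
  show 1: "x \<otimes> inv x = \<one>" "inv x \<otimes> x = \<one>"
    "\<one> \<otimes> x = x" "x \<otimes> \<one> = x"
    "inv (inv x) = x" "inv \<one> = \<one>"
    "inv (x \<otimes> y) = inv y \<otimes> inv x"
    using c by (simp_all add: inv_mult_group)
  show "inv x \<otimes> (x \<otimes> y) = y" "x \<otimes> (inv x \<otimes> y) = y"
    using c by (simp_all add: assoc [symmetric])
  show "(y \<otimes> inv x) \<otimes> x = y"
    using c by (simp add: assoc)
qed

lemma continuous_mult:
  "continuous_on S f \<Longrightarrow> continuous_on S g \<Longrightarrow> continuous_on S (\<lambda>x. f x \<otimes> g x)"
proof -
  assume fg: "continuous_on S f" "continuous_on S g"
  have "continuous_on UNIV (\<lambda>(x, y). x \<otimes> y)"
    using lie by (simp add: lie_group_def smooth_map_def)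
  from continuous_on_compose2 [OF this continuous_on_Pair [OF fg]] show ?thesis
    by simp
qed

lemma continuous_inv: "continuous_on UNIV (\<lambda>x. inv x)"
  using lie by (simp add: lie_group_def smooth_map_def)

text \<open>An open subgroup is closed, its complement being a union of cosets.\<close>

lemma open_subgroup_eq_UNIV:
  assumes mult: "\<And>x y. x \<in> H \<Longrightarrow> y \<in> H \<Longrightarrow> x \<otimes> y \<in> H" and inv: "\<And>x. x \<in> H \<Longrightarrow> inv x \<in> H"
    and U: "open U" "\<one> \<in> U" "U \<subseteq> H"
  shows "H = UNIV"
proof -
  have nb: "open {y. inv x \<otimes> y \<in> U}" for x
  proof -
    have "continuous_on UNIV (\<lambda>y. inv x \<otimes> y)"
      by (intro continuous_mult continuous_intros)
    from open_vimage [OF U(1) this] show ?thesis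
      by (simp add: vimage_def)
  qed
  have 1: "open H"
  proof (subst open_subopen, intro ballI)
    fix x assume "x \<in> H"
    have "{y. inv x \<otimes> y \<in> U} \<subseteq> H"
    proof clarify
      fix y assume "inv x \<otimes> y \<in> U"
      then have "x \<otimes> (inv x \<otimes> y) \<in> H"
        using U(3) \<open>x \<in> H\<close> mult by blast
      then show "y \<in> H"
        by simp
    qed
    then show "\<exists>T. open T \<and> x \<in> T \<and> T \<subseteq> H"
      using nb [of x] U(2) by (intro exI [of _ "{y. inv x \<otimes> y \<in> U}"]) simp
  qed
  have 2: "open (- H)"
  proof (subst open_subopen, intro ballI)
    fix x assume x: "x \<in> - H"
    have "{y. inv x \<otimes> y \<in> U} \<subseteq> - H"
    proof (clarify)
      fix y assume "inv x \<otimes> y \<in> U" "y \<in> H"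
      then have "y \<otimes> inv (inv x \<otimes> y) \<in> H"
        using U(3) mult inv by blast
      then show False
        using x by simp
    qed
    then show "\<exists>T. open T \<and> x \<in> T \<and> T \<subseteq> - H"
      using nb [of x] U(2) by (intro exI [of _ "{y. inv x \<otimes> y \<in> U}"]) simp
  qed
  show ?thesis
    using connectedD [OF conn 1 2] U by auto
qed

lemma rep_mult: "\<tau> (x \<otimes> y) = \<tau> x ** \<tau> y"
  and rep_det: "det (\<tau> x) = 1"
  and rep_irreducible: "acts_irreducibly (range \<tau>) UNIV"
  and rep_continuous: "continuous_on UNIV \<tau>"
  using rep by (auto simp: irreducible_SL_representation_def carrier_UNIV smooth_map_def)

lemma rep_one: "\<tau> \<one> = mat 1"
proof -
  have "invertible (\<tau> \<one>)"
    by (simp add: invertible_det_nz rep_det)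
  then obtain B where B: "B ** \<tau> \<one> = mat 1"
    by (auto simp: invertible_def)
  have "\<tau> \<one> = B ** \<tau> \<one> ** \<tau> \<one>"
    by (simp add: B)
  also have "\<dots> = B ** (\<tau> \<one> ** \<tau> \<one>)"
    by (simp only: matrix_mul_assoc)
  also have "\<dots> = mat 1"
    using rep_mult [of "\<one>" "\<one>"] by (simp add: B)
  finally show ?thesis .
qed

lemma rep_inv: "\<tau> x ** \<tau> (inv x) = mat 1" "\<tau> (inv x) ** \<tau> x = mat 1"
  by (simp_all add: rep_mult [symmetric] rep_one)

lemma locally_invariant_subspace:
  assumes S: "vec.subspace S" and U: "open U" "\<one> \<in> U" "\<And>x u. x \<in> U \<Longrightarrow> u \<in> S \<Longrightarrow> \<tau> x *v u \<in> S"
  shows "S = {0} \<or> S = UNIV"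
proof -
  define H where "H = {x. (\<forall>u\<in>S. \<tau> x *v u \<in> S) \<and> (\<forall>u\<in>S. \<tau> (inv x) *v u \<in> S)}"
  have "H = UNIV"
  proof (rule open_subgroup_eq_UNIV)
    show "x \<otimes> y \<in> H" if "x \<in> H" "y \<in> H" for x y
      using that by (simp add: H_def rep_mult flip: matrix_vector_mul_assoc)
    show "inv x \<in> H" if "x \<in> H" for x
      using that by (simp add: H_def)
    show "open (U \<inter> (\<lambda>x. inv x) -` U)"
      by (intro open_Int U open_vimage continuous_inv)
    show "\<one> \<in> U \<inter> (\<lambda>x. inv x) -` U"
      using U(2) by simp
    show "U \<inter> (\<lambda>x. inv x) -` U \<subseteq> H"
      using U(3) by (auto simp: H_def)
  qed
  then have "preserves (range \<tau>) S"
    by (auto simp: H_def preserves_def)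
  then show ?thesis
    using rep_irreducible S by (auto simp: acts_irreducibly_def)
qed

text \<open>One of the closed sets \<open>R (W i) = {x. \<tau> x *v v0 \<in> W i}\<close>, which would cover the group, has interior points.
  Let \<open>U\<close> be a subspace of least dimension for which \<open>R U\<close> has interior points. For \<open>k\<close>
  near the identity \<open>R U\<close> and its translate by \<open>k\<close> overlap in an open set, so \<open>U\<close> cannot be
  larger than the subspace of vectors that \<open>\<tau> k\<close> keeps in \<open>U\<close>. Hence \<open>U\<close> is invariant
  near the identity, which contradicts irreducibility.\<close>

lemma generic_orbit_point:
  assumes v0: "v0 \<noteq> 0" and W: "\<And>i :: 'i :: finite. vec.subspace (W i)" "\<And>i. W i \<noteq> UNIV"
  shows "\<exists>x. \<forall>i. \<tau> x *v v0 \<notin> W i"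
proof (rule ccontr)
  assume contra: "\<not> (\<exists>x. \<forall>i. \<tau> x *v v0 \<notin> W i)"
  define R where "R U = {x. \<tau> x *v v0 \<in> U}" for U
  have closed: "closed (R U)" if "vec.subspace U" for U
  proof -
    have "closed ((\<lambda>x. \<tau> x *v v0) -` U)"
      by (intro closed_vimage closed_subspace vec_subspace_imp_subspace that
          matrix_vector_mult_continuous_on rep_continuous continuous_on_const)
    then show ?thesis
      by (simp add: R_def vimage_def)
  qed
  have "\<exists>i. interior (R (W i)) \<noteq> {}"
  proof (rule ccontr)
    assume "\<not> (\<exists>i. interior (R (W i)) \<noteq> {})"
    then have "interior (\<Union>i. R (W i)) = {}"
      using closed W(1) by (intro finite_union_interior_empty) auto
    moreover have "(\<Union>i. R (W i)) = UNIV"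
      using contra by (auto simp: R_def)
    ultimately show False
      by simp
  qed
  then obtain i where i: "interior (R (W i)) \<noteq> {}"
    by blast
  let ?P = "\<lambda>U. vec.subspace U \<and> interior (R U) \<noteq> {}"
  have "?P (W i)"
    using W(1) i by simp
  from ex_has_least_nat [where P = ?P and m = vec.dim, OF this]
  obtain U where U: "vec.subspace U" "interior (R U) \<noteq> {}"
    and min: "\<And>U'. ?P U' \<Longrightarrow> vec.dim U \<le> vec.dim U'"
    by auto
  obtain g where g: "g \<in> interior (R U)"
    using U(2) by blast
  define V where "V = {k. inv k \<otimes> g \<in> interior (R U)}"
  have "S = {0} \<or> S = UNIV" if "S = U" for S
  proof (rule locally_invariant_subspace [of S V])
    show "vec.subspace S"
      using U that by simp
    have "continuous_on UNIV (\<lambda>k. inv k \<otimes> g)"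
      by (intro continuous_mult continuous_inv continuous_on_const)
    from open_vimage [OF open_interior this] show "open V"
      by (simp add: V_def vimage_def)
    show "\<one> \<in> V"
      using g by (simp add: V_def)
    fix k u assume k: "k \<in> V" and u: "u \<in> S"
    define U' where "U' = {w \<in> U. \<tau> k *v w \<in> U}"
    have sub: "vec.subspace U'"
      using U(1) by (auto simp: U'_def vec.subspace_def matrix_vector_right_distrib vector_scalar_commute)
    define T where "T = interior (R U) \<inter> (\<lambda>x. k \<otimes> x) -` interior (R U)"
    have "open T"
      unfolding T_def by (intro open_Int open_interior open_vimage continuous_mult continuous_on_const continuous_on_id)
    moreover have "T \<subseteq> R U'"
      using interior_subset [of "R U"]
      by (auto simp: T_def R_def U'_def rep_mult matrix_vector_mul_assoc)
    moreover have "inv k \<otimes> g \<in> T"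
      using k g by (simp add: T_def V_def)
    ultimately have "interior (R U') \<noteq> {}"
      using interiorI by blast
    then have "vec.dim U \<le> vec.dim U'"
      using min sub by blast
    then have "U' = U"
      using sub U(1) by (intro vec.subspace_dim_equal) (auto simp: U'_def)
    then show "\<tau> k *v u \<in> S"
      using u that by (auto simp: U'_def)
  qed
  then consider "U = {0}" | "U = UNIV"
    by blast
  then show False
  proof cases
    case 1
    have "\<tau> g *v v0 = 0"
      using g interior_subset [of "R U"] by (auto simp: R_def 1)
    then have "\<tau> (inv g) *v (\<tau> g *v v0) = 0"
      by simp
    then show False
      using v0 by (simp add: matrix_vector_mul_assoc rep_inv)
  next
    case 2
    have "W i = UNIV"
      using min [OF \<open>?P (W i)\<close>] by (intro vec.subspace_dim_equal W(1)) (auto simp: 2)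
    then show False
      using W(2) by blast
  qed
qed

abbreviation \<phi> :: "'e \<Rightarrow> complex^'n^'n" where
  "\<phi> \<equiv> \<tau> \<circ> chart_inv c"

lemma chart_facts:
  shows "open (fst c)" "open (snd c ` fst c)" "continuous_on (fst c) (snd c)"
    "continuous_on (snd c ` fst c) (chart_inv c)" "\<And>x. x \<in> fst c \<Longrightarrow> chart_inv c (snd c x) = x"
  using lie chart by (auto simp: lie_group_def smooth_atlas_def homeomorphism_def)

lemma rep_chart_C1:
  assumes "x \<in> snd c ` fst c"
  shows "(\<phi> has_derivative frechet_derivative \<phi> (at x)) (at x)"
    and "continuous_on (snd c ` fst c) (\<lambda>x. frechet_derivative \<phi> (at x) v)"
proof -
  have "Ck (Suc 0) (snd c ` fst c) \<phi>"
    using rep chart unfolding irreducible_SL_representation_def smooth_map_def smooth_on_def by fastforce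
  then have "\<phi> differentiable_on (snd c ` fst c)"
    and cont: "continuous_on (snd c ` fst c) (\<lambda>x. frechet_derivative \<phi> (at x) v)"
    by auto
  then have "\<phi> differentiable (at x)"
    using assms chart_facts(2) by (metis at_within_open differentiable_on_def)
  then show "(\<phi> has_derivative frechet_derivative \<phi> (at x)) (at x)"
    by (simp add: frechet_derivative_works)
  show "continuous_on (snd c ` fst c) (\<lambda>x. frechet_derivative \<phi> (at x) v)"
    by (rule cont)
qed

lemma linear_rep_derivative: "linear (rep_derivative G c \<tau>)"
  using rep_chart_C1(1) [of "snd c \<one>"] chart has_derivative_linear
  by (auto simp: rep_derivative_def)

end

locale compatible_lie_group_rep = connected_lie_group_rep G A c \<tau> + polar_group h "range \<tau>" K p
  for G :: "'g::{t2_space,second_countable_topology} monoid" (structure)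
    and A :: "('g, 'e::euclidean_space) chart set"
    and c :: "('g, 'e) chart"
    and \<tau> :: "'g \<Rightarrow> complex^'n^'n"
    and h :: "complex^'n \<Rightarrow> complex^'n \<Rightarrow> complex"
    and K p
begin

text \<open>Outside the range of the chart \<open>chart_inv\<close> still takes values in the group, so the straight line in the chart
  gives a curve in \<open>range \<tau>\<close> defined for all times; translating it to the identity on the right yields a velocity.\<close>

lemma derivative_in_tangent:
  assumes x: "x \<in> snd c ` fst c"
  shows "frechet_derivative \<phi> (at x) v ** \<tau> (inv (chart_inv c x)) \<in> tangent"
proof (rule tangentI)
  show "\<phi> (x + t *\<^sub>R v) ** \<tau> (inv (chart_inv c x)) \<in> range \<tau>" for t
    by (simp add: rep_mult [symmetric])
  show "\<phi> (x + 0 *\<^sub>R v) ** \<tau> (inv (chart_inv c x)) = mat 1"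
    by (simp add: rep_inv)
  have "(\<phi> has_derivative frechet_derivative \<phi> (at x)) (at (x + 0 *\<^sub>R v))"
    using rep_chart_C1(1) [OF x] by simp
  moreover have "((\<lambda>t. x + t *\<^sub>R v) has_derivative (\<lambda>t. t *\<^sub>R v)) (at 0)"
    by (auto intro!: derivative_eq_intros)
  ultimately have "((\<lambda>t. \<phi> (x + t *\<^sub>R v)) has_derivative (\<lambda>t. frechet_derivative \<phi> (at x) (t *\<^sub>R v))) (at 0)"
    by (rule has_derivative_compose [rotated])
  then have d: "((\<lambda>t. \<phi> (x + t *\<^sub>R v)) has_vector_derivative frechet_derivative \<phi> (at x) v) (at 0)"
    using linear_scale [OF has_derivative_linear [OF rep_chart_C1(1) [OF x]]]
    by (simp add: has_vector_derivative_def)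
  show "((\<lambda>t. \<phi> (x + t *\<^sub>R v) ** \<tau> (inv (chart_inv c x))) has_vector_derivative
      frechet_derivative \<phi> (at x) v ** \<tau> (inv (chart_inv c x))) (at 0)"
    using matrix_mult_derivative [OF d has_vector_derivative_const [of "\<tau> (inv (chart_inv c x))"]] by simp
qed

text \<open>Let \<open>\<pi>\<close> be a projection with kernel \<open>S\<close> and \<open>u \<in> S\<close>. The function \<open>f x = \<pi> (\<phi> x *v u)\<close> vanishes at
  the point that represents the identity. Its derivative is \<open>\<pi> (Y *v (\<phi> x *v u))\<close> with \<open>Y\<close> in the Lie
  algebra, and as \<open>Y\<close> preserves \<open>S\<close> it is bounded by a multiple of \<open>f x\<close> itself. On a ball of small
  radius \<open>\<rho>\<close>, independent of \<open>u\<close>, this forces \<open>f = 0\<close>, so \<open>S\<close> is invariant near the identity.\<close>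

lemma tangent_invariant_subspace:
  assumes S: "vec.subspace S" and inv: "\<And>X u. X \<in> tangent \<Longrightarrow> u \<in> S \<Longrightarrow> X *v u \<in> S"
  shows "S = {0} \<or> S = UNIV"
proof -
  obtain \<sigma> where \<sigma>: "bounded_linear \<sigma>" "\<And>w. \<sigma> w \<in> S" "\<And>w. w \<in> S \<Longrightarrow> \<sigma> w = w"
    using subspace_projection [OF vec_subspace_imp_subspace [OF S]] by blast
  define \<pi> where "\<pi> w = w - \<sigma> w" for w
  have \<pi>: "bounded_linear \<pi>" "\<And>w. \<pi> w = 0 \<longleftrightarrow> w \<in> S" "\<And>w. w - \<pi> w \<in> S"
    unfolding \<pi>_def using \<sigma>(2,3) by (auto intro: bounded_linear_sub \<sigma>(1)) metis
  let ?U = "snd c ` fst c"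
  define x0 where "x0 = snd c \<one>"
  have x0: "x0 \<in> ?U" "\<phi> x0 = mat 1"
    using chart chart_facts(5) by (auto simp: x0_def rep_one)
  obtain r where r: "r > 0" "cball x0 r \<subseteq> ?U"
    using chart_facts(2) x0(1) open_contains_cball by blast
  let ?D = "\<lambda>x v. frechet_derivative \<phi> (at x) v"
  have cball_ne: "cball x0 r \<noteq> {}"
    using r by simp
  have bound: "\<exists>C. \<forall>x\<in>cball x0 r. norm (f x) \<le> C"
    if "continuous_on ?U f" for f :: "'e \<Rightarrow> complex^'n^'n"
    using compact_imp_bounded [OF compact_continuous_image [OF continuous_on_subset [OF that r(2)] compact_cball]]
    by (auto simp: bounded_iff)
  have "\<exists>C. \<forall>x\<in>cball x0 r. norm (?D x e) \<le> C" for e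
    by (intro bound) (use rep_chart_C1(2) x0(1) in blast)
  then obtain CD where CD: "\<And>e x. x \<in> cball x0 r \<Longrightarrow> norm (?D x e) \<le> CD e"
    by metis
  have "\<exists>C. \<forall>x\<in>cball x0 r. norm (\<tau> (inv (chart_inv c x))) \<le> C"
    by (intro bound continuous_on_compose2 [OF rep_continuous] continuous_on_compose2 [OF continuous_inv]
        chart_facts subset_UNIV)
  then obtain CI where CI: "\<And>x. x \<in> cball x0 r \<Longrightarrow> norm (\<tau> (inv (chart_inv c x))) \<le> CI"
    by blast
  obtain CM where CM: "CM > 0" "\<And>X Y. norm ((X :: complex^'n^'n) ** (Y :: complex^'n^'n)) \<le> norm X * norm Y * CM"
    using bounded_bilinear.pos_bounded [OF bounded_bilinear_matrix_mult] by auto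
  obtain CV where CV: "CV > 0" "\<And>X v. norm ((X :: complex^'n^'n) *v v) \<le> norm X * norm v * CV"
    using bounded_bilinear.pos_bounded [OF bounded_bilinear_matrix_vector_mult] by auto
  obtain CP where CP: "CP > 0" "\<And>w. norm (\<pi> w) \<le> norm w * CP"
    using bounded_linear.pos_bounded [OF \<pi>(1)] by auto
  define E where "E = (\<Sum>e\<in>Basis. CD e)"
  have CD0: "CD e \<ge> 0" for e
    by (rule order_trans [OF norm_ge_zero CD [of x0]]) (use r(1) in simp)
  have CI0: "CI \<ge> 0"
    by (rule order_trans [OF norm_ge_zero CI [of x0]]) (use r(1) in simp)
  have E: "norm (?D x v) \<le> E * norm v" if x: "x \<in> cball x0 r" for x v
  proof -
    have lin: "linear (?D x)"
      by (rule has_derivative_linear [OF rep_chart_C1(1)]) (use x r in blast)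
    have "?D x v = (\<Sum>e\<in>Basis. (v \<bullet> e) *\<^sub>R ?D x e)"
      by (subst (1) euclidean_representation [of v, symmetric]) (simp add: linear_sum [OF lin] linear_scale [OF lin])
    also have "norm \<dots> \<le> (\<Sum>e\<in>Basis. norm v * CD e)"
      by (intro order_trans [OF norm_sum] sum_mono) (auto intro!: mult_mono CD x Basis_le_norm)
    finally show ?thesis
      by (simp add: E_def sum_distrib_left mult.commute)
  qed
  have E0: "E \<ge> 0"
    unfolding E_def by (intro sum_nonneg CD0)
  define M where "M = E * CI * CM * CV * CP"
  have M0: "M \<ge> 0"
    unfolding M_def using E0 CI0 CM CV CP by simp
  \<comment> \<open>the factor 2 makes the mean value estimate a contraction with constant 1/2\<close>
  define \<rho> where "\<rho> = min r (1 / (2 * (M + 1)))"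
  have \<rho>: "\<rho> > 0" "\<rho> \<le> r" "M * \<rho> \<le> 1 / 2"
  proof -
    show "\<rho> > 0" "\<rho> \<le> r"
      using r M0 by (auto simp: \<rho>_def)
    have "M * \<rho> \<le> M * (1 / (2 * (M + 1)))"
      using M0 by (intro mult_left_mono) (auto simp: \<rho>_def)
    also have "\<dots> \<le> 1 / 2"
      using M0 by (simp add: field_simps)
    finally show "M * \<rho> \<le> 1 / 2" .
  qed
  have ball: "cball x0 \<rho> \<subseteq> cball x0 r"
    using \<rho>(2) by auto
  have in_S: "\<phi> x *v u \<in> S" if u: "u \<in> S" and x: "x \<in> cball x0 \<rho>" for u x
  proof -
    define f where "f x = \<pi> (\<phi> x *v u)" for x
    have deriv: "(f has_derivative (\<lambda>v. \<pi> (?D x v *v u))) (at x within cball x0 \<rho>)" if "x \<in> cball x0 \<rho>" for x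
    proof -
      have "x \<in> ?U"
        using that ball r(2) by blast
      from has_derivative_at_withinI [OF rep_chart_C1(1) [OF this]]
      have "(\<phi> has_derivative ?D x) (at x within cball x0 \<rho>)" .
      from bounded_linear.has_derivative [OF bounded_linear_matrix_vector_left this]
      have "((\<lambda>x. \<phi> x *v u) has_derivative (\<lambda>v. ?D x v *v u)) (at x within cball x0 \<rho>)" .
      from bounded_linear.has_derivative [OF \<pi>(1) this] show ?thesis
        unfolding f_def [abs_def] .
    qed
    then have "continuous_on (cball x0 \<rho>) f"
      using has_derivative_continuous continuous_on_eq_continuous_within by blast
    then have "continuous_on (cball x0 \<rho>) (\<lambda>x. norm (f x))"
      by (rule continuous_on_norm)
    moreover have "x0 \<in> cball x0 \<rho>"
      using \<rho>(1) by simp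
    ultimately obtain y where y: "y \<in> cball x0 \<rho>" "\<And>x. x \<in> cball x0 \<rho> \<Longrightarrow> norm (f x) \<le> norm (f y)"
      using continuous_attains_sup [of "cball x0 \<rho>" "\<lambda>x. norm (f x)"] by auto
    have le: "norm (\<pi> (?D x v *v u)) \<le> M * norm (f y) * norm v" if x: "x \<in> cball x0 \<rho>" for x v
    proof -
      define Y where "Y = ?D x v ** \<tau> (inv (chart_inv c x))"
      define w where "w = \<phi> x *v u"
      have xr: "x \<in> cball x0 r"
        using x ball by blast
      have Yt: "Y \<in> tangent"
        unfolding Y_def by (rule derivative_in_tangent) (use xr r in blast)
      have "Y ** \<phi> x = ?D x v"
        by (simp add: Y_def rep_inv flip: matrix_mul_assoc)
      then have "?D x v *v u = Y *v w"
        by (simp add: w_def matrix_vector_mul_assoc)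
      also have "\<dots> = Y *v (w - \<pi> w) + Y *v \<pi> w"
        by (simp add: matrix_vector_mult_diff_distrib)
      finally have "\<pi> (?D x v *v u) = \<pi> (Y *v (w - \<pi> w)) + \<pi> (Y *v \<pi> w)"
        by (simp add: linear_add [OF bounded_linear.linear [OF \<pi>(1)]])
      also have "\<pi> (Y *v (w - \<pi> w)) = 0"
        using inv [OF Yt \<pi>(3)] \<pi>(2) by blast
      finally have "\<pi> (?D x v *v u) = \<pi> (Y *v \<pi> w)"
        unfolding add_0 .
      then have "norm (\<pi> (?D x v *v u)) \<le> norm (Y *v \<pi> w) * CP"
        by (simp only: CP(2))
      also have "\<dots> \<le> (norm Y * norm (\<pi> w) * CV) * CP"
        using CP(1) CV(2) by (intro mult_right_mono) auto
      also have "norm Y \<le> norm (?D x v) * norm (\<tau> (inv (chart_inv c x))) * CM"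
        unfolding Y_def by (rule CM(2))
      also have "\<dots> \<le> (E * norm v) * CI * CM"
        using CM(1) E [OF xr] CI [OF xr] E0 by (intro mult_right_mono mult_mono) auto
      finally have "norm (\<pi> (?D x v *v u)) \<le> ((E * norm v) * CI * CM) * norm (\<pi> w) * CV * CP"
        using CV(1) CP(1) by (simp add: mult_right_mono)
      also have "\<dots> = M * norm v * norm (f x)"
        by (simp add: M_def f_def w_def)
      also have "\<dots> \<le> M * norm v * norm (f y)"
        using y(2) [OF x] M0 by (intro mult_left_mono) auto
      finally show ?thesis
        by (simp add: mult_ac)
    qed
    have "norm (f y - f x0) \<le> M * norm (f y) * norm (y - x0)"
    proof (rule differentiable_bound [OF convex_cball deriv])
      show "onorm (\<lambda>v. \<pi> (?D x v *v u)) \<le> M * norm (f y)" if "x \<in> cball x0 \<rho>" for x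
        using le [OF that] by (intro onorm_le) auto
    qed (use y \<rho> in auto)
    moreover have "f x0 = 0"
      using u \<pi>(2) by (simp add: f_def x0 del: o_apply)
    moreover have "norm (y - x0) \<le> \<rho>"
      using y(1) by (simp add: dist_norm norm_minus_commute)
    moreover have "M * norm (f y) * norm (y - x0) \<le> M * norm (f y) * \<rho>"
      using M0 y(1) by (intro mult_left_mono) (auto simp: dist_norm norm_minus_commute)
    ultimately have "norm (f y) \<le> M * norm (f y) * \<rho>"
      by simp
    also have "\<dots> = (M * \<rho>) * norm (f y)"
      by simp
    also have "\<dots> \<le> (1 / 2) * norm (f y)"
      by (intro mult_right_mono \<rho>) auto
    finally have "norm (f y) = 0"
      by simp
    then have "f x = 0"
      using y(2) [OF x] by simp
    then show ?thesis
      using \<pi>(2) by (simp add: f_def)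
  qed
  show ?thesis
  proof (rule locally_invariant_subspace [OF S])
    show "open (fst c \<inter> snd c -` ball x0 \<rho>)"
      by (rule continuous_open_preimage [OF chart_facts(3,1) open_ball])
    show "\<one> \<in> fst c \<inter> snd c -` ball x0 \<rho>"
      using chart \<rho> by (simp add: x0_def)
    fix x u assume x: "x \<in> fst c \<inter> snd c -` ball x0 \<rho>" and u: "u \<in> S"
    then have "\<phi> (snd c x) *v u \<in> S"
      by (intro in_S) auto
    then show "\<tau> x *v u \<in> S"
      using x chart_facts(5) [of x] by simp
  qed
qed

end

section \<open>From the Lie group to its image\<close>

lemma span_scale_singleton:
  fixes v :: "complex^'n"
  assumes "z \<noteq> 0"
  shows "vec.span {z *s v} = vec.span {v}"
proof (intro equalityI vec.span_minimal vec.subspace_span)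
  show "{z *s v} \<subseteq> vec.span {v}"
    by (simp add: vec.span_base vec.span_scale)
  have "inverse z *s (z *s v) \<in> vec.span {z *s v}"
    by (intro vec.span_scale vec.span_base) simp
  then show "{v} \<subseteq> vec.span {z *s v}"
    using assms by (simp add: vector_smult_assoc)
qed

lemma span_matrix_image:
  fixes g :: "complex^'n^'n"
  shows "vec.span {g *v v} = (*v) g ` vec.span {v}"
  using vec.linear_span_image [OF matrix_vector_mul_linear_gen, of g "{v}"] by simp

lemma i_su_selfadj:
  assumes h: "hermitian_product h" and X: "X \<in> (\<lambda>X. mat \<i> ** X) ` su h"
  shows "hermitian.selfadj h X"
proof -
  interpret hermitian h
    by (rule hermitian.intro [OF h])
  obtain Y where Y: "X = mat \<i> ** Y" "\<And>v w. h (Y *v v) w + h v (Y *v w) = 0"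
    using X by (auto simp: su_def)
  have "mat \<i> *v w = \<i> *s w" for w :: "complex^'a"
    by (simp add: vec_eq_iff matrix_vector_mult_def mat_def if_distrib if_distribR cong: if_cong)
  then have "h (X *v v) w = h v (X *v w)" for v w
    using eq_neg_iff_add_eq_0 [THEN iffD2, OF Y(2) [of v w]]
    by (simp add: Y(1) h_simps flip: matrix_vector_mul_assoc)
  then show ?thesis
    by (simp add: selfadj_def)
qed

theorem theorem3:
  fixes G :: "'g::{t2_space,second_countable_topology} monoid"
    and A :: "('g, 'e::euclidean_space) chart set"
    and c :: "('g, 'e) chart"
    and K :: "'g set" and p :: "'e set"
    and \<tau> :: "'g \<Rightarrow> complex^'n^'n"
    and h :: "complex^'n \<Rightarrow> complex^'n \<Rightarrow> complex"
    and G\<^sub>V K\<^sub>V p\<^sub>V a P :: "(complex^'n^'n) set"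
    and s :: "complex^'n^'n \<Rightarrow> complex^'n^'n \<Rightarrow> real"
    and Orb' Orb :: "(complex^'n) set set"
  assumes "lie_group G A" and "connected (UNIV :: 'g set)" and "\<not> compact (UNIV :: 'g set)"
    and "c \<in> A" and "\<one>\<^bsub>G\<^esub> \<in> fst c"
    and "lie_semisimple (lie_bracket G c)"
    and "finite (group_center G)"
    and "maximal_compact_subgroup G K"
    and "cartan_decomposition (lie_bracket G c) (lie_subalgebra_of G c K) p"
    and "irreducible_SL_representation G A \<tau>"
    and "G\<^sub>V = range \<tau>" and "K\<^sub>V = \<tau> ` K" and "p\<^sub>V = rep_derivative G c \<tau> ` p"
    and "hermitian_product h" and "compatible h G\<^sub>V K\<^sub>V p\<^sub>V"
    and "invariant_scalar_product K\<^sub>V p\<^sub>V s"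
    and "closed_orbit (zariski_closure_SL G\<^sub>V) Orb'"
    and "closed_orbit G\<^sub>V Orb" and "Orb \<subseteq> Orb'"
    and "maximal_abelian_in p\<^sub>V a"
    and "P = abelian_gradient_map h p\<^sub>V s a ` proj_space"
  shows "P = abelian_gradient_map h p\<^sub>V s a ` Orb \<and>
    (\<exists>f. bij_betw f (faces_mod_weyl K\<^sub>V a P)
           (parabolic_irreps G\<^sub>V p\<^sub>V // irrep_equiv G\<^sub>V K\<^sub>V p\<^sub>V))"
proof -
  interpret rep: connected_lie_group_rep G A c \<tau>
    by (rule connected_lie_group_rep.intro) (fact assms)+
  have K: "subgroup K G" "compact K"
    using assms(8) by (auto simp: maximal_compact_subgroup_def)
  have compat: "K\<^sub>V \<subseteq> SU h" "p\<^sub>V \<subseteq> (\<lambda>X. mat \<i> ** X) ` su h"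
    "range \<tau> = {k ** mexp \<beta> | k \<beta>. k \<in> K\<^sub>V \<and> \<beta> \<in> p\<^sub>V}"
    using assms(11,15) by (auto simp: compatible_def)
  have "polar_group h (range \<tau>) K\<^sub>V p\<^sub>V"
  proof (intro polar_group.intro hermitian.intro polar_group_axioms.intro assms(14))
    show "f ** g \<in> range \<tau>" if "f \<in> range \<tau>" "g \<in> range \<tau>" for f g
      using that by (auto simp flip: rep.rep_mult)
    show "det g = 1" if "g \<in> range \<tau>" for g
      using that rep.rep_det by auto
    show "mat 1 \<in> K\<^sub>V"
      using subgroup.one_closed [OF K(1)] rep.rep_one by (force simp: assms(12))
    show "k ** k' \<in> K\<^sub>V" if "k \<in> K\<^sub>V" "k' \<in> K\<^sub>V" for k k'
      using that subgroup.m_closed [OF K(1)] by (auto simp: assms(12) simp flip: rep.rep_mult)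
    show "\<exists>k'\<in>K\<^sub>V. k ** k' = mat 1" if "k \<in> K\<^sub>V" for k
      using that subgroup.m_inv_closed [OF K(1)] rep.rep_inv(1) by (auto simp: assms(12))
    show "compact K\<^sub>V"
      unfolding assms(12)
      by (intro compact_continuous_image continuous_on_subset [OF rep.rep_continuous] K subset_UNIV)
    show "h (k *v v) (k *v w) = h v w" if "k \<in> K\<^sub>V" for k v w
      using that compat(1) by (auto simp: SU_def)
    show "subspace p\<^sub>V"
      using assms(9) unfolding assms(13) cartan_decomposition_def
      by (intro linear_subspace_image rep.linear_rep_derivative) auto
    show "hermitian.selfadj h \<beta>" if "\<beta> \<in> p\<^sub>V" for \<beta>
      using that compat(2) by (intro i_su_selfadj assms(14)) auto
  qed (rule compat(3))
  then interpret polar_group h "range \<tau>" K\<^sub>V p\<^sub>V .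
  interpret compatible_lie_group_rep G A c \<tau> h K\<^sub>V p\<^sub>V ..
  interpret moment_setting h "range \<tau>" K\<^sub>V p\<^sub>V s a
    by unfold_locales (use tangent_invariant_subspace assms in auto)
  obtain b l where b: "onb b" "\<And>X i. X \<in> a \<Longrightarrow> X *v b i = l i X *\<^sub>R b i"
    using joint_eigenbasis [of a] a_commute a_subset_p p_selfadj by metis
  interpret weight_basis h "range \<tau>" K\<^sub>V p\<^sub>V s a b l
    by unfold_locales (use b in auto)
  have "moment_polytope = abelian_gradient_map h p\<^sub>V s a ` Orb"
  proof
    obtain v1 where v1: "v1 \<noteq> 0" "Orb = proj_orbit (range \<tau>) (vec.span {v1})"
      and Orb: "Orb \<subseteq> proj_space" "closedin (top_of_set (- {0})) {v. v \<noteq> 0 \<and> vec.span {v} \<in> Orb}"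
      using assms(18) by (auto simp: closed_orbit_def closed_in_proj_def proj_space_def assms(11))
    \<comment> \<open>the cone over the closed orbit, without its vertex\<close>
    define \<Omega> where "\<Omega> = {v. v \<noteq> 0 \<and> vec.span {v} \<in> Orb}"
    have \<tau>_ne: "\<tau> x *v v \<noteq> 0" if "v \<noteq> 0" for x v
    proof
      assume "\<tau> x *v v = 0"
      then have "\<tau> (inv\<^bsub>G\<^esub> x) *v (\<tau> x *v v) = 0"
        by simp
      then show False
        using that by (simp add: matrix_vector_mul_assoc rep.rep_inv)
    qed
    have orbit: "\<tau> x *v v \<in> \<Omega>" if v: "v \<in> \<Omega>" for x v
    proof -
      obtain y where y: "vec.span {v} = (*v) (\<tau> y) ` vec.span {v1}" "v \<noteq> 0"
        using v by (auto simp: \<Omega>_def v1(2) proj_orbit_def)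
      have "vec.span {\<tau> x *v v} = (*v) (\<tau> x) ` (*v) (\<tau> y) ` vec.span {v1}"
        by (simp add: span_matrix_image y(1))
      also have "\<dots> = (*v) (\<tau> (x \<otimes>\<^bsub>G\<^esub> y)) ` vec.span {v1}"
        by (simp add: image_image matrix_vector_mul_assoc rep.rep_mult)
      finally show ?thesis
        using \<tau>_ne [OF y(2)] by (auto simp: \<Omega>_def v1(2) proj_orbit_def)
    qed
    have "v1 \<in> \<Omega>"
    proof -
      have "vec.span {v1} = (*v) (\<tau> \<one>\<^bsub>G\<^esub>) ` vec.span {v1}"
        by (simp add: rep.rep_one)
      then show ?thesis
        using v1 by (auto simp: \<Omega>_def proj_orbit_def)
    qed
    have "\<exists>x. \<forall>i. \<tau> x *v v1 \<notin> {v. h v (b i) = 0}"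
    proof (rule rep.generic_orbit_point [OF v1(1)])
      show "vec.subspace {v. h v (b i) = 0}" for i
        by (auto simp: vec.subspace_def h_simps)
      have "h (b i) (b i) \<noteq> 0" for i
        by (simp add: onb_orthonormal [OF b(1)])
      then show "{v. h v (b i) = 0} \<noteq> UNIV" for i
        by blast
    qed
    then obtain x0 where x0: "\<And>i. h (\<tau> x0 *v v1) (b i) \<noteq> 0"
      by auto
    show "moment_polytope \<subseteq> abelian_gradient_map h p\<^sub>V s a ` Orb"
    proof
      fix x assume x: "x \<in> moment_polytope"
      obtain v where "v \<in> \<Omega>" "v \<noteq> 0" "mu v = x"
      proof (rule polytope_attained_on_invariant_cone [OF _ _ _ orbit [OF \<open>v1 \<in> \<Omega>\<close>] x0 x])
        show "closedin (top_of_set (- {0})) \<Omega>"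
          unfolding \<Omega>_def by (rule Orb(2))
        show "r *\<^sub>R v \<in> \<Omega>" if "v \<in> \<Omega>" "r > 0" for v r
          using that span_scale_singleton [of "complex_of_real r" v] by (simp add: \<Omega>_def scaleR_eq_scale)
        show "mexp Z *v v \<in> \<Omega>" if "v \<in> \<Omega>" "Z \<in> a" for v Z
          using orbit [OF that(1)] mexp_in_G [OF a_subset_p [OF that(2)]] by auto
      qed
      then show "x \<in> abelian_gradient_map h p\<^sub>V s a ` Orb"
        by (auto simp: \<Omega>_def)
    qed
    show "abelian_gradient_map h p\<^sub>V s a ` Orb \<subseteq> moment_polytope"
      using Orb(1) by (rule image_mono)
  qed
  then show ?thesis
    using faces_irreps_bijection assms(11,21) by simp
qed

end
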